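(* There exists a universal constant $c>0$ such that the following holds. Let $G\subset\mathbb{R}^n$ be open, let $\mu$ be a Borel probability measure on $G$ satisfying a logarithmic Sobolev inequality with constant $\sigma^2>0$ (where $\sigma>0$), let $d\in\mathbb{N}$, $d\geq 1$, and let $f:G\to\mathbb{R}$ be a $\mathcal{C}^d$-smooth function with $\int_G f\,d\mu=0$. If $$\lVert f^{(k)}\rVert_{\mathrm{Op},2}\le\min(1,\sigma^{d-k})\quad\text{for all }k=1,\dots,d-1\qquad\text{and}\qquad \lVert f^{(d)}\rVert_{\mathrm{Op},\infty}\le 1,$$ then $$\int_G\exp\Big\{\frac{c}{\sigma^2}|f|^{2/d}\Big\}\,d\mu\le 2.$$
   Context: $\mu$ satisfies a logarithmic Sobolev inequality with constant $\sigma^2$ if $\mathrm{Ent}_\mu(g^2)\le 2\sigma^2\int|\nabla g|^2\,d\mu$ for every bounded smooth function $g$ on $G$, where $\mathrm{Ent}_\mu(g^2)=\int g^2\log g^2\,d\mu-\int g^2\,d\mu\,\log\int g^2\,d\mu$. $f^{(k)}(x)$ is the hypermatrix of $k$-th order partial derivatives $\partial_{i_1\dots i_k}f(x)$, viewed as a symmetric $k$-linear form, with operator norm $|f^{(k)}(x)|_{\mathrm{Op}}=\sup\{f^{(k)}(x)[v_1,\dots,v_k]:|v_1|=\dots=|v_k|=1\}$. $\lVert f^{(k)}\rVert_{\mathrm{Op},p}=(\int_G|f^{(k)}|_{\mathrm{Op}}^p\,d\mu)^{1/p}$, with the $L^\infty(\mu)$-norm for $p=\infty$. "Universal" means $c$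 does not depend on $n,d,G,\mu,\sigma,f$. *)

theory Defs
  imports "HOL-Analysis.Analysis" "HOL-Probability.Probability"
begin

text \<open>
  The dimension \<open>n\<close> is quantified inside the main statement (the constant does not depend on it), so
  the space of \<open>n\<close>-dimensional real vectors is the carrier of the library topology
  \<^const>\<open>Euclidean_space\<close>: functions \<open>nat \<Rightarrow> real\<close> vanishing at all indices \<open>\<ge> n\<close>. This topology is the
  subspace topology of the product topology on \<open>nat \<Rightarrow> real\<close>, hence \<^const>\<open>continuous_on\<close> and
  \<open>restrict_space borel\<close> on such sets have their usual Euclidean meaning. The Euclidean norm of \<open>v\<close>
  is \<open>L2_set v {..<n}\<close>.
\<close>

definition partial_deriv :: "nat \<Rightarrow> ((nat \<Rightarrow> real) \<Rightarrow> real) \<Rightarrow> (nat \<Rightarrow> real) \<Rightarrow> real" where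
  "partial_deriv i f x = deriv (\<lambda>t. f (x(i := t))) (x i)"

primrec partial_derivs :: "nat list \<Rightarrow> ((nat \<Rightarrow> real) \<Rightarrow> real) \<Rightarrow> (nat \<Rightarrow> real) \<Rightarrow> real" where
  "partial_derivs [] f = f"
| "partial_derivs (i # is) f = partial_deriv i (partial_derivs is f)"

definition C_diff_on :: "nat \<Rightarrow> nat \<Rightarrow> (nat \<Rightarrow> real) set \<Rightarrow> ((nat \<Rightarrow> real) \<Rightarrow> real) \<Rightarrow> bool" where
  "C_diff_on n d G f \<longleftrightarrow>
     (\<forall>is. set is \<subseteq> {..<n} \<and> length is \<le> d \<longrightarrow> continuous_on G (partial_derivs is f)) \<and>
     (\<forall>is. set is \<subseteq> {..<n} \<and> length is < d \<longrightarrow>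
        (\<forall>i<n. \<forall>x\<in>G. (\<lambda>t. partial_derivs is f (x(i := t))) field_differentiable at (x i)))"

definition gradient_norm :: "nat \<Rightarrow> ((nat \<Rightarrow> real) \<Rightarrow> real) \<Rightarrow> (nat \<Rightarrow> real) \<Rightarrow> real" where
  "gradient_norm n g x = L2_set (\<lambda>i. partial_deriv i g x) {..<n}"

text \<open>The value of the form with coefficient hypermatrix \<open>A\<close> at the vectors \<open>v 0, \<dots>, v (k - 1)\<close>.\<close>
definition multilinear_form ::
    "nat \<Rightarrow> nat \<Rightarrow> (nat list \<Rightarrow> real) \<Rightarrow> (nat \<Rightarrow> nat \<Rightarrow> real) \<Rightarrow> real" where
  "multilinear_form n k A v =
     (\<Sum>is | length is = k \<and> set is \<subseteq> {..<n}. A is * (\<Prod>j<k. v j (is ! j)))"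

definition op_norm :: "nat \<Rightarrow> nat \<Rightarrow> (nat list \<Rightarrow> real) \<Rightarrow> real" where
  "op_norm n k A =
     Sup {multilinear_form n k A v | v.
            \<forall>j<k. v j \<in> topspace (Euclidean_space n) \<and> L2_set (v j) {..<n} = 1}"

definition deriv_op_norm :: "nat \<Rightarrow> nat \<Rightarrow> ((nat \<Rightarrow> real) \<Rightarrow> real) \<Rightarrow> (nat \<Rightarrow> real) \<Rightarrow> real" where
  "deriv_op_norm n k f x = op_norm n k (\<lambda>is. partial_derivs is f x)"

text \<open>The norm takes values in \<^typ>\<open>ennreal\<close>, so that an infinite integral gives an infinite norm.\<close>
definition Lp_norm :: "'a measure \<Rightarrow> ennreal \<Rightarrow> ('a \<Rightarrow> real) \<Rightarrow> ennreal" where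
  "Lp_norm M p h =
     (if p = \<infinity> then esssup M (\<lambda>x. ennreal \<bar>h x\<bar>)
      else let I = (\<integral>\<^sup>+ x. ennreal (\<bar>h x\<bar> powr enn2real p) \<partial>M)
           in if I = \<infinity> then \<infinity> else ennreal (enn2real I powr (1 / enn2real p)))"

text \<open>Only used for nonnegative bounded measurable \<open>h\<close>; the convention \<open>0 log 0 = 0\<close> is built in.\<close>
definition Ent :: "'a measure \<Rightarrow> ('a \<Rightarrow> real) \<Rightarrow> real" where
  "Ent M h = (\<integral>x. h x * ln (h x) \<partial>M) - (\<integral>x. h x \<partial>M) * ln (\<integral>x. h x \<partial>M)"

text \<open>
  The right-hand side is a Lebesgue integral in \<^typ>\<open>ennreal\<close>: the inequality is void for those \<open>g\<close>
  whose gradient is not square integrable.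
\<close>
definition log_sobolev :: "nat \<Rightarrow> (nat \<Rightarrow> real) set \<Rightarrow> (nat \<Rightarrow> real) measure \<Rightarrow> real \<Rightarrow> bool" where
  "log_sobolev n G M s \<longleftrightarrow>
     (\<forall>g. (\<forall>d. C_diff_on n d G g) \<and> bounded (g ` G) \<longrightarrow>
        ennreal (Ent M (\<lambda>x. (g x)\<^sup>2)) \<le>
          ennreal (2 * s) * (\<integral>\<^sup>+ x. ennreal ((gradient_norm n g x)\<^sup>2) \<partial>M))"

end

theory Submission
  imports Defs
begin

text \<open>
  The logarithmic Sobolev inequality is assumed for smooth bounded functions only. A Whitney-type
  approximation (uniform in the function and its gradient, on an arbitrary open \<open>G\<close>) extends it to
  continuously differentiable functions; testing it with \<open>1 + t F\<close> gives the Poincare inequality, and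
  integrating the derivative of \<open>p \<mapsto> \<parallel>u\<parallel>\<^sub>p\<^sup>2\<close> gives the Aida--Stroock bound
  \<open>\<parallel>u\<parallel>\<^sub>p\<^sup>2 \<le> \<parallel>u\<parallel>\<^sub>2\<^sup>2 + \<sigma>\<^sup>2 (p - 2) \<parallel>\<nabla>u\<parallel>\<^sub>p\<^sup>2\<close>. Since the operator norm of the \<open>k\<close>-th derivative is a supremum of
  functions whose gradients are bounded by the operator norm of the \<open>(k + 1)\<close>-st derivative, the bound
  iterates without dimensional loss to \<open>\<parallel>f\<parallel>\<^sub>p \<le> 4 \<sigma>\<^sup>d p\<^bsup>d/2\<^esup>\<close> for \<open>p \<ge> 4\<close>, and summing the exponential
  series yields the claim with \<open>c = 1/288\<close>.
\<close>

subsection \<open>Partial derivatives and open sets\<close>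

text \<open>The functions to be tested, such as powers \<open>u powr (s / 2)\<close>, truncations
  and soft maxima of forms in the derivatives of \<open>f\<close>, are in general only C1, so the
  extension to C1 has to come before everything else. \<open>G\<close> is an arbitrary open set on
  which nothing need extend, hence the approximation is local and glued by a partition of unity; on
  a probability space a uniform error in value and gradient is small enough. The operator norm need
  not be differentiable; soft maxima of finitely many forms take its place. With s = sqrt (p - 2),
  the inequality norm_p(u) \<le> norm_2(u) + \<sigma> s norm_p(grad u) runs from order d down to
  order 0 and leaves \<sigma>^d times the sum of s^j over j \<le> d, which is at most 4 s^d once s
  \<ge> 4/3; this is why p \<ge> 4. The L2 norms of the derivatives are hypotheses; that of
  \<open>f\<close> comes from the Poincare inequality. In the exponential series 96 = 4^2 * 2 * 3
  collects the growth of the moments, and 288 = 3 * 96 leaves a geometric majorant of ratio 1/3 that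
  sums to exactly 2.\<close>

abbreviation has_partial :: "nat \<Rightarrow> ((nat \<Rightarrow> real) \<Rightarrow> real) \<Rightarrow> (nat \<Rightarrow> real) \<Rightarrow> real \<Rightarrow> bool" where
  "has_partial i g x D \<equiv> ((\<lambda>t. g (x(i := t))) has_real_derivative D) (at (x i))"

lemma has_partial_imp_eq: "has_partial i g x D \<Longrightarrow> partial_deriv i g x = D"
  by (simp add: partial_deriv_def DERIV_imp_deriv)

text \<open>Boxes rather than Euclidean balls: changing one coordinate within its range stays in the
  box, so all estimates can be made along coordinate lines. Coordinates from \<open>n\<close> on are
  pinned to 0, which makes the box a compact subset of the carrier.\<close>

definition cube :: "nat \<Rightarrow> (nat \<Rightarrow> real) \<Rightarrow> real \<Rightarrow> (nat \<Rightarrow> real) set" where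
  "cube n z r = {y. (\<forall>i\<ge>n. y i = 0) \<and> (\<forall>i<n. \<bar>y i - z i\<bar> \<le> r)}"

text \<open>A basic product neighbourhood prescribes an open factor for every index. Only the
  indices below \<open>n\<close> cost a positive radius, because points of the space vanish at the
  others, and a minimum of finitely many radii remains.\<close>

lemma openin_Euclidean_space_imp_cube:
  assumes "openin (Euclidean_space n) G" "x \<in> G"
  obtains r where "r > 0" "cube n x r \<subseteq> G"
proof -
  obtain T where T: "openin (powertop_real UNIV) T" and G: "G = T \<inter> {x. \<forall>i\<ge>n. x i = 0}"
    using assms(1) unfolding Euclidean_space_def openin_subtopology by blast
  have "x \<in> T" using assms G by auto
  obtain X where X: "x \<in> Pi\<^sub>E UNIV X" "\<And>i. openin euclideanreal (X i)" "Pi\<^sub>E UNIV X \<subseteq> T"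
    using product_topology_open_contains_basis[OF T \<open>x \<in> T\<close>] by auto
  have "\<exists>r>0. \<forall>t. \<bar>t - x i\<bar> \<le> r \<longrightarrow> t \<in> X i" for i
  proof -
    have "open (X i)" "x i \<in> X i" using X by auto
    then obtain e where "e > 0" "cball (x i) e \<subseteq> X i" using open_contains_cball by meson
    then show ?thesis by (intro exI[of _ e]) (auto simp: dist_real_def subset_iff abs_minus_commute)
  qed
  then obtain r where r: "\<And>i. r i > 0" "\<And>i t. \<bar>t - x i\<bar> \<le> r i \<Longrightarrow> t \<in> X i" by metis
  have xs: "x i = 0" if "i \<ge> n" for i using assms G that by auto
  define R where "R = Min (insert 1 (r ` {..<n}))"
  have R: "R > 0" "\<And>i. i < n \<Longrightarrow> R \<le> r i" unfolding R_def using r(1) by (auto intro: Min_le)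
  have "y \<in> G" if "y \<in> cube n x R" for y
  proof -
    have "y i \<in> X i" for i
    proof (cases "i < n")
      case True
      then have "\<bar>y i - x i\<bar> \<le> r i" using that R(2)[of i] unfolding cube_def by force
      then show ?thesis using r(2) by blast
    next
      case False
      then have "y i = x i" using that xs by (auto simp: cube_def)
      then show ?thesis using r(2)[of "y i" i] r(1)[of i] by simp
    qed
    then show ?thesis using G X that by (auto simp: cube_def)
  qed
  then show ?thesis using that R(1) by blast
qed

lemma openin_Euclidean_space_imp_zero:
  "openin (Euclidean_space n) G \<Longrightarrow> x \<in> G \<Longrightarrow> i \<ge> n \<Longrightarrow> x i = 0"
  using openin_subset by (force simp: topspace_Euclidean_space)

lemma eventually_upd_in:
  assumes "openin (Euclidean_space n) G" "x \<in> G" "i < n"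
  shows "\<forall>\<^sub>F t in nhds (x i). x(i := t) \<in> G"
proof -
  obtain r where r: "r > 0" "cube n x r \<subseteq> G"
    using openin_Euclidean_space_imp_cube[OF assms(1,2)] .
  have "\<forall>\<^sub>F t in nhds (x i). dist t (x i) < r" using r(1) by (simp add: eventually_nhds_metric) blast
  then show ?thesis
  proof (rule eventually_mono)
    fix t assume "dist t (x i) < r"
    then have "x(i := t) \<in> cube n x r"
      using openin_Euclidean_space_imp_zero[OF assms(1,2)] assms(3) r(1) by (auto simp: cube_def dist_real_def)
    then show "x(i := t) \<in> G" using r by blast
  qed
qed

lemma has_partial_cong:
  assumes "\<forall>\<^sub>F t in nhds (x i). g (x(i := t)) = h (x(i := t))"
  shows "has_partial i g x D \<longleftrightarrow> has_partial i h x D"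
  by (rule DERIV_cong_ev) (use assms in auto)

lemma has_partial_cong_on:
  assumes "openin (Euclidean_space n) G" "x \<in> G" "i < n" "\<And>y. y \<in> G \<Longrightarrow> g y = h y"
  shows "has_partial i g x D \<longleftrightarrow> has_partial i h x D"
  by (rule has_partial_cong, rule eventually_mono[OF eventually_upd_in[OF assms(1-3)]]) (rule assms(4))

lemma isCont_upd:
  fixes x :: "nat \<Rightarrow> real"
  shows "isCont (\<lambda>t. x(i := t)) a"
proof -
  have "continuous_on UNIV (\<lambda>t. (x(i := t)) j)" for j
    by (cases "j = i") auto
  then have "continuous_on UNIV (\<lambda>t. x(i := t))"
    by (rule continuous_on_coordinatewise_then_product)
  then show ?thesis by (simp add: continuous_on_eq_continuous_at)
qed

text \<open>Companion of \<open>eventually_upd_in\<close> for sets that are open in the whole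
  function space, such as the cylinders that carry the partition of unity.\<close>

lemma eventually_upd_in_open:
  fixes x :: "nat \<Rightarrow> real"
  assumes "open U" "x \<in> U"
  shows "\<forall>\<^sub>F t in nhds (x i). x(i := t) \<in> U"
proof -
  have "\<forall>\<^sub>F t in at (x i). x(i := t) \<in> U"
    using isCont_upd[where x = x and i = i and a = "x i"] assms unfolding isCont_def by (intro topological_tendstoD) auto
  then show ?thesis using assms by (auto simp: eventually_at_filter elim: eventually_mono)
qed

lemma continuous_on_coord: "continuous_on S (\<lambda>x::nat\<Rightarrow>real. x i)"
  by (rule continuous_on_subset[OF continuous_on_product_coordinates subset_UNIV])

text \<open>The partial derivatives are carried as explicit data \<open>D\<close>, so that chain and
  product rules hand over formulas instead of \<open>partial_deriv\<close> terms, and gradient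
  bounds can be stated for those formulas.\<close>

definition C1_on ::
    "nat \<Rightarrow> (nat \<Rightarrow> real) set \<Rightarrow> ((nat \<Rightarrow> real) \<Rightarrow> real) \<Rightarrow> (nat \<Rightarrow> (nat \<Rightarrow> real) \<Rightarrow> real) \<Rightarrow> bool" where
  "C1_on n G g D \<longleftrightarrow> continuous_on G g \<and>
     (\<forall>i<n. continuous_on G (D i) \<and> (\<forall>x\<in>G. has_partial i g x (D i x)))"

subsection \<open>Smooth functions\<close>

text \<open>Coinduction for smoothness: a class closed under partial derivatives contains only
  functions that are differentiable to every order. Equality is asked for on \<open>G\<close> alone,
  since derivatives at points of an open set see only nearby values; each iterated derivative is
  therefore traded for a member of \<open>S\<close> agreeing with it on \<open>G\<close>.\<close>

lemma C_diff_on_coinduct: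
  assumes G: "openin (Euclidean_space n) G" and "g \<in> S"
    and cont: "\<And>g. g \<in> S \<Longrightarrow> continuous_on G g"
    and step: "\<And>g i. g \<in> S \<Longrightarrow> i < n \<Longrightarrow> \<exists>h\<in>S. \<forall>x\<in>G. has_partial i g x (h x)"
  shows "C_diff_on n d G g"
proof -
  have *: "\<exists>h\<in>S. \<forall>x\<in>G. partial_derivs is g x = h x" if "set is \<subseteq> {..<n}" for "is"
    using that
  proof (induction "is")
    case Nil
    then show ?case using \<open>g \<in> S\<close> by auto
  next
    case (Cons i "is")
    then obtain h where h: "h \<in> S" "\<forall>x\<in>G. partial_derivs is g x = h x" by auto
    have "i < n" using Cons by auto
    then obtain k where k: "k \<in> S" "\<forall>x\<in>G. has_partial i h x (k x)" using step h by blast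
    have "partial_derivs (i # is) g x = k x" if "x \<in> G" for x
      using has_partial_cong_on[OF G that \<open>i < n\<close>, of "partial_derivs is g" h "k x"] h k that
      by (auto intro: has_partial_imp_eq)
    then show ?case using k by auto
  qed
  have "continuous_on G (partial_derivs is g)" if "set is \<subseteq> {..<n}" for "is"
    using *[OF that] cont by (metis (no_types, lifting) continuous_on_cong)
  moreover have "(\<lambda>t. partial_derivs is g (x(i := t))) field_differentiable at (x i)"
    if isn: "set is \<subseteq> {..<n}" and x: "x \<in> G" "i < n" for x i "is"
  proof -
    obtain h where h: "h \<in> S" "\<forall>x\<in>G. partial_derivs is g x = h x" using *[OF isn] by auto
    obtain k where k: "\<forall>x\<in>G. has_partial i h x (k x)" using step h x by blast
    have "has_partial i (partial_derivs is g) x (k x)"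
      using has_partial_cong_on[OF G x, of "partial_derivs is g" h "k x"] h k x by auto
    then show ?thesis by (auto simp: field_differentiable_def)
  qed
  ultimately show ?thesis by (auto simp: C_diff_on_def)
qed

text \<open>The powers \<open>(1 / t) ^ k\<close> make this family closed under differentiation: the
  derivative of a member is a linear combination of two members.\<close>

definition flat :: "nat \<Rightarrow> real \<Rightarrow> real" where
  "flat k t = (if t > 0 then (1 / t) ^ k * exp (- (1 / t)) else 0)"

lemma flat_tendsto_0: "((\<lambda>t. flat k t) \<longlongrightarrow> 0) (at_right 0)"
proof -
  have "((\<lambda>s::real. s ^ k / exp s) \<longlongrightarrow> 0) at_top" by (rule tendsto_power_div_exp_0)
  then have "((\<lambda>t::real. inverse t ^ k / exp (inverse t)) \<longlongrightarrow> 0) (at_right 0)"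
    by (rule filterlim_compose[OF _ filterlim_inverse_at_top_right])
  then show ?thesis
    by (rule Lim_transform_eventually)
       (auto simp: flat_def eventually_at_filter exp_minus divide_simps)
qed

text \<open>Only t = 0 is delicate: there the difference quotient from the right is
  \<open>flat (k + 1)\<close>, which tends to 0.\<close>

lemma has_real_derivative_flat:
  "(flat k has_real_derivative flat (k + 2) t - real k * flat (k + 1) t) (at t)"
proof -
  consider "t > 0" | "t < 0" | "t = 0" by linarith
  then show ?thesis
  proof cases
    case 1
    have "((\<lambda>t. (1 / t) ^ k * exp (- (1 / t))) has_real_derivative
            flat (k + 2) t - real k * flat (k + 1) t) (at t)"
    proof (rule DERIV_cong)
      have "((\<lambda>t. 1 / t) has_real_derivative - ((1 / t)\<^sup>2)) (at t)"
        using 1 by (auto intro!: derivative_eq_intros simp: power2_eq_square)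
      from DERIV_mult[OF DERIV_power[OF this, of k] DERIV_chain2[OF DERIV_exp DERIV_minus[OF this]]]
      show "((\<lambda>t. (1 / t) ^ k * exp (- (1 / t))) has_real_derivative
          real k * (- ((1 / t)\<^sup>2) * (1 / t) ^ (k - Suc 0)) * exp (- (1 / t)) +
          exp (- (1 / t)) * - (- ((1 / t)\<^sup>2)) * (1 / t) ^ k) (at t)" .
      show "real k * (- ((1 / t)\<^sup>2) * (1 / t) ^ (k - Suc 0)) * exp (- (1 / t)) +
          exp (- (1 / t)) * - (- ((1 / t)\<^sup>2)) * (1 / t) ^ k
        = flat (k + 2) t - real k * flat (k + 1) t"
        using 1 unfolding flat_def by (cases k) (simp_all add: power2_eq_square algebra_simps)
    qed
    moreover have "\<forall>\<^sub>F x in nhds t. flat k x = (1 / x) ^ k * exp (- (1 / x))"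
      using 1 by (auto simp: flat_def intro!: eventually_nhds_in_open[of "{0<..}", THEN eventually_mono])
    ultimately show ?thesis by (subst DERIV_cong_ev[OF refl _ refl])
  next
    case 2
    have "\<forall>\<^sub>F x in nhds t. flat k x = 0"
      using 2 by (auto simp: flat_def intro!: eventually_nhds_in_open[of "{..<0}", THEN eventually_mono])
    then have "(flat k has_real_derivative 0) (at t)"
      by (subst DERIV_cong_ev[where g = "\<lambda>_. 0"]) auto
    then show ?thesis using 2 by (simp add: flat_def)
  next
    case 3
    have "((\<lambda>h. flat k h / h) \<longlongrightarrow> 0) (at_right 0)"
      by (rule Lim_transform_eventually[OF flat_tendsto_0[of "Suc k"]])
         (auto simp: flat_def eventually_at_filter)
    moreover have "((\<lambda>h. flat k h / h) \<longlongrightarrow> 0) (at_left 0)"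
      by (rule Lim_transform_eventually[of "\<lambda>_. 0"]) (auto simp: flat_def eventually_at_filter)
    ultimately have "((\<lambda>h. flat k h / h) \<longlongrightarrow> 0) (at 0)"
      by (simp add: filterlim_split_at)
    then show ?thesis using 3 by (simp add: has_field_derivative_iff flat_def)
  qed
qed

lemma continuous_on_flat: "continuous_on S (flat k)"
  by (intro continuous_at_imp_continuous_on ballI DERIV_isCont[OF has_real_derivative_flat])

text \<open>A class of globally smooth functions that is closed under partial derivatives and rich enough to
  contain bump functions.\<close>
inductive_set elem_smooth :: "((nat \<Rightarrow> real) \<Rightarrow> real) set" where
  const: "(\<lambda>x. c) \<in> elem_smooth"
| coord: "(\<lambda>x. x i) \<in> elem_smooth"
| flat: "g \<in> elem_smooth \<Longrightarrow> (\<lambda>x. flat k (g x)) \<in> elem_smooth"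
| add: "g \<in> elem_smooth \<Longrightarrow> h \<in> elem_smooth \<Longrightarrow> (\<lambda>x. g x + h x) \<in> elem_smooth"
| mult: "g \<in> elem_smooth \<Longrightarrow> h \<in> elem_smooth \<Longrightarrow> (\<lambda>x. g x * h x) \<in> elem_smooth"
| inv: "g \<in> elem_smooth \<Longrightarrow> (\<And>x. g x \<noteq> 0) \<Longrightarrow> (\<lambda>x. inverse (g x)) \<in> elem_smooth"

lemma elem_smooth_minus: "g \<in> elem_smooth \<Longrightarrow> h \<in> elem_smooth \<Longrightarrow> (\<lambda>x. g x - h x) \<in> elem_smooth"
  using elem_smooth.add[OF _ elem_smooth.mult[OF elem_smooth.const[of "-1"]], of g h] by simp

lemma elem_smooth_divide:
  "g \<in> elem_smooth \<Longrightarrow> h \<in> elem_smooth \<Longrightarrow> (\<And>x. h x \<noteq> 0) \<Longrightarrow> (\<lambda>x. g x / h x) \<in> elem_smooth"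
  by (simp add: divide_inverse elem_smooth.mult elem_smooth.inv)

lemma elem_smooth_sum:
  "(\<And>a. a \<in> A \<Longrightarrow> g a \<in> elem_smooth) \<Longrightarrow> (\<lambda>x. \<Sum>a\<in>A. g a x) \<in> elem_smooth"
  by (induction A rule: infinite_finite_induct) (auto intro: elem_smooth.intros)

lemma elem_smooth_prod:
  "(\<And>a. a \<in> A \<Longrightarrow> g a \<in> elem_smooth) \<Longrightarrow> (\<lambda>x. \<Prod>a\<in>A. g a x) \<in> elem_smooth"
  by (induction A rule: infinite_finite_induct) (auto intro: elem_smooth.intros)

lemma elem_smooth_continuous: "g \<in> elem_smooth \<Longrightarrow> continuous_on S g"
proof (induction rule: elem_smooth.induct)
  case (flat g k)
  show ?case by (rule continuous_on_compose2[OF continuous_on_flat[of UNIV] flat.IH]) auto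
qed (auto intro!: continuous_intros continuous_on_coord)

lemma elem_smooth_deriv: "g \<in> elem_smooth \<Longrightarrow> \<exists>h\<in>elem_smooth. \<forall>x. has_partial i g x (h x)"
proof (induction rule: elem_smooth.induct)
  case (const c)
  show ?case by (rule bexI[of _ "\<lambda>_. 0"]) (auto intro: elem_smooth.intros)
next
  case (coord j)
  show ?case
    by (rule bexI[of _ "\<lambda>_. if i = j then 1 else 0"]) (auto intro: elem_smooth.intros)
next
  case (flat g k)
  then obtain h where h: "h \<in> elem_smooth" "\<And>x. has_partial i g x (h x)" by blast
  show ?case
  proof (intro bexI allI)
    show "has_partial i (\<lambda>x. flat k (g x)) x ((flat (k + 2) (g x) - real k * flat (k + 1) (g x)) * h x)" for x
      using DERIV_chain2[OF has_real_derivative_flat h(2)[of x], of k] by simp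
  qed (intro elem_smooth.intros elem_smooth_minus flat h)
next
  case (add g h)
  then obtain g' h' where *: "g' \<in> elem_smooth" "\<And>x. has_partial i g x (g' x)"
    "h' \<in> elem_smooth" "\<And>x. has_partial i h x (h' x)" by blast
  show ?case by (intro bexI allI, rule DERIV_add[OF *(2) *(4)]) (rule elem_smooth.add[OF *(1,3)])
next
  case (mult g h)
  then obtain g' h' where *: "g' \<in> elem_smooth" "\<And>x. has_partial i g x (g' x)"
    "h' \<in> elem_smooth" "\<And>x. has_partial i h x (h' x)" by blast
  have "has_partial i (\<lambda>x. g x * h x) x (g' x * h x + h' x * g x)" for x
    using DERIV_mult[OF *(2)[of x] *(4)[of x]] by simp
  then show ?case by (intro bexI allI, assumption) (intro elem_smooth.intros * mult)
next
  case (inv g)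
  then obtain g' where *: "g' \<in> elem_smooth" "\<And>x. has_partial i g x (g' x)" by blast
  have "has_partial i (\<lambda>x. inverse (g x)) x ((-1) * (inverse (g x) * g' x * inverse (g x)))" for x
    using DERIV_inverse'[OF *(2)[of x]] inv by simp
  then show ?case by (intro bexI allI, assumption) (intro elem_smooth.intros * inv)
qed

lemma elem_smooth_partial: "g \<in> elem_smooth \<Longrightarrow> has_partial i g x (partial_deriv i g x)"
  using elem_smooth_deriv[of g i] has_partial_imp_eq by metis

text \<open>The locally elementary functions satisfy the coinduction principle: where
  \<open>g\<close> agrees with an elementary \<open>h\<close>, its partial derivative agrees with
  that of \<open>h\<close>, which is elementary again. Working locally admits functions that are
  glued from infinitely many elementary pieces.\<close>

lemma locally_elem_smooth_imp_C_diff_on: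
  assumes G: "openin (Euclidean_space n) G"
    and g: "\<And>x. x \<in> G \<Longrightarrow> \<exists>U h. open U \<and> x \<in> U \<and> h \<in> elem_smooth \<and> (\<forall>y\<in>U \<inter> G. g y = h y)"
  shows "C_diff_on n d G g"
proof -
  define S where "S = {g. \<forall>x\<in>G. \<exists>U h. open U \<and> x \<in> U \<and> h \<in> elem_smooth \<and> (\<forall>y\<in>U \<inter> G. g y = h y)}"
  show ?thesis
  proof (rule C_diff_on_coinduct[OF G, of g S])
    show "g \<in> S" using g by (simp add: S_def)
  next
    fix g assume "g \<in> S"
    show "continuous_on G g"
      unfolding continuous_on_eq_continuous_within
    proof
      fix x assume "x \<in> G"
      then obtain U h where U: "open U" "x \<in> U" "h \<in> elem_smooth" "\<forall>y\<in>U \<inter> G. g y = h y"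
        using \<open>g \<in> S\<close>[unfolded S_def mem_Collect_eq, rule_format, OF \<open>x \<in> G\<close>] by blast
      have "continuous (at x within G) h" using elem_smooth_continuous[OF U(3), of G] \<open>x \<in> G\<close>
        by (simp add: continuous_on_eq_continuous_within)
      moreover have "\<forall>\<^sub>F y in at x within G. h y = g y"
        using U by (auto simp: eventually_at_topological)
      ultimately show "continuous (at x within G) g"
        using U \<open>x \<in> G\<close> unfolding continuous_within by (metis IntI Lim_transform_eventually)
    qed
  next
    fix g i assume "g \<in> S" "i < n"
    have "\<exists>U h. open U \<and> x \<in> U \<and> h \<in> elem_smooth \<and> (\<forall>y\<in>U \<inter> G. has_partial i g y (h y))" if xG: "x \<in> G" for x
    proof -
      obtain U h where U: "open U" "x \<in> U" "h \<in> elem_smooth" "\<forall>y\<in>U \<inter> G. g y = h y"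
        using \<open>g \<in> S\<close>[unfolded S_def mem_Collect_eq, rule_format, OF xG] by blast
      obtain k where k: "k \<in> elem_smooth" "\<forall>x. has_partial i h x (k x)" using elem_smooth_deriv[OF U(3)] by blast
      have "has_partial i g y (k y)" if y: "y \<in> U \<inter> G" for y
      proof -
        have "\<forall>\<^sub>F t in nhds (y i). y(i := t) \<in> U \<and> y(i := t) \<in> G"
          using eventually_upd_in_open[OF U(1), of y i] eventually_upd_in[OF G, of y i] y \<open>i < n\<close>
          by (auto intro: eventually_conj)
        then have "\<forall>\<^sub>F t in nhds (y i). g (y(i := t)) = h (y(i := t))"
          by (rule eventually_mono) (use U in auto)
        then show ?thesis using has_partial_cong k by blast
      qed
      then show ?thesis using U k by blast
    qed
    then obtain U h where Uh: "\<And>x. x \<in> G \<Longrightarrow> open (U x) \<and> x \<in> U x \<and> h x \<in> elem_smooth"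
      "\<And>x y. x \<in> G \<Longrightarrow> y \<in> U x \<inter> G \<Longrightarrow> has_partial i g y (h x y)" by metis
    show "\<exists>h\<in>S. \<forall>x\<in>G. has_partial i g x (h x)"
    proof (intro bexI[of _ "partial_deriv i g"] ballI)
      fix x assume "x \<in> G"
      then show "has_partial i g x (partial_deriv i g x)"
        using Uh(1)[of x] Uh(2)[of x x] has_partial_imp_eq by auto
    next
      have "partial_deriv i g y = h x y" if "x \<in> G" "y \<in> U x \<inter> G" for x y
        using Uh(2)[OF that] by (rule has_partial_imp_eq)
      then show "partial_deriv i g \<in> S" unfolding S_def mem_Collect_eq
        by (intro ballI exI[of _ "U x" for x] exI[of _ "h x" for x] conjI) (use Uh(1) in auto)
    qed
  qed
qed

subsection \<open>Smooth steps and bumps\<close>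

text \<open>The usual smooth step from 0 to 1 on the unit interval. The two flat functions in the
  denominator never vanish together, so the quotient stays in \<open>elem_smooth\<close>.\<close>

definition step :: "real \<Rightarrow> real" where
  "step t = flat 0 t / (flat 0 t + flat 0 (1 - t))"

lemma flat_nonneg: "flat k t \<ge> 0"
  by (simp add: flat_def)

lemma step_denominator_pos: "flat 0 t + flat 0 (1 - t) > 0"
  by (cases "t > 0") (auto simp: flat_def add_pos_nonneg)

lemma step_eq_0: "t \<le> 0 \<Longrightarrow> step t = 0"
  by (simp add: step_def flat_def)

lemma step_eq_1: "t \<ge> 1 \<Longrightarrow> step t = 1"
  using step_denominator_pos[of t] by (simp add: step_def flat_def split: if_splits)

lemma step_nonneg: "0 \<le> step t" and step_le_1: "step t \<le> 1"
  using step_denominator_pos[of t] flat_nonneg[of 0] by (auto simp: step_def divide_simps)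

lemma step_mono: "s \<le> t \<Longrightarrow> step s \<le> step t"
proof -
  assume st: "s \<le> t"
  have flat_mono: "flat 0 a \<le> flat 0 b" if "a \<le> b" for a b
    using that by (auto simp: flat_def frac_le)
  have "flat 0 s * (flat 0 t + flat 0 (1 - t)) \<le> flat 0 t * (flat 0 s + flat 0 (1 - s))"
    using mult_mono[OF flat_mono[OF st] flat_mono[of "1 - t" "1 - s"]] st flat_nonneg
    by (simp add: algebra_simps)
  then show ?thesis using step_denominator_pos[of s] step_denominator_pos[of t]
    by (simp add: step_def divide_simps mult.commute)
qed

lemma elem_smooth_step: "g \<in> elem_smooth \<Longrightarrow> (\<lambda>x. step (g x)) \<in> elem_smooth"
  unfolding step_def using step_denominator_pos
  by (intro elem_smooth_divide elem_smooth.add elem_smooth.flat elem_smooth_minus elem_smooth.const)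
     (auto simp: less_imp_neq[symmetric])

text \<open>The derivative is continuous on [0, 1] and zero outside, hence bounded. The quotient
  rule is spelled out to read off the continuity.\<close>

lemma step_deriv_ex:
  obtains s' C where "\<And>t. (step has_real_derivative s' t) (at t)" "C > 0" "\<And>t. \<bar>s' t\<bar> \<le> C"
    "\<And>t. t < 0 \<or> t > 1 \<Longrightarrow> s' t = 0"
proof -
  define d where "d t = flat 2 t - real 0 * flat 1 t" for t :: real
  define s' where "s' t = (d t * (flat 0 t + flat 0 (1 - t)) - flat 0 t * (d t + d (1 - t) * (-1))) /
     ((flat 0 t + flat 0 (1 - t)) * (flat 0 t + flat 0 (1 - t)))" for t
  have fd: "(flat 0 has_real_derivative d t) (at t)" for t
    using has_real_derivative_flat[of 0 t] by (simp add: d_def numeral_2_eq_2)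
  have fd': "((\<lambda>t. flat 0 (1 - t)) has_real_derivative d (1 - t) * (-1)) (at t)" for t
    by (rule DERIV_chain2[OF fd]) (auto intro!: derivative_eq_intros)
  have der: "(step has_real_derivative s' t) (at t)" for t
    unfolding step_def s'_def
    by (rule DERIV_divide[OF fd DERIV_add[OF fd fd']]) (use step_denominator_pos[of t] in auto)
  have "continuous_on {0..1} (\<lambda>t. flat k (1 - t))" for k
    by (rule continuous_on_compose2[OF continuous_on_flat[of UNIV]]) (auto intro!: continuous_intros)
  then have "continuous_on {0..1} s'" unfolding s'_def d_def
    using step_denominator_pos
    by (intro continuous_intros continuous_on_flat) (auto simp: less_imp_neq[symmetric])
  then have "bounded (s' ` {0..1})" by (intro compact_imp_bounded compact_continuous_image) auto
  then obtain C where C: "C > 0" "\<And>t. t \<in> {0..1} \<Longrightarrow> \<bar>s' t\<bar> \<le> C"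
    unfolding bounded_pos by auto
  have z: "s' t = 0" if "t < 0 \<or> t > 1" for t
  proof -
    have "\<forall>\<^sub>F x in nhds t. step x = step t"
    proof (cases "t < 0")
      case True
      then show ?thesis using step_eq_0
        by (intro eventually_mono[OF eventually_nhds_in_open[of "{..<0}"]]) auto
    next
      case False
      then show ?thesis using step_eq_1 that
        by (intro eventually_mono[OF eventually_nhds_in_open[of "{1<..}"]]) auto
    qed
    then have "(step has_real_derivative 0) (at t)"
      by (subst DERIV_cong_ev[OF refl _ refl]) auto
    then show ?thesis using DERIV_unique der by blast
  qed
  show ?thesis
  proof (rule that[OF der C(1) _ z])
    show "\<bar>s' t\<bar> \<le> C" for t using C z[of t] by (cases "t \<in> {0..1}") auto
  qed
qed

text \<open>A bump supported in [-1, 1] whose integer translates add up to 1, because the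
  differences telescope.\<close>

definition hat :: "real \<Rightarrow> real" where
  "hat t = step (t + 1) - step t"

lemma hat_nonneg: "hat t \<ge> 0"
  using step_mono[of t "t + 1"] by (simp add: hat_def)

lemma hat_eq_0: "\<bar>t\<bar> \<ge> 1 \<Longrightarrow> hat t = 0"
  by (cases "t \<ge> 1") (auto simp: hat_def step_eq_0 step_eq_1)

lemma sum_hat:
  assumes "0 \<le> s" "s \<le> real N"
  shows "(\<Sum>k\<le>N. hat (s - real k)) = 1"
proof -
  have "(\<Sum>k\<le>N. hat (s - real k)) = (\<Sum>k\<le>N. step (s + 1 - real k) - step (s + 1 - real (Suc k)))"
    by (intro sum.cong) (auto simp: hat_def algebra_simps)
  also have "\<dots> = step (s + 1) - step (s - real N)"
    by (subst sum_telescope) simp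
  also have "\<dots> = 1" using assms by (simp add: step_eq_0 step_eq_1)
  finally show ?thesis .
qed

text \<open>At any point at most three integer translates have a nonzero derivative, so the sum of
  absolute derivatives is bounded independently of the number of translates. The gradients of the
  grid partition of unity are then of the order of the inverse mesh, with no factor for the number
  of grid points.\<close>

lemma hat_deriv_ex:
  obtains h' K where "\<And>t. (hat has_real_derivative h' t) (at t)" "K > 0"
    "\<And>s N. (\<Sum>k\<le>N. \<bar>h' (s - real k)\<bar>) \<le> K"
proof -
  obtain s' C where s': "\<And>t. (step has_real_derivative s' t) (at t)" "C > 0" "\<And>t. \<bar>s' t\<bar> \<le> C"
    "\<And>t. t < 0 \<or> t > 1 \<Longrightarrow> s' t = 0" by (rule step_deriv_ex) blast
  define h' where "h' t = s' (t + 1) - s' t" for t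
  have "((\<lambda>t. step (t + 1)) has_real_derivative s' (t + 1) * 1) (at t)" for t
    by (rule DERIV_chain2[OF s'(1)]) (auto intro!: derivative_eq_intros)
  from DERIV_diff[OF this s'(1)]
  have "(hat has_real_derivative h' t) (at t)" for t unfolding hat_def h'_def by simp
  moreover have "(\<Sum>k\<le>N. \<bar>h' (s - real k)\<bar>) \<le> 3 * (2 * C)" for s N
  proof -
    define A where "A = {k. k \<le> N \<and> h' (s - real k) \<noteq> 0}"
    have "A \<subseteq> nat ` {\<lfloor>s\<rfloor> - 1..\<lfloor>s\<rfloor> + 1}"
    proof
      fix k assume "k \<in> A"
      then have "s' (s - real k + 1) \<noteq> 0 \<or> s' (s - real k) \<noteq> 0" by (auto simp: A_def h'_def)
      then have "\<bar>s - real k\<bar> \<le> 1" using s'(4)[of "s - real k + 1"] s'(4)[of "s - real k"] by force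
      then have "int k \<in> {\<lfloor>s\<rfloor> - 1..\<lfloor>s\<rfloor> + 1}" by (auto; linarith)
      then show "k \<in> nat ` {\<lfloor>s\<rfloor> - 1..\<lfloor>s\<rfloor> + 1}" by (metis image_eqI nat_int)
    qed
    then have "card A \<le> card (nat ` {\<lfloor>s\<rfloor> - 1..\<lfloor>s\<rfloor> + 1})" by (intro card_mono) auto
    also have "\<dots> \<le> card {\<lfloor>s\<rfloor> - 1..\<lfloor>s\<rfloor> + 1}" by (intro card_image_le) auto
    finally have "card A \<le> 3" by simp
    have "\<bar>h' t\<bar> \<le> 2 * C" for t using s'(3)[of "t + 1"] s'(3)[of t] unfolding h'_def by linarith
    then have "(\<Sum>k\<in>A. \<bar>h' (s - real k)\<bar>) \<le> real (card A) * (2 * C)" by (intro sum_bounded_above)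
    also have "\<dots> \<le> 3 * (2 * C)" using \<open>card A \<le> 3\<close> s'(2) by (intro mult_right_mono) auto
    also have "(\<Sum>k\<in>A. \<bar>h' (s - real k)\<bar>) = (\<Sum>k\<le>N. \<bar>h' (s - real k)\<bar>)"
      by (rule sum.mono_neutral_left) (auto simp: A_def)
    finally show ?thesis .
  qed
  ultimately show ?thesis using that[of h' "3 * (2 * C)"] s'(2) by simp
qed

subsection \<open>Approximation on cubes\<close>

text \<open>Tychonoff's theorem, with singleton factors {0} beyond \<open>n\<close>.\<close>

lemma compact_cube: "compact (cube n z r)"
proof -
  define B where "B i = (if i < n then {z i - r..z i + r} else {0::real})" for i
  have "cube n z r = Pi\<^sub>E UNIV B"
  proof (intro set_eqI)
    fix y
    have "y \<in> Pi\<^sub>E UNIV B \<longleftrightarrow> (\<forall>i. y i \<in> B i)" by (simp add: PiE_def Pi_def)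
    also have "\<dots> \<longleftrightarrow> (\<forall>i. (i \<ge> n \<longrightarrow> y i = 0) \<and> (i < n \<longrightarrow> \<bar>y i - z i\<bar> \<le> r))"
      by (intro all_cong1) (simp add: B_def; linarith)
    finally show "y \<in> cube n z r \<longleftrightarrow> y \<in> Pi\<^sub>E UNIV B" by (auto simp: cube_def)
  qed
  moreover have "compactin (powertop_real UNIV) (Pi\<^sub>E UNIV B)"
    by (subst compactin_PiE) (auto simp: B_def)
  ultimately show ?thesis by (simp add: euclidean_product_topology flip: compactin_euclidean_iff)
qed

text \<open>Heine-Cantor, with closeness measured in the first \<open>n\<close> coordinates. Two
  sequences violating the claim have, along a subsequence, the same coordinatewise limit, where
  continuity is contradicted.\<close>

lemma uniform_modulus_on_cube:
  assumes h: "continuous_on (cube n z r) h" and e: "e > (0::real)"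
  obtains \<delta> where "\<delta> > 0" "\<And>x y. x \<in> cube n z r \<Longrightarrow> y \<in> cube n z r \<Longrightarrow>
      (\<And>i. i < n \<Longrightarrow> \<bar>x i - y i\<bar> \<le> \<delta>) \<Longrightarrow> \<bar>h x - h y\<bar> < e"
proof -
  have "\<exists>\<delta>>0. \<forall>x\<in>cube n z r. \<forall>y\<in>cube n z r. (\<forall>i<n. \<bar>x i - y i\<bar> \<le> \<delta>) \<longrightarrow> \<bar>h x - h y\<bar> < e"
  proof (rule ccontr)
    assume neg: "\<not> ?thesis"
    have "\<exists>x\<in>cube n z r. \<exists>y\<in>cube n z r. (\<forall>i<n. \<bar>x i - y i\<bar> \<le> 1 / real (Suc m)) \<and> \<bar>h x - h y\<bar> \<ge> e" for m
    proof -
      have "1 / real (Suc m) > 0" by simp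
      with neg show ?thesis by (meson not_less)
    qed
    then obtain x y where xy: "\<And>m. x m \<in> cube n z r" "\<And>m. y m \<in> cube n z r"
      "\<And>m i. i < n \<Longrightarrow> \<bar>x m i - y m i\<bar> \<le> 1 / real (Suc m)" "\<And>m. \<bar>h (x m) - h (y m)\<bar> \<ge> e" by metis
    obtain l \<phi> where l: "l \<in> cube n z r" "strict_mono \<phi>" "(x \<circ> \<phi>) \<longlonglongrightarrow> l"
      using compact_cube[of n z r] xy(1) unfolding compact_def by blast
    have "(\<lambda>m. y (\<phi> m) i) \<longlonglongrightarrow> l i" for i
    proof -
      have x_lim: "(\<lambda>m. x (\<phi> m) i) \<longlonglongrightarrow> l i"
        using continuous_on_tendsto_compose[OF continuous_on_coord[of UNIV i] l(3)] by (simp add: comp_def)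
      have "(\<lambda>m. y (\<phi> m) i - x (\<phi> m) i) \<longlonglongrightarrow> 0"
      proof (rule Lim_null_comparison)
        show "\<forall>\<^sub>F m in sequentially. norm (y (\<phi> m) i - x (\<phi> m) i) \<le> 1 / real (Suc m)"
        proof (intro always_eventually allI)
          fix m
          show "norm (y (\<phi> m) i - x (\<phi> m) i) \<le> 1 / real (Suc m)"
          proof (cases "i < n")
            case True
            have "norm (y (\<phi> m) i - x (\<phi> m) i) \<le> 1 / real (Suc (\<phi> m))"
              using xy(3)[OF True, of "\<phi> m"] by (simp add: abs_minus_commute)
            also have "\<dots> \<le> 1 / real (Suc m)"
              using seq_suble[OF l(2), of m] by (intro divide_left_mono) auto
            finally show ?thesis .
          next
            case False
            then show ?thesis using xy(1)[of "\<phi> m"] xy(2)[of "\<phi> m"] by (auto simp: cube_def)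
          qed
        qed
        show "(\<lambda>m. 1 / real (Suc m)) \<longlonglongrightarrow> 0" by (rule LIMSEQ_Suc[OF lim_1_over_n])
      qed
      from tendsto_add[OF this x_lim] show ?thesis by simp
    qed
    then have "(\<lambda>m. y (\<phi> m)) \<longlonglongrightarrow> l"
      using limitin_componentwise[of "\<lambda>_. euclideanreal" UNIV "\<lambda>m. y (\<phi> m)" l sequentially]
      by (simp add: euclidean_product_topology)
    then have "(\<lambda>m. h (y (\<phi> m))) \<longlonglongrightarrow> h l"
      by (rule continuous_on_tendsto_compose[OF h _ l(1)]) (use xy in auto)
    moreover have "(\<lambda>m. h (x (\<phi> m))) \<longlonglongrightarrow> h l"
      by (rule continuous_on_tendsto_compose[OF h _ l(1)]) (use xy l in \<open>auto simp: comp_def\<close>)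
    ultimately have "(\<lambda>m. \<bar>h (x (\<phi> m)) - h (y (\<phi> m))\<bar>) \<longlonglongrightarrow> \<bar>h l - h l\<bar>" by (intro tendsto_intros)
    then have "e \<le> \<bar>h l - h l\<bar>" using xy(4) by (intro tendsto_lowerbound) auto
    then show False using e by simp
  qed
  then show ?thesis using that by blast
qed

lemma C1_onD:
  assumes "C1_on n G u D"
  shows "continuous_on G u" "i < n \<Longrightarrow> continuous_on G (D i)" "i < n \<Longrightarrow> x \<in> G \<Longrightarrow> has_partial i u x (D i x)"
  using assms by (auto simp: C1_on_def)

text \<open>The mean value inequality for \<open>F t - c * t\<close>.\<close>

lemma derivative_deviation_bound:
  fixes F :: "real \<Rightarrow> real"
  assumes "\<And>t. t \<in> closed_segment a b \<Longrightarrow> (F has_real_derivative F' t) (at t)"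
    and "\<And>t. t \<in> closed_segment a b \<Longrightarrow> \<bar>F' t - c\<bar> \<le> \<eta>"
  shows "\<bar>F b - F a - c * (b - a)\<bar> \<le> \<eta> * \<bar>b - a\<bar>"
proof -
  have "norm ((F b - c * b) - (F a - c * a)) \<le> \<eta> * norm (b - a)"
  proof (rule field_differentiable_bound[of "closed_segment a b" "\<lambda>t. F t - c * t" "\<lambda>t. F' t - c"])
    fix t assume t: "t \<in> closed_segment a b"
    have "((\<lambda>t. F t - c * t) has_real_derivative F' t - c * 1) (at t within closed_segment a b)"
      by (intro DERIV_diff DERIV_cmult DERIV_ident DERIV_subset[OF assms(1)[OF t]]) auto
    then show "((\<lambda>t. F t - c * t) has_real_derivative F' t - c) (at t within closed_segment a b)" by simp
    show "norm (F' t - c) \<le> \<eta>" using assms(2)[OF t] by simp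
  qed auto
  then show ?thesis by (simp add: algebra_simps)
qed

text \<open>Walk from \<open>a\<close> to \<open>x\<close> along the coordinate axes, changing one
  coordinate at a time, and compare every edge with the partial derivative at \<open>a\<close>. The
  points visited lie coordinatewise between \<open>a\<close> and \<open>x\<close>, so the
  oscillation of \<open>D\<close> has to be controlled only there.\<close>

lemma taylor_on_cube:
  assumes u: "C1_on n G u D" and sub: "cube n z r \<subseteq> G" and x: "x \<in> cube n z r" and a: "a \<in> cube n z r"
    and D: "\<And>i \<xi>. i < n \<Longrightarrow> \<xi> \<in> cube n z r \<Longrightarrow> (\<And>l. l < n \<Longrightarrow> \<bar>\<xi> l - a l\<bar> \<le> \<bar>x l - a l\<bar>) \<Longrightarrow>
      \<bar>D i \<xi> - D i a\<bar> \<le> \<eta>"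
  shows "\<bar>u x - u a - (\<Sum>i<n. D i a * (x i - a i))\<bar> \<le> \<eta> * (\<Sum>i<n. \<bar>x i - a i\<bar>)"
proof -
  define P where "P m = (\<lambda>i. if i < m then x i else a i)" for m
  have Pn: "P n = x" using x a by (auto simp: P_def cube_def)
  have P0: "P 0 = a" by (simp add: P_def)
  have step: "\<bar>u (P (Suc m)) - u (P m) - D m a * (x m - a m)\<bar> \<le> \<eta> * \<bar>x m - a m\<bar>" if m: "m < n" for m
  proof -
    have up: "P (Suc m) = (P m)(m := x m)" "P m = (P m)(m := a m)" by (auto simp: P_def)
    have in_cube: "(P m)(m := t) \<in> cube n z r" and close: "\<And>l. l < n \<Longrightarrow> \<bar>((P m)(m := t)) l - a l\<bar> \<le> \<bar>x l - a l\<bar>"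
      if t: "t \<in> closed_segment (a m) (x m)" for t
    proof -
      have seg: "min (a m) (x m) \<le> t" "t \<le> max (a m) (x m)"
        using t by (auto simp: closed_segment_eq_real_ivl split: if_splits)
      have "\<bar>x m - z m\<bar> \<le> r" "\<bar>a m - z m\<bar> \<le> r" using x a m by (auto simp: cube_def)
      with seg have "\<bar>t - z m\<bar> \<le> r" by linarith
      then show "(P m)(m := t) \<in> cube n z r" using x a m by (auto simp: cube_def P_def)
      show "\<bar>((P m)(m := t)) l - a l\<bar> \<le> \<bar>x l - a l\<bar>" if "l < n" for l
        using seg by (cases "l = m") (auto simp: P_def)
    qed
    have "\<bar>u ((P m)(m := x m)) - u ((P m)(m := a m)) - D m a * (x m - a m)\<bar> \<le> \<eta> * \<bar>x m - a m\<bar>"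
    proof (rule derivative_deviation_bound[where F' = "\<lambda>t. D m ((P m)(m := t))"])
      fix t assume t: "t \<in> closed_segment (a m) (x m)"
      have "has_partial m u ((P m)(m := t)) (D m ((P m)(m := t)))"
        using C1_onD(3)[OF u m] in_cube[OF t] sub by blast
      then show "((\<lambda>t. u ((P m)(m := t))) has_real_derivative D m ((P m)(m := t))) (at t)" by simp
      show "\<bar>D m ((P m)(m := t)) - D m a\<bar> \<le> \<eta>" by (rule D[OF m in_cube[OF t] close[OF t]])
    qed
    then show ?thesis using up by metis
  qed
  have "u x - u a = (\<Sum>m<n. u (P (Suc m)) - u (P m))" using sum_lessThan_telescope[of "\<lambda>m. u (P m)" n] by (simp add: Pn P0)
  then have "\<bar>u x - u a - (\<Sum>i<n. D i a * (x i - a i))\<bar> = \<bar>\<Sum>m<n. u (P (Suc m)) - u (P m) - D m a * (x m - a m)\<bar>"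
    by (simp add: sum_subtractf)
  also have "\<dots> \<le> (\<Sum>m<n. \<eta> * \<bar>x m - a m\<bar>)" by (rule order_trans[OF sum_abs sum_mono]) (use step in auto)
  finally show ?thesis by (simp add: sum_distrib_left)
qed

text \<open>A zero of a nonnegative function is a minimum. For a partition of unity this means that
  the gradient of a weight vanishes wherever the weight does, so that only nearby approximants enter
  the gradient estimates.\<close>

lemma has_partial_nonneg_zero:
  assumes "\<And>y. f y \<ge> 0" "f x = 0" "has_partial i f x D"
  shows "D = (0::real)"
  by (rule DERIV_local_min[OF assms(3), of 1]) (use assms in auto)

lemma has_partial_sum:
  "(\<And>a. a \<in> A \<Longrightarrow> has_partial i (f a) x (D a)) \<Longrightarrow> has_partial i (\<lambda>y. \<Sum>a\<in>A. f a y) x (\<Sum>a\<in>A. D a)"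
  by (rule DERIV_sum)

text \<open>First-order Taylor polynomials at the points of a grid of mesh \<open>\<delta>\<close> are glued by a partition of
  unity with gradients of size \<open>1/\<delta>\<close>; the Taylor remainders are \<open>o(\<delta>)\<close>.\<close>
lemma cube_C1_approx:
  assumes u: "C1_on n G u D" and sub: "cube n z (2 * r) \<subseteq> G" and r: "r > 0" and e: "e > 0"
  shows "\<exists>p\<in>elem_smooth. \<forall>x\<in>cube n z r. \<bar>p x - u x\<bar> \<le> e \<and> (\<forall>i<n. \<bar>partial_deriv i p x - D i x\<bar> \<le> e)"
proof -
  obtain h' K where h': "\<And>t. (hat has_real_derivative h' t) (at t)" "K > 0"
    "\<And>s N. (\<Sum>k\<le>N. \<bar>h' (s - real k)\<bar>) \<le> K" by (rule hat_deriv_ex) blast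
  \<comment> \<open>Splits \<open>e\<close>: the error in value will be at most \<eta> * n, the
    error in a partial derivative at most \<eta> * (1 + n * K).\<close>
  define \<eta> where "\<eta> = e / (1 + real n + real n * K)"
  have den: "1 + real n + real n * K > 0" using h'(2) by (simp add: add_pos_nonneg)
  have \<eta>: "\<eta> > 0" "\<eta> * (1 + real n + real n * K) = e" using den e by (auto simp: \<eta>_def)
  have "\<exists>\<delta>>0. \<forall>x\<in>cube n z (2*r). \<forall>y\<in>cube n z (2*r). (\<forall>i<n. \<bar>x i - y i\<bar> \<le> \<delta>) \<longrightarrow> \<bar>D i x - D i y\<bar> < \<eta>" if "i < n" for i
  proof -
    have "continuous_on (cube n z (2*r)) (D i)" using C1_onD(2)[OF u that] sub continuous_on_subset by blast
    then obtain \<delta> where "\<delta> > 0" "\<And>x y. x \<in> cube n z (2*r) \<Longrightarrow> y \<in> cube n z (2*r) \<Longrightarrow>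
      (\<And>i. i < n \<Longrightarrow> \<bar>x i - y i\<bar> \<le> \<delta>) \<Longrightarrow> \<bar>D i x - D i y\<bar> < \<eta>"
      by (rule uniform_modulus_on_cube[OF _ \<eta>(1)]) blast
    then show ?thesis by blast
  qed
  then obtain \<delta>' where \<delta>': "\<And>i. i < n \<Longrightarrow> \<delta>' i > 0"
    "\<And>i x y. i < n \<Longrightarrow> x \<in> cube n z (2*r) \<Longrightarrow> y \<in> cube n z (2*r) \<Longrightarrow> (\<forall>l<n. \<bar>x l - y l\<bar> \<le> \<delta>' i) \<Longrightarrow> \<bar>D i x - D i y\<bar> < \<eta>"
    by metis
  \<comment> \<open>The inserted 1 yields \<delta> \<le> 1 and keeps the set nonempty for n =
    0.\<close>
  define \<delta>0 where "\<delta>0 = Min (insert 1 (\<delta>' ` {..<n}))"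
  have \<delta>0: "\<delta>0 > 0" "\<delta>0 \<le> 1" "\<And>i. i < n \<Longrightarrow> \<delta>0 \<le> \<delta>' i"
    unfolding \<delta>0_def using \<delta>'(1) by (auto intro: Min_le)
  \<comment> \<open>The mesh divides the side 4 * r of the larger box exactly, so the grid indices 0
    to N reach both ends and the weights sum to 1 on the whole larger box, in particular near each
    point of the smaller one.\<close>
  define N where "N = Suc (nat \<lceil>4 * r / \<delta>0\<rceil>)"
  define \<delta> where "\<delta> = 4 * r / real N"
  have N: "real N > 0" "4 * r / \<delta>0 \<le> real N" unfolding N_def by (simp, linarith)
  have \<delta>: "\<delta> > 0" "\<delta> * real N = 4 * r" "\<delta> \<le> \<delta>0"
    using N r \<delta>0(1) by (auto simp: \<delta>_def field_simps)
  have close: "\<bar>D i x - D i y\<bar> \<le> \<eta>" if "i < n" "x \<in> cube n z (2*r)" "y \<in> cube n z (2*r)" "\<And>l. l < n \<Longrightarrow> \<bar>x l - y l\<bar> \<le> \<delta>" for i x y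
    using \<delta>'(2)[of i x y] \<delta>0(3)[of i] \<delta>(3) that by force
  define A where "A = Pi\<^sub>E {..<n} (\<lambda>_. {..N})"
  have finA: "finite A" unfolding A_def by (intro finite_PiE) auto
  define P where "P a = (\<lambda>i. if i < n then z i - 2 * r + \<delta> * real (a i) else 0)" for a :: "nat \<Rightarrow> nat"
  define s where "s i t = (t - z i + 2 * r) / \<delta>" for i and t :: real
  define \<omega> where "\<omega> a x = (\<Prod>i<n. hat (s i (x i) - real (a i)))" for a :: "nat \<Rightarrow> nat" and x
  define T where "T a x = u (P a) + (\<Sum>i<n. D i (P a) * (x i - P a i))" for a x
  define p where "p x = (\<Sum>a\<in>A. \<omega> a x * T a x)" for x
  have xP: "x i - P a i = \<delta> * (s i (x i) - real (a i))" if "i < n" for x a i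
    using that \<delta>(1) by (simp add: P_def s_def field_simps)
  have \<omega>_smooth: "\<omega> a \<in> elem_smooth" for a
    unfolding \<omega>_def[abs_def] hat_def s_def using \<delta>(1)
    by (intro elem_smooth_prod elem_smooth_minus elem_smooth_step elem_smooth.add elem_smooth_divide elem_smooth.coord elem_smooth.const) auto
  have T_smooth: "T a \<in> elem_smooth" for a
    unfolding T_def[abs_def]
    by (intro elem_smooth.add elem_smooth_sum elem_smooth.mult elem_smooth_minus elem_smooth.coord elem_smooth.const)
  have p_smooth: "p \<in> elem_smooth"
    unfolding p_def[abs_def] by (intro elem_smooth_sum elem_smooth.mult \<omega>_smooth T_smooth)
  have \<omega>_nonneg: "\<omega> a x \<ge> 0" for a x unfolding \<omega>_def by (intro prod_nonneg) (auto simp: hat_nonneg)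
  have sum_hat_s: "(\<Sum>k\<le>N. hat (s i t - real k)) = 1" if "\<bar>t - z i\<bar> \<le> 2 * r" for i t
    by (rule sum_hat) (use that \<delta> in \<open>auto simp: s_def divide_simps abs_le_iff algebra_simps\<close>)
  have sum_\<omega>: "(\<Sum>a\<in>A. \<omega> a x) = 1" if "\<And>i. i < n \<Longrightarrow> \<bar>x i - z i\<bar> \<le> 2 * r" for x
  proof -
    have "(\<Sum>a\<in>A. \<omega> a x) = (\<Prod>i<n. \<Sum>k\<le>N. hat (s i (x i) - real k))"
      unfolding A_def \<omega>_def by (subst prod_sum_PiE) auto
    also have "\<dots> = 1" using that by (simp add: sum_hat_s)
    finally show ?thesis .
  qed
  have P_in: "P a \<in> cube n z (2 * r)" if "a \<in> A" for a
  proof -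
    have "\<bar>\<delta> * real (a i) - 2 * r\<bar> \<le> 2 * r" if "i < n" for i
    proof -
      have "a i \<le> N" using \<open>a \<in> A\<close> that by (auto simp: A_def PiE_def Pi_def)
      then have "\<delta> * real (a i) \<le> \<delta> * real N" using \<delta>(1) by (intro mult_left_mono) auto
      moreover have "0 \<le> \<delta> * real (a i)" using \<delta>(1) by simp
      ultimately show ?thesis using \<delta>(2) by linarith
    qed
    then show ?thesis by (auto simp: cube_def P_def)
  qed
  show ?thesis
  proof (intro bexI[OF _ p_smooth] ballI)
    fix x assume x: "x \<in> cube n z r"
    then have x2: "x \<in> cube n z (2 * r)" using r by (force simp: cube_def)
    have xs: "\<bar>x i - z i\<bar> \<le> 2 * r" if "i < n" for i using x2 that by (auto simp: cube_def)
    have s1: "(\<Sum>a\<in>A. \<omega> a x) = 1" by (rule sum_\<omega>) (rule xs)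
    have near: "\<bar>x l - P a l\<bar> \<le> \<delta>" if "\<omega> a x \<noteq> 0" "l < n" for a l
    proof -
      have "hat (s l (x l) - real (a l)) \<noteq> 0" using that by (auto simp: \<omega>_def)
      then have "\<bar>s l (x l) - real (a l)\<bar> \<le> 1" using hat_eq_0 by force
      then have "\<delta> * \<bar>s l (x l) - real (a l)\<bar> \<le> \<delta> * 1" using \<delta>(1) by (intro mult_left_mono) auto
      then show ?thesis using \<delta>(1) by (simp add: xP[OF that(2)] abs_mult)
    qed
    have Tu: "\<bar>T a x - u x\<bar> \<le> \<eta> * (real n * \<delta>)" if a: "a \<in> A" "\<omega> a x \<noteq> 0" for a
    proof -
      have "\<bar>u x - u (P a) - (\<Sum>i<n. D i (P a) * (x i - P a i))\<bar> \<le> \<eta> * (\<Sum>i<n. \<bar>x i - P a i\<bar>)"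
        by (rule taylor_on_cube[OF u sub x2 P_in[OF a(1)]])
           (meson close P_in[OF a(1)] near[OF a(2)] order_trans)
      also have "\<dots> \<le> \<eta> * (\<Sum>i<n. \<delta>)" using near[OF a(2)] \<eta>(1) by (intro mult_left_mono sum_mono) auto
      finally show ?thesis by (simp add: T_def abs_minus_commute)
    qed
    have Tu': "\<omega> a x * \<bar>T a x - u x\<bar> \<le> \<omega> a x * (\<eta> * (real n * \<delta>))" if "a \<in> A" for a
      using Tu[OF that] \<omega>_nonneg[of a x] by (cases "\<omega> a x = 0") (auto intro: mult_left_mono)
    have "p x - u x = (\<Sum>a\<in>A. \<omega> a x * (T a x - u x))"
      unfolding p_def right_diff_distrib sum_subtractf sum_distrib_right[symmetric] s1 by simp
    also have "\<bar>\<dots>\<bar> \<le> (\<Sum>a\<in>A. \<omega> a x * (\<eta> * (real n * \<delta>)))"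
      by (rule order_trans[OF sum_abs sum_mono]) (use Tu' \<omega>_nonneg in \<open>auto simp: abs_mult\<close>)
    also have "\<dots> = \<eta> * (real n * \<delta>)" unfolding sum_distrib_right[symmetric] s1 by simp
    also have "\<dots> \<le> \<eta> * (1 + real n + real n * K)"
    proof -
      have "real n * \<delta> \<le> real n * 1" using \<delta>(3) \<delta>0(2) by (intro mult_left_mono) auto
      then show ?thesis using \<eta>(1) h'(2) by (intro mult_left_mono) (auto simp: add_increasing2)
    qed
    finally have 1: "\<bar>p x - u x\<bar> \<le> e" using \<eta>(2) by simp
    have "\<bar>partial_deriv i p x - D i x\<bar> \<le> e" if i: "i < n" for i
    proof -
      define c where "c a = (h' (s i (x i) - real (a i)) * (1 / \<delta>)) * (\<Prod>l\<in>{..<n} - {i}. hat (s l (x l) - real (a l)))" for a :: "nat \<Rightarrow> nat"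
      have dchi: "has_partial i (\<omega> a) x (c a)" for a
      proof -
        have "((\<lambda>t. s i t - real (a i)) has_real_derivative 1 / \<delta>) (at (x i))"
          unfolding s_def using \<delta>(1) by (auto intro!: derivative_eq_intros)
        from DERIV_cmult_right[OF DERIV_chain2[OF h'(1) this], of "\<Prod>l\<in>{..<n} - {i}. hat (s l (x l) - real (a l))"]
        have "((\<lambda>t. hat (s i t - real (a i)) * (\<Prod>l\<in>{..<n} - {i}. hat (s l (x l) - real (a l)))) has_real_derivative c a) (at (x i))"
          unfolding c_def .
        moreover have "\<omega> a (x(i := t)) = hat (s i t - real (a i)) * (\<Prod>l\<in>{..<n} - {i}. hat (s l (x l) - real (a l)))" for t
          unfolding \<omega>_def using i by (subst prod.remove[of _ i]) (auto intro!: prod.cong)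
        ultimately show ?thesis by presburger
      qed
      have c0: "c a = 0" if "\<omega> a x = 0" for a
        by (rule has_partial_nonneg_zero[OF \<omega>_nonneg that dchi])
      \<comment> \<open>The sum over the grid factorises: direction \<open>i\<close> contributes at
        most K / \<delta>, every other direction contributes 1.\<close>
      have sum_c: "(\<Sum>a\<in>A. \<bar>c a\<bar>) \<le> K / \<delta>"
      proof -
        define q where "q l k = (if l = i then \<bar>h' (s i (x i) - real k)\<bar> / \<delta> else hat (s l (x l) - real k))" for l k
        have "\<bar>c a\<bar> = (\<Prod>l<n. q l (a l))" for a
        proof -
          have "(\<Prod>l<n. q l (a l)) = q i (a i) * (\<Prod>l\<in>{..<n} - {i}. q l (a l))" using i by (subst prod.remove[of _ i]) auto
          also have "(\<Prod>l\<in>{..<n} - {i}. q l (a l)) = (\<Prod>l\<in>{..<n} - {i}. hat (s l (x l) - real (a l)))"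
            by (intro prod.cong) (auto simp: q_def)
          finally show ?thesis using \<delta>(1)
            by (simp add: c_def q_def abs_mult prod_nonneg hat_nonneg abs_prod abs_of_nonneg)
        qed
        then have "(\<Sum>a\<in>A. \<bar>c a\<bar>) = (\<Prod>l<n. \<Sum>k\<le>N. q l k)" unfolding A_def by (subst prod_sum_PiE) auto
        also have "\<dots> = (\<Sum>k\<le>N. q i k) * (\<Prod>l\<in>{..<n} - {i}. \<Sum>k\<le>N. q l k)" using i by (subst prod.remove[of _ i]) auto
        also have "(\<Prod>l\<in>{..<n} - {i}. \<Sum>k\<le>N. q l k) = 1"
          by (rule prod.neutral) (auto simp: q_def sum_hat_s xs)
        also have "(\<Sum>k\<le>N. q i k) = (\<Sum>k\<le>N. \<bar>h' (s i (x i) - real k)\<bar>) / \<delta>" by (simp add: q_def sum_divide_distrib)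
        also have "\<dots> * 1 \<le> K / \<delta>" using h'(3) \<delta>(1) by (simp add: divide_right_mono)
        finally show ?thesis .
      qed
      have dT: "has_partial i (T a) x (D i (P a))" for a
      proof -
        have "has_partial i (\<lambda>x. \<Sum>l<n. D l (P a) * (x l - P a l)) x (\<Sum>l<n. if l = i then D l (P a) else 0)"
        proof (rule has_partial_sum)
          fix l
          show "has_partial i (\<lambda>x. D l (P a) * (x l - P a l)) x (if l = i then D l (P a) else 0)"
            by (cases "l = i") (auto intro!: derivative_eq_intros)
        qed
        also have "(\<Sum>l<n. if l = i then D l (P a) else 0) = D i (P a)" using i by simp
        finally have "has_partial i (\<lambda>x. \<Sum>l<n. D l (P a) * (x l - P a l)) x (D i (P a))" .
        from DERIV_add[OF DERIV_const this, of "u (P a)"] show ?thesis unfolding T_def by simp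
      qed
      have du: "has_partial i u x (D i x)" using C1_onD(3)[OF u i] sub x2 by blast
      \<comment> \<open>The errors \<omega> (T - u) are differentiated instead of \<open>p\<close>:
        near \<open>x\<close> the weights sum to 1, so \<open>p\<close> is \<open>u\<close> plus
        these errors. The factor 1 / \<delta> from the derivative of a weight then meets a Taylor
        remainder of order \<eta> \<delta>.\<close>
      define E where "E a = c a * (T a x - u x) + (D i (P a) - D i x) * \<omega> a x" for a
      have dE: "has_partial i (\<lambda>y. \<omega> a y * (T a y - u y)) x (E a)" for a
        using DERIV_mult[OF dchi DERIV_diff[OF dT du], of a a] unfolding E_def by simp
      have *: "has_partial i (\<lambda>y. (\<Sum>a\<in>A. \<omega> a y * (T a y - u y)) + u y) x ((\<Sum>a\<in>A. E a) + D i x)"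
        by (rule DERIV_add[OF has_partial_sum[OF dE] du])
      have ev: "\<forall>\<^sub>F t in nhds (x i). p (x(i := t)) = (\<Sum>a\<in>A. \<omega> a (x(i := t)) * (T a (x(i := t)) - u (x(i := t)))) + u (x(i := t))"
      proof (rule eventually_mono[OF eventually_nhds_in_open[of "{t. \<bar>t - z i\<bar> < 2 * r}"]])
        show "open {t. \<bar>t - z i\<bar> < 2 * r}" by (intro open_Collect_less continuous_intros)
        show "x i \<in> {t. \<bar>t - z i\<bar> < 2 * r}" using x i r by (force simp: cube_def)
        fix t assume "t \<in> {t. \<bar>t - z i\<bar> < 2 * r}"
        then have "\<bar>(x(i := t)) l - z l\<bar> \<le> 2 * r" if "l < n" for l using xs that by auto
        then have "(\<Sum>a\<in>A. \<omega> a (x(i := t))) = 1" by (rule sum_\<omega>)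
        then show "p (x(i := t)) = (\<Sum>a\<in>A. \<omega> a (x(i := t)) * (T a (x(i := t)) - u (x(i := t)))) + u (x(i := t))"
          unfolding p_def right_diff_distrib sum_subtractf sum_distrib_right[symmetric] by simp
      qed
      have "has_partial i p x ((\<Sum>a\<in>A. E a) + D i x)"
        using has_partial_cong[of p x i "\<lambda>y. (\<Sum>a\<in>A. \<omega> a y * (T a y - u y)) + u y"] ev * by blast
      then have "partial_deriv i p x = (\<Sum>a\<in>A. E a) + D i x" by (rule has_partial_imp_eq)
      then have "\<bar>partial_deriv i p x - D i x\<bar> = \<bar>\<Sum>a\<in>A. E a\<bar>" by simp
      also have "\<dots> \<le> (\<Sum>a\<in>A. \<bar>c a\<bar> * (\<eta> * (real n * \<delta>)) + \<eta> * \<omega> a x)"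
      proof (rule order_trans[OF sum_abs sum_mono])
        fix a assume a: "a \<in> A"
        show "\<bar>E a\<bar> \<le> \<bar>c a\<bar> * (\<eta> * (real n * \<delta>)) + \<eta> * \<omega> a x"
        proof (cases "\<omega> a x = 0")
          case True
          then show ?thesis using c0 by (simp add: E_def)
        next
          case False
          have "\<bar>E a\<bar> \<le> \<bar>c a\<bar> * \<bar>T a x - u x\<bar> + \<bar>D i (P a) - D i x\<bar> * \<omega> a x"
            unfolding E_def using abs_triangle_ineq[of "c a * (T a x - u x)" "(D i (P a) - D i x) * \<omega> a x"] \<omega>_nonneg[of a x]
            by (simp add: abs_mult)
          also have "\<dots> \<le> \<bar>c a\<bar> * (\<eta> * (real n * \<delta>)) + \<eta> * \<omega> a x"
            using Tu[OF a False] close[OF i P_in[OF a] x2] near[OF False] \<omega>_nonneg[of a x]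
            by (intro add_mono mult_left_mono mult_right_mono) (auto simp: abs_minus_commute)
          finally show ?thesis .
        qed
      qed
      also have "\<dots> = (\<Sum>a\<in>A. \<bar>c a\<bar>) * (\<eta> * (real n * \<delta>)) + \<eta>"
        unfolding sum.distrib sum_distrib_right[symmetric] sum_distrib_left[symmetric] s1 by simp
      also have "\<dots> \<le> K / \<delta> * (\<eta> * (real n * \<delta>)) + \<eta>"
        using sum_c \<eta>(1) \<delta>(1) by (intro add_right_mono mult_right_mono) auto
      also have "\<dots> = \<eta> * (1 + real n * K)" using \<delta>(1) by (simp add: field_simps)
      also have "\<dots> \<le> \<eta> * (1 + real n + real n * K)" using \<eta>(1) by (intro mult_left_mono) auto
      also have "\<dots> = e" by (rule \<eta>(2))
      finally show ?thesis .
    qed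
    with 1 show "\<bar>p x - u x\<bar> \<le> e \<and> (\<forall>i<n. \<bar>partial_deriv i p x - D i x\<bar> \<le> e)" by blast
  qed
qed

subsection \<open>Global approximation\<close>

text \<open>The bound on the partial derivatives is part of the notion because the accuracy of each
  local approximant is chosen against it. Together with values in [0, 1] it is stable under
  products.\<close>

definition smooth_cutoff :: "nat \<Rightarrow> ((nat \<Rightarrow> real) \<Rightarrow> real) \<Rightarrow> bool" where
  "smooth_cutoff n g \<longleftrightarrow> g \<in> elem_smooth \<and> (\<forall>x. 0 \<le> g x \<and> g x \<le> 1) \<and>
     (\<exists>B. \<forall>x. \<forall>i<n. \<bar>partial_deriv i g x\<bar> \<le> B)"

lemma smooth_cutoff_compl:
  assumes "smooth_cutoff n g"
  shows "smooth_cutoff n (\<lambda>x. 1 - g x)"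
proof -
  have "partial_deriv i (\<lambda>x. 1 - g x) x = 0 - partial_deriv i g x" for x i
    by (rule has_partial_imp_eq, rule DERIV_diff[OF DERIV_const elem_smooth_partial])
       (use assms in \<open>simp add: smooth_cutoff_def\<close>)
  then show ?thesis using assms
    by (auto simp: smooth_cutoff_def intro!: elem_smooth_minus elem_smooth.const)
qed

lemma smooth_cutoff_mult:
  assumes g: "smooth_cutoff n g" and h: "smooth_cutoff n h"
  shows "smooth_cutoff n (\<lambda>x. g x * h x)"
proof -
  obtain B where B: "\<And>x i. i < n \<Longrightarrow> \<bar>partial_deriv i g x\<bar> \<le> B" using g by (auto simp: smooth_cutoff_def)
  obtain C where C: "\<And>x i. i < n \<Longrightarrow> \<bar>partial_deriv i h x\<bar> \<le> C" using h by (auto simp: smooth_cutoff_def)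
  have "\<bar>partial_deriv i (\<lambda>x. g x * h x) x\<bar> \<le> B + C" if "i < n" for x i
  proof -
    have "has_partial i (\<lambda>x. g x * h x) x (partial_deriv i g x * h x + partial_deriv i h x * g x)"
      using DERIV_mult[OF elem_smooth_partial[where g = g and i = i and x = x] elem_smooth_partial[where g = h and i = i and x = x]] g h
      by (simp add: smooth_cutoff_def)
    then have "partial_deriv i (\<lambda>x. g x * h x) x = partial_deriv i g x * h x + partial_deriv i h x * g x"
      by (rule has_partial_imp_eq)
    also have "\<bar>partial_deriv i g x * h x + partial_deriv i h x * g x\<bar>
        \<le> \<bar>partial_deriv i g x\<bar> * \<bar>h x\<bar> + \<bar>partial_deriv i h x\<bar> * \<bar>g x\<bar>"
      by (metis abs_mult abs_triangle_ineq)
    also have "\<dots> \<le> B * 1 + C * 1"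
      using g h B[OF that, of x] C[OF that, of x]
      by (intro add_mono mult_mono) (auto simp: smooth_cutoff_def intro: order_trans[OF abs_ge_zero])
    finally show ?thesis by simp
  qed
  then show ?thesis using g h
    by (auto simp: smooth_cutoff_def mult_le_one intro!: elem_smooth.mult)
qed

lemma smooth_cutoff_prod:
  assumes "\<And>a. a \<in> A \<Longrightarrow> smooth_cutoff n (g a)"
  shows "smooth_cutoff n (\<lambda>x. \<Prod>a\<in>A. g a x)"
proof -
  have one: "smooth_cutoff n (\<lambda>x. 1)"
    unfolding smooth_cutoff_def
    by (auto intro!: elem_smooth.const exI[of _ 0] has_partial_imp_eq)
  show ?thesis using assms
    by (induction A rule: infinite_finite_induct) (auto simp: one intro: smooth_cutoff_mult)
qed

lemma smooth_cutoff_step: "smooth_cutoff n (\<lambda>x. step (a * x l + b))"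
proof -
  obtain s' C where s': "\<And>t. (step has_real_derivative s' t) (at t)" "C > 0" "\<And>t. \<bar>s' t\<bar> \<le> C"
    "\<And>t. t < 0 \<or> t > 1 \<Longrightarrow> s' t = 0" by (rule step_deriv_ex) blast
  have "\<bar>partial_deriv i (\<lambda>x. step (a * x l + b)) x\<bar> \<le> C * \<bar>a\<bar>" for i x
  proof -
    have "has_partial i (\<lambda>x. a * x l + b) x (if i = l then a else 0)"
      by (cases "i = l") (auto intro!: derivative_eq_intros)
    from DERIV_chain2[OF s'(1) this]
    have "partial_deriv i (\<lambda>x. step (a * x l + b)) x = s' (a * x l + b) * (if i = l then a else 0)"
      by (intro has_partial_imp_eq) simp
    then show ?thesis using s'(2,3) by (auto simp: abs_mult mult_right_mono)
  qed
  moreover have "(\<lambda>x. step (a * x l + b)) \<in> elem_smooth"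
    by (intro elem_smooth_step elem_smooth.add elem_smooth.mult elem_smooth.const elem_smooth.coord)
  ultimately show ?thesis unfolding smooth_cutoff_def using step_nonneg step_le_1 by blast
qed

lemma cube_cutoff_ex:
  assumes r: "r > 0"
  shows "\<exists>\<psi>. smooth_cutoff n \<psi> \<and> (\<forall>x. (\<forall>i<n. \<bar>x i - z i\<bar> \<le> r) \<longrightarrow> \<psi> x = 1) \<and>
    (\<forall>x. (\<exists>i<n. \<bar>x i - z i\<bar> \<ge> 2 * r) \<longrightarrow> \<psi> x = 0)"
proof -
  \<comment> \<open>With s = (x i - z i) / r the two steps have arguments 2 + s and 2 - s: both are
    at least 1 if |s| \<le> 1, and one of them is at most 0 if |s| \<ge> 2.\<close>
  define \<psi> where "\<psi> x = (\<Prod>i<n. step (1 / r * x i + (2 - z i / r)) * step ((- 1 / r) * x i + (2 + z i / r)))" for x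
  have eq: "1 / r * x i + (2 - z i / r) = 2 + (x i - z i) / r"
    "(- 1 / r) * x i + (2 + z i / r) = 2 - (x i - z i) / r" for x i
    using r by (auto simp: field_simps)
  have "smooth_cutoff n \<psi>" unfolding \<psi>_def[abs_def]
    by (intro smooth_cutoff_prod smooth_cutoff_mult smooth_cutoff_step)
  moreover have "\<psi> x = 1" if "\<forall>i<n. \<bar>x i - z i\<bar> \<le> r" for x
    unfolding \<psi>_def eq
  proof (rule prod.neutral, rule ballI)
    fix i assume "i \<in> {..<n}"
    then have "\<bar>x i - z i\<bar> \<le> r" using that by auto
    then have "\<bar>(x i - z i) / r\<bar> \<le> 1" using r by (simp add: abs_divide divide_le_eq)
    then show "step (2 + (x i - z i) / r) * step (2 - (x i - z i) / r) = 1"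
      using \<open>\<bar>(x i - z i) / r\<bar> \<le> 1\<close> step_eq_1[of "2 + (x i - z i) / r"] step_eq_1[of "2 - (x i - z i) / r"] unfolding abs_le_iff by simp
  qed
  moreover have "\<psi> x = 0" if far: "\<exists>i<n. \<bar>x i - z i\<bar> \<ge> 2 * r" for x
  proof -
    obtain i where i: "i < n" "\<bar>x i - z i\<bar> \<ge> 2 * r" using far by auto
    then have "\<bar>(x i - z i) / r\<bar> \<ge> 2" using r by (simp add: abs_divide divide_simps)
    then have "step (2 + (x i - z i) / r) * step (2 - (x i - z i) / r) = 0"
      using step_eq_0[of "2 + (x i - z i) / r"] step_eq_0[of "2 - (x i - z i) / r"] by (simp add: abs_if split: if_splits)
    then show ?thesis unfolding \<psi>_def eq using i(1) by (intro prod_zero) auto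
  qed
  ultimately show ?thesis by blast
qed

text \<open>Telescoping: the j-th summand is the difference of consecutive products of the factors 1
  - \<psi> i.\<close>

lemma sum_prod_compl:
  fixes \<psi> :: "nat \<Rightarrow> 'a::comm_ring_1"
  shows "(\<Sum>j\<le>J. \<psi> j * (\<Prod>i<j. 1 - \<psi> i)) = 1 - (\<Prod>j\<le>J. 1 - \<psi> j)"
  by (induction J) (simp_all add: lessThan_Suc_atMost algebra_simps)

text \<open>The accuracy of the j-th local approximant is tuned to the gradient of the j-th weight,
  so that one uniform error survives the gluing of infinitely many pieces.\<close>

lemma C1_smooth_approx:
  assumes G: "openin (Euclidean_space n) G" and u: "C1_on n G u D" and e: "e > 0"
  shows "\<exists>g. (\<forall>d. C_diff_on n d G g) \<and>
    (\<forall>x\<in>G. \<bar>g x - u x\<bar> \<le> e \<and> (\<forall>i<n. \<exists>D'. has_partial i g x D' \<and> \<bar>D' - D i x\<bar> \<le> e))"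
proof (cases "G = {}")
  case True
  then show ?thesis by (auto simp: C_diff_on_def)
next
  case False
  \<comment> \<open>Radius 4: a cutoff lives on the box of twice the basic radius, and the
    approximation on that box asks for the box of twice its radius inside \<open>G\<close>.\<close>
  have "\<exists>r>0. cube n x (4 * r) \<subseteq> G" if x: "x \<in> G" for x
  proof -
    obtain r where "r > 0" "cube n x r \<subseteq> G" using openin_Euclidean_space_imp_cube[OF G x] .
    then show ?thesis by (intro exI[of _ "r / 4"]) auto
  qed
  then obtain \<rho> where \<rho>: "\<And>x. x \<in> G \<Longrightarrow> \<rho> x > 0" "\<And>x. x \<in> G \<Longrightarrow> cube n x (4 * \<rho> x) \<subseteq> G" by metis
  \<comment> \<open>Cylinders, with no condition on coordinates from \<open>n\<close> on, are open
    in the whole function space, where the Lindelof property gives a countable subcover.\<close>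
  define Cy where "Cy x = {y. \<forall>i<n. \<bar>y i - x i\<bar> < \<rho> x}" for x :: "nat \<Rightarrow> real"
  have Cy_open: "open (Cy x)" for x
  proof -
    have "Cy x = (\<Inter>i\<in>{..<n}. {y. \<bar>y i - x i\<bar> < \<rho> x})" by (auto simp: Cy_def)
    also have "open \<dots>"
      by (intro open_INT ballI open_Collect_less continuous_intros continuous_on_coord) auto
    finally show ?thesis .
  qed
  obtain \<F> where \<F>: "\<F> \<subseteq> Cy ` G" "countable \<F>" "\<Union>\<F> = \<Union>(Cy ` G)"
    using Lindelof[of "Cy ` G"] Cy_open by (metis (no_types, lifting) imageE)
  obtain C where C: "C \<subseteq> G" "countable C" "\<F> = Cy ` C"
    using \<F>(1,2) by (metis countable_subset_image)
  have G_cov: "\<exists>y\<in>C. x \<in> Cy y" if "x \<in> G" for x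
  proof -
    have "x \<in> Cy x" using \<rho>(1)[OF that] by (simp add: Cy_def)
    then have "x \<in> \<Union>\<F>" using \<F>(3) that by auto
    then show ?thesis using C(3) by auto
  qed
  then have "C \<noteq> {}" using False by blast
  \<comment> \<open>For finite \<open>C\<close> the enumeration repeats points, which the partition
    of unity below tolerates.\<close>
  define z where "z = from_nat_into C"
  have zG: "z j \<in> G" for j using from_nat_into[OF \<open>C \<noteq> {}\<close>] C(1) by (auto simp: z_def)
  have z_cov: "\<exists>j. x \<in> Cy (z j)" if "x \<in> G" for x
    using G_cov[OF that] from_nat_into_surj[OF C(2)] unfolding z_def by metis
  define r where "r j = \<rho> (z j)" for j
  have r: "r j > 0" "cube n (z j) (4 * r j) \<subseteq> G" for j using \<rho> zG by (auto simp: r_def)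
  have "\<exists>\<psi>. smooth_cutoff n \<psi> \<and> (\<forall>x. (\<forall>i<n. \<bar>x i - z j i\<bar> \<le> r j) \<longrightarrow> \<psi> x = 1) \<and>
    (\<forall>x. (\<exists>i<n. \<bar>x i - z j i\<bar> \<ge> 2 * r j) \<longrightarrow> \<psi> x = 0)" for j by (rule cube_cutoff_ex[OF r(1)])
  then obtain \<psi> where \<psi>: "\<And>j. smooth_cutoff n (\<psi> j)"
    "\<And>j x. (\<forall>i<n. \<bar>x i - z j i\<bar> \<le> r j) \<Longrightarrow> \<psi> j x = 1"
    "\<And>j x i. i < n \<Longrightarrow> \<bar>x i - z j i\<bar> \<ge> 2 * r j \<Longrightarrow> \<psi> j x = 0" by metis
  have \<psi>1: "\<psi> j x = 1" if "x \<in> Cy (z j)" for j x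
    using that \<psi>(2)[of x j] by (auto simp: Cy_def r_def less_imp_le)
  \<comment> \<open>a partition of unity that is locally finite although the cover need not be: on the \<open>J\<close>-th
    cylinder \<open>\<psi> J = 1\<close>, so all later terms vanish\<close>
  define \<omega> where "\<omega> j x = \<psi> j x * (\<Prod>i<j. 1 - \<psi> i x)" for j x
  have \<omega>_cut: "smooth_cutoff n (\<omega> j)" for j
    unfolding \<omega>_def[abs_def] by (intro smooth_cutoff_mult smooth_cutoff_prod smooth_cutoff_compl \<psi>)
  then have \<omega>_smooth: "\<omega> j \<in> elem_smooth" and \<omega>_nonneg: "0 \<le> \<omega> j x" for j x
    by (auto simp: smooth_cutoff_def)
  have "\<exists>B>0. \<forall>x. \<forall>i<n. \<bar>partial_deriv i (\<omega> j) x\<bar> \<le> B" for j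
  proof -
    obtain B where "\<forall>x. \<forall>i<n. \<bar>partial_deriv i (\<omega> j) x\<bar> \<le> B" using \<omega>_cut[of j] by (auto simp: smooth_cutoff_def)
    then show ?thesis by (intro exI[of _ "max B 1"]) (force intro: le_max_iff_disj[THEN iffD2])
  qed
  then obtain B where B: "\<And>j. B j > 0" "\<And>j x i. i < n \<Longrightarrow> \<bar>partial_deriv i (\<omega> j) x\<bar> \<le> B j" by metis
  have sum_\<omega>: "(\<Sum>j\<le>J. \<omega> j x) = 1" if "x \<in> Cy (z J)" for x J
    unfolding \<omega>_def sum_prod_compl using \<psi>1[OF that] by (simp add: prod_zero_iff) blast
  have \<omega>0: "\<omega> j x = 0" if "x \<in> Cy (z J)" "J < j" for x J j
    unfolding \<omega>_def using \<psi>1[OF that(1)] that(2) by (auto simp: prod_zero_iff)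
  \<comment> \<open>The factor B j + 1 pays for the gradient of the weight and the power of 2 makes
    these errors sum to at most e / 2; the other e / 2 is left for the gradient errors of the
    approximants.\<close>
  define \<epsilon> where "\<epsilon> j = e / (2 ^ (j + 2) * (B j + 1))" for j
  have \<epsilon>: "\<epsilon> j > 0" "B j * \<epsilon> j \<le> e / 2 ^ (j + 2)" "\<epsilon> j \<le> e / 2" for j
  proof -
    show "\<epsilon> j > 0" using e B(1)[of j] by (simp add: \<epsilon>_def)
    have "B j * \<epsilon> j = e / 2 ^ (j + 2) * (B j / (B j + 1))" by (simp add: \<epsilon>_def)
    also have "\<dots> \<le> e / 2 ^ (j + 2) * 1" using B(1)[of j] e by (intro mult_left_mono) auto
    finally show "B j * \<epsilon> j \<le> e / 2 ^ (j + 2)" by simp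
    have "1 * 2 \<le> (2::real) ^ j * 2 ^ 2" by (intro mult_mono) auto
    then have "(2::real) \<le> 2 ^ (j + 2)" by (simp only: power_add mult_1)
    then have "(2::real) * 1 \<le> 2 ^ (j + 2) * (B j + 1)"
      using B(1)[of j] by (intro mult_mono) auto
    then show "\<epsilon> j \<le> e / 2" unfolding \<epsilon>_def using e by (intro divide_left_mono) auto
  qed
  have "\<exists>p\<in>elem_smooth. \<forall>x\<in>cube n (z j) (2 * r j). \<bar>p x - u x\<bar> \<le> \<epsilon> j \<and>
      (\<forall>i<n. \<bar>partial_deriv i p x - D i x\<bar> \<le> \<epsilon> j)" for j
    by (rule cube_C1_approx[OF u]) (use r[of j] \<epsilon> in auto)
  then obtain p where p: "\<And>j. p j \<in> elem_smooth"
    "\<And>j x. x \<in> cube n (z j) (2 * r j) \<Longrightarrow> \<bar>p j x - u x\<bar> \<le> \<epsilon> j"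
    "\<And>j x i. x \<in> cube n (z j) (2 * r j) \<Longrightarrow> i < n \<Longrightarrow> \<bar>partial_deriv i (p j) x - D i x\<bar> \<le> \<epsilon> j" by metis
  \<comment> \<open>The least index is just one admissible stopping point: by \<open>g_eq\<close>
    every J whose cylinder contains x gives the same value, so on each cylinder \<open>g\<close> is
    one finite elementary sum.\<close>
  define g where "g x = (\<Sum>j\<le>(LEAST j. x \<in> Cy (z j)). \<omega> j x * p j x)" for x
  have g_eq: "g x = (\<Sum>j\<le>J. \<omega> j x * p j x)" if x: "x \<in> Cy (z J)" for x J
    unfolding g_def
  proof (rule sum.mono_neutral_left)
    show "{..LEAST j. x \<in> Cy (z j)} \<subseteq> {..J}" using Least_le[of "\<lambda>j. x \<in> Cy (z j)", OF x] by auto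
    show "\<forall>i\<in>{..J} - {..LEAST j. x \<in> Cy (z j)}. \<omega> i x * p i x = 0"
      using \<omega>0[of x "LEAST j. x \<in> Cy (z j)"] LeastI[of "\<lambda>j. x \<in> Cy (z j)", OF x] by auto
  qed auto
  have g_eq': "g x = (\<Sum>j\<le>J. \<omega> j x * (p j x - u x)) + u x" if x: "x \<in> Cy (z J)" for x J
    unfolding g_eq[OF x] right_diff_distrib sum_subtractf sum_distrib_right[symmetric] sum_\<omega>[OF x] by simp
  have in_cube: "x \<in> cube n (z j) (2 * r j)" if "\<omega> j x \<noteq> 0" "x \<in> G" for j x
    using that \<psi>(3)[where x = x and j = j] openin_Euclidean_space_imp_zero[OF G that(2)]
    by (auto simp: cube_def \<omega>_def) (meson linear)
  show ?thesis
  proof (intro exI[of _ g] conjI allI ballI impI)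
    show "C_diff_on n d G g" for d
    proof (rule locally_elem_smooth_imp_C_diff_on[OF G])
      fix x assume "x \<in> G"
      then obtain J where "x \<in> Cy (z J)" using z_cov by blast
      moreover have "(\<lambda>x. \<Sum>j\<le>J. \<omega> j x * p j x) \<in> elem_smooth"
        by (intro elem_smooth_sum elem_smooth.mult \<omega>_smooth p)
      ultimately show "\<exists>U h. open U \<and> x \<in> U \<and> h \<in> elem_smooth \<and> (\<forall>y\<in>U \<inter> G. g y = h y)"
        by (intro exI[of _ "Cy (z J)"] exI[of _ "\<lambda>x. \<Sum>j\<le>J. \<omega> j x * p j x"]) (auto simp: Cy_open g_eq)
    qed
  next
    fix x assume x: "x \<in> G"
    obtain J where J: "x \<in> Cy (z J)" using z_cov[OF x] by blast
    have pu: "\<omega> j x * \<bar>p j x - u x\<bar> \<le> \<omega> j x * e" for j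
      using p(2)[OF in_cube[OF _ x], of j] \<omega>_nonneg[of j x] \<epsilon>(3)[of j] e
      by (cases "\<omega> j x = 0") (auto intro!: mult_left_mono)
    have "\<bar>g x - u x\<bar> = \<bar>\<Sum>j\<le>J. \<omega> j x * (p j x - u x)\<bar>" by (simp add: g_eq'[OF J])
    also have "\<dots> \<le> (\<Sum>j\<le>J. \<omega> j x * e)"
      by (rule order_trans[OF sum_abs sum_mono]) (use pu \<omega>_nonneg in \<open>auto simp: abs_mult\<close>)
    also have "\<dots> = e" unfolding sum_distrib_right[symmetric] sum_\<omega>[OF J] by simp
    finally show "\<bar>g x - u x\<bar> \<le> e" .
    fix i assume i: "i < n"
    have du: "has_partial i u x (D i x)" using C1_onD(3)[OF u i x] .
    define c where "c j = partial_deriv i (\<omega> j) x" for j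
    define E where "E j = c j * (p j x - u x) + (partial_deriv i (p j) x - D i x) * \<omega> j x" for j
    have d\<omega>: "has_partial i (\<omega> j) x (c j)" for j unfolding c_def by (rule elem_smooth_partial[OF \<omega>_smooth])
    have c0: "c j = 0" if "\<omega> j x = 0" for j by (rule has_partial_nonneg_zero[OF \<omega>_nonneg that d\<omega>])
    have dE: "has_partial i (\<lambda>y. \<omega> j y * (p j y - u y)) x (E j)" for j
    proof -
      have "has_partial i (p j) x (partial_deriv i (p j) x)" by (rule elem_smooth_partial[OF p(1)])
      from DERIV_mult[OF d\<omega>[of j] DERIV_diff[OF this du]] show ?thesis unfolding E_def by simp
    qed
    have *: "has_partial i (\<lambda>y. (\<Sum>j\<le>J. \<omega> j y * (p j y - u y)) + u y) x ((\<Sum>j\<le>J. E j) + D i x)"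
      by (rule DERIV_add[OF has_partial_sum[OF dE] du])
    have "\<forall>\<^sub>F t in nhds (x i). g (x(i := t)) = (\<Sum>j\<le>J. \<omega> j (x(i := t)) * (p j (x(i := t)) - u (x(i := t)))) + u (x(i := t))"
      by (rule eventually_mono[OF eventually_upd_in_open[OF Cy_open J]]) (rule g_eq')
    then have gE: "has_partial i g x ((\<Sum>j\<le>J. E j) + D i x)"
      using has_partial_cong[of g x i "\<lambda>y. (\<Sum>j\<le>J. \<omega> j y * (p j y - u y)) + u y"] * by blast
    have Ej: "\<bar>E j\<bar> \<le> e / 2 ^ (j + 2) + \<omega> j x * (e / 2)" for j
    proof (cases "\<omega> j x = 0")
      case True
      then show ?thesis using c0 e by (simp add: E_def)
    next
      case False
      have "\<bar>E j\<bar> \<le> \<bar>c j\<bar> * \<bar>p j x - u x\<bar> + \<bar>partial_deriv i (p j) x - D i x\<bar> * \<omega> j x"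
        unfolding E_def using abs_triangle_ineq[of "c j * (p j x - u x)" "(partial_deriv i (p j) x - D i x) * \<omega> j x"] \<omega>_nonneg[of j x]
        by (simp add: abs_mult)
      also have "\<dots> \<le> B j * \<epsilon> j + (e / 2) * \<omega> j x"
        using p(2)[OF in_cube[OF False x]] p(3)[OF in_cube[OF False x] i] \<omega>_nonneg[of j x] B(1)[of j] B(2)[OF i, of j x] \<epsilon>(3)[of j]
        by (intro add_mono mult_mono) (auto simp: c_def)
      also have "\<dots> \<le> e / 2 ^ (j + 2) + \<omega> j x * (e / 2)" using \<epsilon>(2)[of j] by (simp add: mult.commute)
      finally show ?thesis .
    qed
    have "\<bar>\<Sum>j\<le>J. E j\<bar> \<le> (\<Sum>j\<le>J. e / 2 ^ (j + 2) + \<omega> j x * (e / 2))"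
      by (rule order_trans[OF sum_abs sum_mono]) (rule Ej)
    also have "\<dots> = e / 4 * (\<Sum>j\<le>J. (1 / 2) ^ j) + e / 2"
      unfolding sum.distrib sum_distrib_right[symmetric] sum_\<omega>[OF J]
      by (simp add: sum_distrib_left power_divide)
    also have "(\<Sum>j\<le>J. (1 / 2 :: real) ^ j) = 2 - (1 / 2) ^ J"
      by (induction J) auto
    also have "e / 4 * (2 - (1 / 2) ^ J) + e / 2 \<le> e" using e by (simp add: field_simps)
    finally have "\<bar>\<Sum>j\<le>J. E j\<bar> \<le> e" .
    then show "\<exists>D'. has_partial i g x D' \<and> \<bar>D' - D i x\<bar> \<le> e" using gE by (intro exI[of _ "(\<Sum>j\<le>J. E j) + D i x"]) auto
  qed
qed

subsection \<open>The logarithmic Sobolev inequality for continuously differentiable functions\<close>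

locale log_sobolev_space = prob_space M for M :: "(nat \<Rightarrow> real) measure" +
  fixes n :: nat and G :: "(nat \<Rightarrow> real) set" and \<sigma> :: real
  assumes open_G: "openin (Euclidean_space n) G"
    and sets_M: "sets M = sets (restrict_space borel G)"
    and \<sigma>_pos: "\<sigma> > 0"
    and lsi: "log_sobolev n G M (\<sigma>\<^sup>2)"
begin

lemma space_M: "space M = G"
  using sets_eq_imp_space_eq[OF sets_M] by (simp add: space_restrict_space)

lemma continuous_on_measurable: "continuous_on G h \<Longrightarrow> h \<in> borel_measurable M"
  for h :: "(nat \<Rightarrow> real) \<Rightarrow> real"
  using borel_measurable_continuous_on_restrict[of G h] measurable_cong_sets[OF sets_M refl] by blast

lemma integrable_bounded:
  fixes h :: "(nat \<Rightarrow> real) \<Rightarrow> real"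
  assumes "h \<in> borel_measurable M" "\<And>x. x \<in> G \<Longrightarrow> \<bar>h x\<bar> \<le> B"
  shows "integrable M h"
  by (rule integrable_const_bound[where B = B]) (use assms in \<open>auto simp: space_M\<close>)

text \<open>Bounds away from 0 and infinity let the entropies of smooth approximants converge by
  dominated convergence. The energy enters through an integrable majorant \<open>w\<close> of the
  squared gradient, so that an application may estimate pointwise before integrating.\<close>

lemma lsi_C1:
  assumes g: "C1_on n G g D" and c: "c > 0" and bnd: "\<And>x. x \<in> G \<Longrightarrow> c \<le> g x" "\<And>x. x \<in> G \<Longrightarrow> g x \<le> B"
    and w: "integrable M w" and Dw: "\<And>x. x \<in> G \<Longrightarrow> (\<Sum>i<n. (D i x)\<^sup>2) \<le> w x"
  shows "Ent M (\<lambda>x. (g x)\<^sup>2) \<le> 2 * \<sigma>\<^sup>2 * (\<integral>x. w x \<partial>M)"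
proof -
  \<comment> \<open>Errors of at most 1 and c / 2 keep the approximants between c / 2 and B +
    1.\<close>
  define e where "e m = min 1 (c / 2) / real (Suc m)" for m
  have e: "e m > 0" "e m \<le> 1" "e m \<le> c / 2" for m
  proof -
    have "min 1 (c / 2) / real (Suc m) \<le> min 1 (c / 2) / 1" using c by (intro divide_left_mono) auto
    then show "e m > 0" "e m \<le> 1" "e m \<le> c / 2" using c by (auto simp: e_def)
  qed
  have e_lim: "e \<longlonglongrightarrow> 0"
    using tendsto_mult_right_zero[OF LIMSEQ_Suc[OF lim_1_over_n], of "min 1 (c / 2)"] by (simp add: e_def[abs_def])
  have "\<exists>h. (\<forall>d. C_diff_on n d G h) \<and>
    (\<forall>x\<in>G. \<bar>h x - g x\<bar> \<le> e m \<and> (\<forall>i<n. \<exists>D'. has_partial i h x D' \<and> \<bar>D' - D i x\<bar> \<le> e m))" for m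
    by (rule C1_smooth_approx[OF open_G g e(1)])
  then obtain h where h: "\<And>m d. C_diff_on n d G (h m)" "\<And>m x. x \<in> G \<Longrightarrow> \<bar>h m x - g x\<bar> \<le> e m"
    "\<And>m x i. x \<in> G \<Longrightarrow> i < n \<Longrightarrow> \<exists>D'. has_partial i (h m) x D' \<and> \<bar>D' - D i x\<bar> \<le> e m" by metis
  have h_bnd: "c / 2 \<le> h m x" "h m x \<le> B + 1" if "x \<in> G" for m x
    using h(2)[OF that, of m] bnd[OF that] e[of m] by linarith+
  have h_lim: "(\<lambda>m. h m x) \<longlonglongrightarrow> g x" if "x \<in> G" for x
  proof -
    have "(\<lambda>m. h m x - g x) \<longlonglongrightarrow> 0"
      by (rule Lim_null_comparison[OF _ e_lim]) (use h(2)[OF that] in auto)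
    from tendsto_add[OF this tendsto_const[of "g x"]] show ?thesis by simp
  qed
  have [measurable]: "h m \<in> borel_measurable M" for m
  proof (rule continuous_on_measurable)
    show "continuous_on G (h m)" using h(1)[of 0 m] unfolding C_diff_on_def by force
  qed
  have [measurable]: "g \<in> borel_measurable M" using continuous_on_measurable C1_onD(1)[OF g] .
  have int_lim: "(\<lambda>m. \<integral>x. k (h m x) \<partial>M) \<longlonglongrightarrow> (\<integral>x. k (g x) \<partial>M)"
    if k: "continuous_on {c / 2..B + 1} k" and [measurable]: "k \<in> borel_measurable borel" for k :: "real \<Rightarrow> real"
  proof -
    have "bounded (k ` {c / 2..B + 1})" using k by (intro compact_imp_bounded compact_continuous_image) auto
    then obtain K where "\<forall>y\<in>k ` {c / 2..B + 1}. norm y \<le> K" unfolding bounded_iff by blast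
    then have K: "\<bar>k t\<bar> \<le> K" if "t \<in> {c / 2..B + 1}" for t using that by (metis imageI real_norm_def)
    show ?thesis
    proof (rule integral_dominated_convergence[where w = "\<lambda>_. K"])
      show "AE x in M. (\<lambda>m. k (h m x)) \<longlonglongrightarrow> k (g x)"
      proof (rule AE_I2)
        fix x assume "x \<in> space M"
        then have x: "x \<in> G" by (simp add: space_M)
        show "(\<lambda>m. k (h m x)) \<longlonglongrightarrow> k (g x)"
          by (rule continuous_on_tendsto_compose[OF k h_lim[OF x]]) (use bnd[OF x] h_bnd[OF x] c in auto)
      qed
      show "AE x in M. norm (k (h m x)) \<le> K" for m
        by (rule AE_I2) (use K h_bnd in \<open>auto simp: space_M\<close>)
    qed auto
  qed
  have lim1: "(\<lambda>m. \<integral>x. (h m x)\<^sup>2 * ln ((h m x)\<^sup>2) \<partial>M) \<longlonglongrightarrow> (\<integral>x. (g x)\<^sup>2 * ln ((g x)\<^sup>2) \<partial>M)"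
    by (rule int_lim[of "\<lambda>t. t\<^sup>2 * ln (t\<^sup>2)"]) (use c in \<open>auto intro!: continuous_intros\<close>)
  have lim2: "(\<lambda>m. \<integral>x. (h m x)\<^sup>2 \<partial>M) \<longlonglongrightarrow> (\<integral>x. (g x)\<^sup>2 \<partial>M)"
    by (rule int_lim[of "\<lambda>t. t\<^sup>2"]) (auto intro!: continuous_intros)
  have g_le: "g x \<le> B" "0 \<le> g x" "\<bar>g x\<bar> \<le> B" if "x \<in> G" for x using bnd[OF that] c by auto
  have "c\<^sup>2 \<le> (\<integral>x. (g x)\<^sup>2 \<partial>M)"
  proof (rule integral_ge_const)
    show "integrable M (\<lambda>x. (g x)\<^sup>2)"
      by (rule integrable_bounded[of _ "B\<^sup>2"]) (use g_le in \<open>auto intro: power_mono\<close>)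
    show "AE x in M. c\<^sup>2 \<le> (g x)\<^sup>2" by (rule AE_I2) (use bnd c in \<open>auto simp: space_M intro: power_mono\<close>)
  qed
  then have pos: "(\<integral>x. (g x)\<^sup>2 \<partial>M) > 0" using c by (smt (verit) zero_less_power)
  have Ent_lim: "(\<lambda>m. Ent M (\<lambda>x. (h m x)\<^sup>2)) \<longlonglongrightarrow> Ent M (\<lambda>x. (g x)\<^sup>2)"
    unfolding Ent_def using pos by (intro tendsto_intros lim1 lim2) auto
  have Ent_le: "Ent M (\<lambda>x. (h m x)\<^sup>2) \<le> 2 * \<sigma>\<^sup>2 * ((1 + e m) * (\<integral>x. w x \<partial>M) + real n * ((e m)\<^sup>2 + e m))" for m
  proof -
    \<comment> \<open>Comes from (a + b)^2 \<le> (1 + e) a^2 + e + e^2 for |b| \<le> e, where the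
      cross term is split with weight e. The surplus vanishes as e tends to 0.\<close>
    define v where "v x = (1 + e m) * w x + real n * ((e m)\<^sup>2 + e m)" for x
    have v_int: "integrable M v" unfolding v_def[abs_def] using w by auto
    have w0: "0 \<le> w x" if "x \<in> G" for x using Dw[OF that] by (rule order_trans[rotated]) (auto intro: sum_nonneg)
    have v0: "0 \<le> v x" if "x \<in> G" for x using w0[OF that] e(1)[of m] by (auto simp: v_def intro!: add_nonneg_nonneg mult_nonneg_nonneg)
    have v_nonneg: "0 \<le> (\<integral>x. v x \<partial>M)"
      by (rule integral_nonneg_AE, rule AE_I2) (use v0 in \<open>auto simp: space_M\<close>)
    have grad: "(gradient_norm n (h m) x)\<^sup>2 \<le> v x" if x: "x \<in> G" for x
    proof -
      have "(gradient_norm n (h m) x)\<^sup>2 = (\<Sum>i<n. (partial_deriv i (h m) x)\<^sup>2)"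
        unfolding gradient_norm_def L2_set_def by (simp add: sum_nonneg)
      also have "\<dots> \<le> (\<Sum>i<n. (1 + e m) * (D i x)\<^sup>2 + ((e m)\<^sup>2 + e m))"
      proof (rule sum_mono)
        fix i assume "i \<in> {..<n}"
        then obtain D' where "has_partial i (h m) x D'" and D': "\<bar>D' - D i x\<bar> \<le> e m" using h(3)[OF x, of i m] by auto
        then have "partial_deriv i (h m) x = D'" by (intro has_partial_imp_eq)
        moreover define b where "b = D' - D i x"
        have "b\<^sup>2 \<le> (e m)\<^sup>2" using D' unfolding b_def by (rule abs_le_square_iff[THEN iffD1, OF order_trans]) simp
        moreover have "2 * (D i x * b) \<le> e m * (D i x)\<^sup>2 + e m"
        proof -
          have "0 \<le> (e m * D i x - b)\<^sup>2" by simp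
          then have "e m * (2 * (D i x * b)) \<le> e m * (e m * (D i x)\<^sup>2 + e m)"
            using \<open>b\<^sup>2 \<le> (e m)\<^sup>2\<close> by (simp add: power2_eq_square algebra_simps)
          then show ?thesis using e(1)[of m] by (simp only: mult_le_cancel_left_pos)
        qed
        moreover have "D'\<^sup>2 = (D i x)\<^sup>2 + 2 * (D i x * b) + b\<^sup>2" by (simp add: b_def power2_eq_square algebra_simps)
        ultimately show "(partial_deriv i (h m) x)\<^sup>2 \<le> (1 + e m) * (D i x)\<^sup>2 + ((e m)\<^sup>2 + e m)"
          by (simp add: algebra_simps)
      qed
      also have "\<dots> = (1 + e m) * (\<Sum>i<n. (D i x)\<^sup>2) + real n * ((e m)\<^sup>2 + e m)"
        by (simp add: sum.distrib sum_distrib_left)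
      also have "\<dots> \<le> v x" unfolding v_def using Dw[OF x] e(1)[of m] by (intro add_right_mono mult_left_mono) auto
      finally show ?thesis .
    qed
    have "bounded (h m ` G)"
    proof (rule boundedI)
      fix y assume "y \<in> h m ` G"
      then obtain x where "x \<in> G" "y = h m x" by auto
      then show "norm y \<le> B + 1" using h_bnd[of x m] c by simp
    qed
    then have "ennreal (Ent M (\<lambda>x. (h m x)\<^sup>2)) \<le> ennreal (2 * \<sigma>\<^sup>2) * (\<integral>\<^sup>+ x. ennreal ((gradient_norm n (h m) x)\<^sup>2) \<partial>M)"
      using lsi h(1) unfolding log_sobolev_def by blast
    also have "\<dots> \<le> ennreal (2 * \<sigma>\<^sup>2) * (\<integral>\<^sup>+ x. ennreal (v x) \<partial>M)"
      by (intro mult_left_mono nn_integral_mono ennreal_leI) (use grad in \<open>auto simp: space_M\<close>)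
    also have "(\<integral>\<^sup>+ x. ennreal (v x) \<partial>M) = ennreal (\<integral>x. v x \<partial>M)"
      by (rule nn_integral_eq_integral[OF v_int]) (rule AE_I2, use v0 in \<open>auto simp: space_M\<close>)
    also have "ennreal (2 * \<sigma>\<^sup>2) * ennreal (\<integral>x. v x \<partial>M) = ennreal (2 * \<sigma>\<^sup>2 * (\<integral>x. v x \<partial>M))"
      by (rule ennreal_mult[symmetric]) (use v_nonneg in auto)
    finally have "Ent M (\<lambda>x. (h m x)\<^sup>2) \<le> 2 * \<sigma>\<^sup>2 * (\<integral>x. v x \<partial>M)"
      by (subst (asm) ennreal_le_iff) (use v_nonneg in auto)
    also have "(\<integral>x. v x \<partial>M) = (1 + e m) * (\<integral>x. w x \<partial>M) + real n * ((e m)\<^sup>2 + e m)"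
      unfolding v_def using w by (simp add: prob_space)
    finally show ?thesis .
  qed
  have "(\<lambda>m. 2 * \<sigma>\<^sup>2 * ((1 + e m) * (\<integral>x. w x \<partial>M) + real n * ((e m)\<^sup>2 + e m)))
      \<longlonglongrightarrow> 2 * \<sigma>\<^sup>2 * ((1 + 0) * (\<integral>x. w x \<partial>M) + real n * (0\<^sup>2 + 0))"
    by (intro tendsto_intros e_lim)
  from LIMSEQ_le[OF Ent_lim this] Ent_le show ?thesis by auto
qed

end

section \<open>Second-order expansion of the entropy and the Poincare inequality for bounded
  functions\<close>

lemma ln_one_plus_cubic_lower:
  fixes s :: real
  assumes "\<bar>s\<bar> \<le> 1 / 2"
  shows "s - s\<^sup>2 / 2 - \<bar>s\<bar> ^ 3 \<le> ln (1 + s)"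
proof (cases "s \<ge> 0")
  case True
  have "ln (1 + 0) - 0 + 0\<^sup>2 / 2 \<le> ln (1 + s) - s + s\<^sup>2 / 2"
  proof (rule DERIV_nonneg_imp_nondecreasing[OF True])
    fix t :: real assume "0 \<le> t" "t \<le> s"
    then show "\<exists>y. ((\<lambda>t. ln (1 + t) - t + t\<^sup>2 / 2) has_real_derivative y) (at t) \<and> 0 \<le> y"
      by (intro exI[of _ "1 / (1 + t) - 1 + t"] conjI)
         (auto intro!: derivative_eq_intros simp: field_simps)
  qed
  then have "0 \<le> ln (1 + s) - s + s\<^sup>2 / 2" by simp
  then show ?thesis using zero_le_power[of "\<bar>s\<bar>" 3] by linarith
next
  case False
  have "ln (1 + 0) - 0 + 0\<^sup>2 / 2 - 0 ^ 3 \<le> ln (1 + s) - s + s\<^sup>2 / 2 - s ^ 3"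
  proof (rule DERIV_nonpos_imp_nonincreasing[where a = s and b = 0 and f = "\<lambda>t. ln (1 + t) - t + t\<^sup>2 / 2 - t ^ 3"])
    show "s \<le> 0" using False by simp
    fix t :: real assume t: "s \<le> t" "t \<le> 0"
    then have t': "t \<ge> - 1 / 2" using assms by linarith
    have "1 / (1 + t) - 1 + t - 3 * t\<^sup>2 = t\<^sup>2 * (1 / (1 + t) - 3)" using t' by (simp add: field_simps power2_eq_square)
    also have "\<dots> \<le> 0" using t' by (intro mult_nonneg_nonpos) (auto simp: field_simps)
    finally show "\<exists>y. ((\<lambda>t. ln (1 + t) - t + t\<^sup>2 / 2 - t ^ 3) has_real_derivative y) (at t) \<and> y \<le> 0"
      using t' by (intro exI[of _ "1 / (1 + t) - 1 + t - 3 * t\<^sup>2"] conjI)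
         (auto intro!: derivative_eq_intros)
  qed
  moreover have "\<bar>s\<bar> ^ 3 = - (s ^ 3)" using False by (simp add: abs_if power3_eq_cube)
  ultimately show ?thesis by simp
qed

text \<open>Expansion of the entropy integrand around 1. In the product of (1 + s)^2 with the
  quadratic polynomial the cubic terms cancel, and the remaining errors amount to at most 1/2 + 9/2
  = 5 times \<open>\<bar>s\<bar> ^ 3\<close>.\<close>

lemma entropy_integrand_lower:
  fixes s :: real
  assumes s: "\<bar>s\<bar> \<le> 1 / 2"
  shows "2 * s + 3 * s\<^sup>2 - 6 * \<bar>s\<bar> ^ 3 \<le> (1 + s)\<^sup>2 * ln ((1 + s)\<^sup>2)"
proof -
  have "2 * (1 + s)\<^sup>2 * (s - s\<^sup>2 / 2 - \<bar>s\<bar> ^ 3) \<le> 2 * (1 + s)\<^sup>2 * ln (1 + s)"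
    by (intro mult_left_mono ln_one_plus_cubic_lower s) auto
  also have "\<dots> = (1 + s)\<^sup>2 * ln ((1 + s)\<^sup>2)" using s by (simp add: ln_realpow)
  finally have *: "2 * (1 + s)\<^sup>2 * (s - s\<^sup>2 / 2 - \<bar>s\<bar> ^ 3) \<le> (1 + s)\<^sup>2 * ln ((1 + s)\<^sup>2)" .
  have "2 * (1 + s)\<^sup>2 * (s - s\<^sup>2 / 2 - \<bar>s\<bar> ^ 3) = 2 * s + 3 * s\<^sup>2 - s ^ 4 - 2 * (1 + s)\<^sup>2 * \<bar>s\<bar> ^ 3"
    by (simp add: power2_eq_square power4_eq_xxxx algebra_simps)
  moreover have "s ^ 4 \<le> \<bar>s\<bar> ^ 3 * (1 / 2)"
  proof -
    have "s ^ 4 = \<bar>s\<bar> ^ 3 * \<bar>s\<bar>" by (simp add: power4_eq_xxxx power3_eq_cube)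
    also have "\<dots> \<le> \<bar>s\<bar> ^ 3 * (1 / 2)" using s by (intro mult_left_mono) auto
    finally show ?thesis .
  qed
  moreover have "2 * (1 + s)\<^sup>2 * \<bar>s\<bar> ^ 3 \<le> (9 / 2) * \<bar>s\<bar> ^ 3"
  proof (rule mult_right_mono)
    have "(1 + s)\<^sup>2 \<le> (3 / 2)\<^sup>2" using s by (intro power_mono) auto
    then show "2 * (1 + s)\<^sup>2 \<le> 9 / 2" by (simp add: power2_eq_square)
  qed auto
  ultimately show ?thesis using * zero_le_power[of "\<bar>s\<bar>" 3] by linarith
qed

context log_sobolev_space
begin

text \<open>Linearisation of the logarithmic Sobolev inequality at the constant 1. For
  \<open>1 + t * F\<close> the entropy is at least 2 t^2 V up to higher order: 3 t^2 V from the
  integrand, less t^2 V from the normalising term, while the linear term integrates to 0. Dividing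
  by t^2 and letting t tend to 0 removes the rest.\<close>

lemma poincare_bounded:
  assumes F: "C1_on n G F D" and B: "\<And>x. x \<in> G \<Longrightarrow> \<bar>F x\<bar> \<le> B" and mean: "(\<integral>x. F x \<partial>M) = 0"
    and w: "integrable M w" and Dw: "\<And>x. x \<in> G \<Longrightarrow> (\<Sum>i<n. (D i x)\<^sup>2) \<le> w x"
  shows "(\<integral>x. (F x)\<^sup>2 \<partial>M) \<le> \<sigma>\<^sup>2 * (\<integral>x. w x \<partial>M)"
proof -
  have "G \<noteq> {}" using not_empty by (simp add: space_M)
  then have B0: "B \<ge> 0" using B by (metis abs_ge_zero all_not_in_conv order_trans)
  have [measurable]: "F \<in> borel_measurable M" using continuous_on_measurable C1_onD(1)[OF F] .
  define V where "V = (\<integral>x. (F x)\<^sup>2 \<partial>M)"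
  have F2: "(F x)\<^sup>2 \<le> B\<^sup>2" if "x \<in> G" for x using power_mono[OF B[OF that], of 2] by simp
  have int_F: "integrable M F" by (rule integrable_bounded[of _ B]) (use B in auto)
  have int_F2: "integrable M (\<lambda>x. (F x)\<^sup>2)" by (rule integrable_bounded[of _ "B\<^sup>2"]) (use F2 in auto)
  have V0: "V \<ge> 0" unfolding V_def by (intro integral_nonneg_AE) auto
  have key: "2 * V \<le> 2 * \<sigma>\<^sup>2 * (\<integral>x. w x \<partial>M) + 6 * t * B ^ 3 + t\<^sup>2 * V\<^sup>2" if t: "t > 0" "t * B \<le> 1 / 2" for t
  proof -
    have tF: "\<bar>t * F x\<bar> \<le> 1 / 2" if "x \<in> G" for x
    proof -
      have "t * \<bar>F x\<bar> \<le> t * B" using B[OF that] t(1) by (intro mult_left_mono) auto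
      then have "t * \<bar>F x\<bar> \<le> 1 / 2" using t(2) by linarith
      then show ?thesis using t(1) by (simp only: abs_mult abs_of_pos)
    qed
    define g where "g x = 1 + t * F x" for x
    have g12: "1 / 2 \<le> g x" "g x \<le> 3 / 2" if "x \<in> G" for x using tF[OF that] unfolding g_def by linarith+
    have g_C1: "C1_on n G g (\<lambda>i x. t * D i x)"
      unfolding C1_on_def g_def
    proof (intro conjI allI impI ballI)
      show "continuous_on G (\<lambda>x. 1 + t * F x)" by (intro continuous_intros C1_onD(1)[OF F])
      fix i assume i: "i < n"
      show "continuous_on G (\<lambda>x. t * D i x)" by (intro continuous_intros C1_onD(2)[OF F i])
      fix x assume "x \<in> G"
      show "has_partial i (\<lambda>x. 1 + t * F x) x (t * D i x)"
        using DERIV_add[OF DERIV_const DERIV_cmult[OF C1_onD(3)[OF F i \<open>x \<in> G\<close>]], of 1 t] by simp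
    qed
    have "Ent M (\<lambda>x. (g x)\<^sup>2) \<le> 2 * \<sigma>\<^sup>2 * (\<integral>x. t\<^sup>2 * w x \<partial>M)"
    proof (rule lsi_C1[OF g_C1, of "1 / 2" "3 / 2"])
      show "integrable M (\<lambda>x. t\<^sup>2 * w x)" using w by auto
      show "(\<Sum>i<n. (t * D i x)\<^sup>2) \<le> t\<^sup>2 * w x" if "x \<in> G" for x
        using Dw[OF that] by (simp add: power_mult_distrib mult_left_mono flip: sum_distrib_left)
    qed (use g12 in auto)
    then have up: "Ent M (\<lambda>x. (g x)\<^sup>2) \<le> 2 * \<sigma>\<^sup>2 * t\<^sup>2 * (\<integral>x. w x \<partial>M)" by simp
    have g2: "(\<integral>x. (g x)\<^sup>2 \<partial>M) = 1 + t\<^sup>2 * V"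
    proof -
      have "(\<lambda>x. (g x)\<^sup>2) = (\<lambda>x. 1 + 2 * t * F x + t\<^sup>2 * (F x)\<^sup>2)"
        by (auto simp: g_def power2_eq_square algebra_simps)
      then show ?thesis using int_F int_F2 mean by (simp add: prob_space V_def)
    qed
    have "3 * t\<^sup>2 * V - 6 * (t * B) ^ 3 = (\<integral>x. 2 * t * F x + 3 * t\<^sup>2 * (F x)\<^sup>2 - 6 * (t * B) ^ 3 \<partial>M)"
      using int_F int_F2 mean by (simp add: prob_space V_def)
    also have "\<dots> \<le> (\<integral>x. (g x)\<^sup>2 * ln ((g x)\<^sup>2) \<partial>M)"
    proof (rule integral_mono)
      have "\<bar>(g x)\<^sup>2 * ln ((g x)\<^sup>2)\<bar> \<le> (3 / 2)\<^sup>2 * ((3 / 2)\<^sup>2 + 4)" if "x \<in> G" for x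
        unfolding abs_mult
      proof (rule mult_mono)
        have b: "(1 / 2)\<^sup>2 \<le> (g x)\<^sup>2" "(g x)\<^sup>2 \<le> (3 / 2)\<^sup>2" using g12[OF that] by (auto intro!: power_mono)
        show "\<bar>(g x)\<^sup>2\<bar> \<le> (3 / 2)\<^sup>2" using b by simp
        have p: "(g x)\<^sup>2 > 0" using b by (smt (verit) zero_less_power divide_pos_pos)
        have "inverse ((g x)\<^sup>2) \<le> inverse ((1 / 2)\<^sup>2)" using b by (intro le_imp_inverse_le) auto
        then have "inverse ((g x)\<^sup>2) \<le> 4" by (simp add: power2_eq_square)
        then have "- ln ((g x)\<^sup>2) \<le> 4" using ln_le_minus_one[of "inverse ((g x)\<^sup>2)"] p by (simp add: ln_inverse)
        moreover have "ln ((g x)\<^sup>2) \<le> (3 / 2)\<^sup>2" using ln_le_minus_one[OF p] b by linarith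
        ultimately show "\<bar>ln ((g x)\<^sup>2)\<bar> \<le> (3 / 2)\<^sup>2 + 4" by (smt (verit) zero_le_power2)
      qed auto
      then show "integrable M (\<lambda>x. (g x)\<^sup>2 * ln ((g x)\<^sup>2))"
        by (intro integrable_bounded) (auto simp: g_def)
      fix x assume "x \<in> space M"
      then have x: "x \<in> G" by (simp add: space_M)
      have "\<bar>t * F x\<bar> ^ 3 \<le> (t * B) ^ 3" using B[OF x] t(1) by (intro power_mono) (auto simp: abs_mult)
      then show "2 * t * F x + 3 * t\<^sup>2 * (F x)\<^sup>2 - 6 * (t * B) ^ 3 \<le> (g x)\<^sup>2 * ln ((g x)\<^sup>2)"
        using entropy_integrand_lower[OF tF[OF x]] by (simp add: g_def power_mult_distrib)
    qed (use int_F int_F2 in auto)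
    finally have low: "3 * t\<^sup>2 * V - 6 * (t * B) ^ 3 \<le> (\<integral>x. (g x)\<^sup>2 * ln ((g x)\<^sup>2) \<partial>M)" .
    have "(1 + t\<^sup>2 * V) * ln (1 + t\<^sup>2 * V) \<le> (1 + t\<^sup>2 * V) * (t\<^sup>2 * V)"
      using V0 by (intro mult_left_mono ln_add_one_self_le_self) auto
    then have "t\<^sup>2 * (2 * V) \<le> t\<^sup>2 * (2 * \<sigma>\<^sup>2 * (\<integral>x. w x \<partial>M) + 6 * t * B ^ 3 + t\<^sup>2 * V\<^sup>2)"
      using up low unfolding Ent_def g2 by (simp add: power2_eq_square power3_eq_cube algebra_simps)
    then show ?thesis using t(1) by (simp only: mult_le_cancel_left_pos zero_less_power)
  qed
  have "((\<lambda>t. 2 * \<sigma>\<^sup>2 * (\<integral>x. w x \<partial>M) + 6 * t * B ^ 3 + t\<^sup>2 * V\<^sup>2) \<longlongrightarrow>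
      2 * \<sigma>\<^sup>2 * (\<integral>x. w x \<partial>M) + 6 * 0 * B ^ 3 + 0\<^sup>2 * V\<^sup>2) (at_right 0)"
    by (intro tendsto_intros)
  moreover have "\<forall>\<^sub>F t in at_right 0. 2 * V \<le> 2 * \<sigma>\<^sup>2 * (\<integral>x. w x \<partial>M) + 6 * t * B ^ 3 + t\<^sup>2 * V\<^sup>2"
  proof (rule eventually_at_rightI[of 0 "1 / (2 * (B + 1))"])
    fix t assume t: "t \<in> {0<..<1 / (2 * (B + 1))}"
    then have "t * (2 * (B + 1)) < 1" using B0 by (simp add: field_simps)
    then have "t * B \<le> 1 / 2" using t by (simp add: algebra_simps)
    then show "2 * V \<le> 2 * \<sigma>\<^sup>2 * (\<integral>x. w x \<partial>M) + 6 * t * B ^ 3 + t\<^sup>2 * V\<^sup>2" using key t by auto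
  qed (use B0 in auto)
  ultimately have "2 * V \<le> 2 * \<sigma>\<^sup>2 * (\<integral>x. w x \<partial>M) + 6 * 0 * B ^ 3 + 0\<^sup>2 * V\<^sup>2"
    by (intro tendsto_lowerbound) auto
  then show ?thesis by (simp add: V_def)
qed

end

subsection \<open>Moment growth\<close>

text \<open>The outer function needs a derivative only along the range of \<open>u\<close>, which
  admits real powers of positive functions.\<close>

lemma C1_on_compose:
  assumes u: "C1_on n G u D"
    and \<phi>: "\<And>x. x \<in> G \<Longrightarrow> (\<phi> has_real_derivative \<phi>' (u x)) (at (u x))"
    and \<phi>': "continuous_on (u ` G) \<phi>'"
  shows "C1_on n G (\<lambda>x. \<phi> (u x)) (\<lambda>i x. \<phi>' (u x) * D i x)"
  unfolding C1_on_def
proof (intro conjI allI impI ballI)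
  have "continuous_on (u ` G) \<phi>"
    by (intro continuous_at_imp_continuous_on ballI) (use \<phi> DERIV_isCont in blast)
  then show "continuous_on G (\<lambda>x. \<phi> (u x))"
    by (rule continuous_on_compose2[OF _ C1_onD(1)[OF u]]) auto
  fix i assume i: "i < n"
  have "continuous_on G (\<lambda>x. \<phi>' (u x))"
    by (rule continuous_on_compose2[OF \<phi>' C1_onD(1)[OF u]]) auto
  then show "continuous_on G (\<lambda>x. \<phi>' (u x) * D i x)" by (intro continuous_intros C1_onD(2)[OF u i])
  fix x assume x: "x \<in> G"
  have "(\<phi> has_real_derivative \<phi>' (u x)) (at (u (x(i := x i))))" using \<phi>[OF x] by simp
  from DERIV_chain2[OF this C1_onD(3)[OF u i x]]
  show "has_partial i (\<lambda>x. \<phi> (u x)) x (\<phi>' (u x) * D i x)" .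
qed

lemma exp_quadratic_bound:
  fixes x :: real
  assumes "\<bar>x\<bar> \<le> 1"
  shows "\<bar>exp x - 1 - x\<bar> \<le> x\<^sup>2"
proof -
  have "exp x \<le> 1 + x + x\<^sup>2"
  proof (cases "x \<ge> 0")
    case True
    then show ?thesis using exp_bound[of x] assms by simp
  next
    case False
    have "1 - x \<le> exp (- x)" using exp_ge_add_one_self[of "- x"] by simp
    then have "exp x * (1 - x) \<le> 1"
      using mult_left_mono[of "1 - x" "exp (- x)" "exp x"] by (simp add: exp_minus)
    also have "1 \<le> (1 + x + x\<^sup>2) * (1 - x)"
    proof -
      have "(1 + x + x\<^sup>2) * (1 - x) = 1 + (- x) ^ 3" by (simp add: power2_eq_square power3_eq_cube algebra_simps)
      then show ?thesis using False zero_le_power[of "- x" 3] by linarith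
    qed
    finally show ?thesis using False by (simp only: mult_le_cancel_right)
  qed
  then show ?thesis using exp_ge_add_one_self[of x] by linarith
qed

lemma L2_set_sum_le: "L2_set (\<lambda>i. \<Sum>a\<in>A. f a i) I \<le> (\<Sum>a\<in>A. L2_set (f a) I)"
proof (induction A rule: infinite_finite_induct)
  case (insert a A)
  have "L2_set (\<lambda>i. \<Sum>a\<in>insert a A. f a i) I = L2_set (\<lambda>i. f a i + (\<Sum>a\<in>A. f a i)) I"
    using insert by simp
  also have "\<dots> \<le> L2_set (f a) I + L2_set (\<lambda>i. \<Sum>a\<in>A. f a i) I" by (rule L2_set_triangle_ineq)
  finally show ?case using insert by simp
qed (auto simp: L2_set_def)

lemma L2_set_scale: "L2_set (\<lambda>i. c * f i) I = \<bar>c\<bar> * L2_set f I"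
  by (simp add: L2_set_def power_mult_distrib real_sqrt_mult flip: sum_distrib_left)

section \<open>Moments of a bounded positive function as functions of the exponent\<close>

context log_sobolev_space
begin

text \<open>Differentiation under the integral with an explicit remainder: since |ln u| \<le>
  \<Lambda> on \<open>G\<close>, the quadratic bound for the exponential makes the difference
  quotient accurate up to a multiple of |h|.\<close>

lemma integral_powr_deriv:
  assumes [measurable]: "u \<in> borel_measurable M" and c: "c > 0"
    and bnd: "\<And>x. x \<in> G \<Longrightarrow> c \<le> u x" "\<And>x. x \<in> G \<Longrightarrow> u x \<le> B"
  shows "((\<lambda>s. \<integral>x. u x powr s \<partial>M) has_real_derivative (\<integral>x. u x powr s * ln (u x) \<partial>M)) (at s)"
    and "integrable M (\<lambda>x. u x powr s)" and "integrable M (\<lambda>x. u x powr s * ln (u x))"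
proof -
  define \<Lambda> where "\<Lambda> = \<bar>ln c\<bar> + \<bar>ln B\<bar>"
  have \<Lambda>: "\<bar>ln (u x)\<bar> \<le> \<Lambda>" if "x \<in> G" for x
  proof -
    have "ln c \<le> ln (u x)" "ln (u x) \<le> ln B" using bnd[OF that] c by auto
    then show ?thesis unfolding \<Lambda>_def by linarith
  qed
  have pw: "u x powr s = exp (s * ln (u x))" "u x > 0" if "x \<in> G" for x s
    using bnd[OF that] c by (auto simp: powr_def)
  have K: "\<bar>u x powr s\<bar> \<le> exp (\<bar>s\<bar> * \<Lambda>)" if "x \<in> G" for x s
  proof -
    have "s * ln (u x) \<le> \<bar>s\<bar> * \<bar>ln (u x)\<bar>" by (metis abs_ge_self abs_mult)
    also have "\<dots> \<le> \<bar>s\<bar> * \<Lambda>" using \<Lambda>[OF that] by (intro mult_left_mono) auto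
    finally show ?thesis using pw[OF that] by simp
  qed
  show int1: "integrable M (\<lambda>x. u x powr s)" for s
    by (rule integrable_bounded[OF _ K]) auto
  show int2: "integrable M (\<lambda>x. u x powr s * ln (u x))"
  proof (rule integrable_bounded)
    show "\<bar>u x powr s * ln (u x)\<bar> \<le> exp (\<bar>s\<bar> * \<Lambda>) * \<Lambda>" if "x \<in> G" for x
      unfolding abs_mult using K[OF that] \<Lambda>[OF that] by (intro mult_mono) auto
  qed auto
  define J where "J = (\<integral>x. u x powr s * ln (u x) \<partial>M)"
  have est: "\<bar>((\<integral>x. u x powr (s + h) \<partial>M) - (\<integral>x. u x powr s \<partial>M)) / h - J\<bar> \<le> exp (\<bar>s\<bar> * \<Lambda>) * \<Lambda>\<^sup>2 * \<bar>h\<bar>"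
    if h: "h \<noteq> 0" "\<bar>h\<bar> * (\<Lambda> + 1) \<le> 1" for h
  proof -
    have "(\<integral>x. u x powr (s + h) \<partial>M) - (\<integral>x. u x powr s \<partial>M) - h * J =
        (\<integral>x. u x powr (s + h) - u x powr s - h * (u x powr s * ln (u x)) \<partial>M)"
      unfolding J_def using int1 int2 by simp
    then have "\<bar>(\<integral>x. u x powr (s + h) \<partial>M) - (\<integral>x. u x powr s \<partial>M) - h * J\<bar> \<le> (\<integral>x. \<bar>u x powr (s + h) - u x powr s - h * (u x powr s * ln (u x))\<bar> \<partial>M)"
      by (simp only: integral_abs_bound)
    also have "\<dots> \<le> (\<integral>x. exp (\<bar>s\<bar> * \<Lambda>) * (h\<^sup>2 * \<Lambda>\<^sup>2) \<partial>M)"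
    proof (rule integral_mono)
      fix x assume "x \<in> space M"
      then have x: "x \<in> G" by (simp add: space_M)
      have "u x powr (s + h) - u x powr s - h * (u x powr s * ln (u x)) = u x powr s * (exp (h * ln (u x)) - 1 - h * ln (u x))"
        using pw[OF x] by (simp add: exp_add algebra_simps)
      then have "\<bar>u x powr (s + h) - u x powr s - h * (u x powr s * ln (u x))\<bar> =
          u x powr s * \<bar>exp (h * ln (u x)) - 1 - h * ln (u x)\<bar>" by (simp add: abs_mult)
      also have "\<dots> \<le> exp (\<bar>s\<bar> * \<Lambda>) * (h\<^sup>2 * \<Lambda>\<^sup>2)"
      proof (rule mult_mono)
        have "\<bar>h * ln (u x)\<bar> \<le> \<bar>h\<bar> * (\<Lambda> + 1)" unfolding abs_mult using \<Lambda>[OF x] by (intro mult_left_mono) auto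
        then have "\<bar>h * ln (u x)\<bar> \<le> 1" using h by linarith
        then have "\<bar>exp (h * ln (u x)) - 1 - h * ln (u x)\<bar> \<le> (h * ln (u x))\<^sup>2" by (rule exp_quadratic_bound)
        also have "\<dots> \<le> h\<^sup>2 * \<Lambda>\<^sup>2"
          unfolding power_mult_distrib using power_mono[OF \<Lambda>[OF x], of 2] by (intro mult_left_mono) auto
        finally show "\<bar>exp (h * ln (u x)) - 1 - h * ln (u x)\<bar> \<le> h\<^sup>2 * \<Lambda>\<^sup>2" .
      qed (use K[OF x, of s] in auto)
      finally show "\<bar>u x powr (s + h) - u x powr s - h * (u x powr s * ln (u x))\<bar> \<le> exp (\<bar>s\<bar> * \<Lambda>) * (h\<^sup>2 * \<Lambda>\<^sup>2)" by simp
    qed (use int1 int2 in auto)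
    also have "\<dots> = exp (\<bar>s\<bar> * \<Lambda>) * \<Lambda>\<^sup>2 * \<bar>h\<bar> * \<bar>h\<bar>" by (simp add: prob_space power2_eq_square)
    finally have *: "\<bar>(\<integral>x. u x powr (s + h) \<partial>M) - (\<integral>x. u x powr s \<partial>M) - h * J\<bar> \<le> exp (\<bar>s\<bar> * \<Lambda>) * \<Lambda>\<^sup>2 * \<bar>h\<bar> * \<bar>h\<bar>" .
    have "((\<integral>x. u x powr (s + h) \<partial>M) - (\<integral>x. u x powr s \<partial>M)) / h - J =
        ((\<integral>x. u x powr (s + h) \<partial>M) - (\<integral>x. u x powr s \<partial>M) - h * J) / h" using h by (simp add: field_simps)
    then show ?thesis using * h(1) by (simp add: abs_divide divide_le_eq)
  qed
  have "(\<lambda>h. ((\<integral>x. u x powr (s + h) \<partial>M) - (\<integral>x. u x powr s \<partial>M)) / h - J) \<midarrow>0\<rightarrow> 0"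
  proof (rule Lim_null_comparison)
    have "\<Lambda> \<ge> 0" by (simp add: \<Lambda>_def)
    have "\<forall>\<^sub>F h in at 0. dist h 0 < 1 / (\<Lambda> + 1)" using \<open>\<Lambda> \<ge> 0\<close>
      by (auto simp: eventually_at intro!: exI[of _ "1 / (\<Lambda> + 1)"])
    moreover have "\<forall>\<^sub>F h in at (0::real). h \<noteq> 0" by (simp add: eventually_at_filter)
    ultimately show "\<forall>\<^sub>F h in at 0. norm (((\<integral>x. u x powr (s + h) \<partial>M) - (\<integral>x. u x powr s \<partial>M)) / h - J) \<le> exp (\<bar>s\<bar> * \<Lambda>) * \<Lambda>\<^sup>2 * \<bar>h\<bar>"
      by eventually_elim (use est \<open>\<Lambda> \<ge> 0\<close> in \<open>auto simp: field_simps\<close>)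
    show "(\<lambda>h. exp (\<bar>s\<bar> * \<Lambda>) * \<Lambda>\<^sup>2 * \<bar>h\<bar>) \<midarrow>0\<rightarrow> 0" by (auto intro!: tendsto_eq_intros)
  qed
  then show "((\<lambda>s. \<integral>x. u x powr s \<partial>M) has_real_derivative (\<integral>x. u x powr s * ln (u x) \<partial>M)) (at s)"
    unfolding DERIV_def J_def[symmetric] by (rule LIM_zero_cancel)
qed

text \<open>The Aida-Stroock argument. With I(s) the s-th moment,
  \<open>s * I' s - I s * ln (I s)\<close> is the entropy of u^s, and the derivative of the squared
  s-norm I(s)^(2/s) is this entropy times (2 / s^2) I(s)^(2/s - 1). The logarithmic Sobolev
  inequality for u^(s/2) and Hoelder bound it by \<sigma>^2 W^2 for every s between 2 and p; the
  mean value theorem on [2, p] concludes.\<close>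

lemma moment_growth_bounded:
  assumes u: "C1_on n G u D" and c: "c > 0"
    and bnd: "\<And>x. x \<in> G \<Longrightarrow> c \<le> u x" "\<And>x. x \<in> G \<Longrightarrow> u x \<le> B"
    and w0: "\<And>x. x \<in> G \<Longrightarrow> 0 \<le> w x" and Dw: "\<And>x. x \<in> G \<Longrightarrow> (\<Sum>i<n. (D i x)\<^sup>2) \<le> (w x)\<^sup>2"
    and p: "p > 2" and W: "W > 0"
    and w_int: "integrable M (\<lambda>x. w x powr p)" and w_le: "(\<integral>x. w x powr p \<partial>M) \<le> W powr p"
  shows "(\<integral>x. u x powr p \<partial>M) powr (2 / p) \<le> (\<integral>x. (u x)\<^sup>2 \<partial>M) + \<sigma>\<^sup>2 * (p - 2) * W\<^sup>2"
proof -
  have um: "u \<in> borel_measurable M" using continuous_on_measurable C1_onD(1)[OF u] .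
  note powr_facts = integral_powr_deriv[OF um c bnd]
  define I where "I s = (\<integral>x. u x powr s \<partial>M)" for s
  define I' where "I' s = (\<integral>x. u x powr s * ln (u x) \<partial>M)" for s
  have u_pos: "u x > 0" if "x \<in> G" for x using bnd(1)[OF that] c by linarith
  have dI: "(I has_real_derivative I' s) (at s)" for s
    using powr_facts(1) unfolding I_def[abs_def] I'_def by simp
  have I_pos: "I s > 0" if "s > 0" for s
  proof -
    have "c powr s \<le> I s" unfolding I_def
    proof (rule integral_ge_const[OF powr_facts(2)])
      show "AE x in M. c powr s \<le> u x powr s"
        by (rule AE_I2) (use bnd c that in \<open>auto simp: space_M intro!: powr_mono2\<close>)
    qed
    then show ?thesis using c by (smt (verit) powr_gt_zero)
  qed
  define \<psi> where "\<psi> s = 2 / s * ln (I s)" for s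
  define \<psi>' where "\<psi>' s = (- (2 / s\<^sup>2)) * ln (I s) + (I' s / I s) * (2 / s)" for s
  have d\<psi>: "((\<lambda>s. exp (\<psi> s)) has_real_derivative exp (\<psi> s) * \<psi>' s) (at s)" if "s > 0" for s
  proof -
    have "((\<lambda>s. ln (I s)) has_real_derivative I' s / I s) (at s)"
      using DERIV_chain2[OF DERIV_ln_divide[OF I_pos[OF that]] dI] by simp
    moreover have "((\<lambda>s. 2 / s) has_real_derivative - (2 / s\<^sup>2)) (at s)"
      using that by (auto intro!: derivative_eq_intros simp: power2_eq_square)
    ultimately have "(\<psi> has_real_derivative \<psi>' s) (at s)" unfolding \<psi>_def[abs_def] \<psi>'_def
      by (intro DERIV_mult)
    then show ?thesis by (rule DERIV_chain2[OF DERIV_exp])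
  qed
  have slope: "exp (\<psi> s) * \<psi>' s \<le> \<sigma>\<^sup>2 * W\<^sup>2" if s: "2 < s" "s < p" for s
  proof -
    have Is: "I s > 0" using I_pos s by auto
    define A where "A = I s powr (1 / s)"
    have A: "A > 0" "A powr s = I s" "exp (\<psi> s) = A powr 2"
      using Is s by (auto simp: A_def powr_powr \<psi>_def powr_def)
    \<comment> \<open>Hoelder in pointwise form, because \<open>lsi_C1\<close> wants an integrable
      majorant. Young's inequality for the normalised powers bounds u^(s-2) w^2, and a second use
      passes from w^s to w^p, whose integral is controlled. The weights of each convex combination
      add up to 1, so the integral is at most A^(s-2) W^2.\<close>
    define v where "v x = A powr (s - 2) * W\<^sup>2 * ((s - 2) / s * (u x powr s / I s) + 2 / s * ((1 - s / p) + s / p * (w x powr p / W powr p)))" for x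
    have v_int: "integrable M v" unfolding v_def[abs_def] using powr_facts(2) w_int by auto
    have "(\<integral>x. v x \<partial>M) = A powr (s - 2) * W\<^sup>2 * ((s - 2) / s * (I s / I s) + 2 / s * ((1 - s / p) + s / p * ((\<integral>x. w x powr p \<partial>M) / W powr p)))"
      unfolding v_def I_def using powr_facts(2) w_int by (simp add: prob_space)
    also have "\<dots> \<le> A powr (s - 2) * W\<^sup>2 * ((s - 2) / s * 1 + 2 / s * ((1 - s / p) + s / p * 1))"
      using Is W w_le s p by (intro mult_left_mono add_mono order_refl) auto
    also have "\<dots> = A powr (s - 2) * W\<^sup>2" using s by (simp add: field_simps)
    finally have v_le: "(\<integral>x. v x \<partial>M) \<le> A powr (s - 2) * W\<^sup>2" .
    have young: "u x powr (s - 2) * (w x)\<^sup>2 \<le> v x" if x: "x \<in> G" for x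
    proof (cases "w x = 0")
      case True
      have "0 \<le> v x" unfolding v_def using s p Is W by (intro mult_nonneg_nonneg add_nonneg_nonneg) auto
      then show ?thesis using True by simp
    next
      case False
      then have wx: "w x > 0" using w0[OF x] by simp
      define X where "X = u x powr s / I s"
      define Y where "Y = w x powr s / W powr s"
      define Z where "Z = w x powr p / W powr p"
      have XYZ: "X > 0" "Y > 0" "Z > 0" using u_pos[OF x] Is wx W by (auto simp: X_def Y_def Z_def)
      have "X powr ((s - 2) / s) * Y powr (2 / s) \<le> (s - 2) / s * X + 2 / s * Y"
        by (rule Youngs_inequality_0) (use s XYZ in \<open>auto simp: field_simps\<close>)
      moreover have "Y = 1 powr (1 - s / p) * Z powr (s / p)"
        using s p wx W by (simp add: Y_def Z_def powr_divide powr_powr)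
      moreover have "1 powr (1 - s / p) * Z powr (s / p) \<le> (1 - s / p) * 1 + s / p * Z"
        by (rule Youngs_inequality_0) (use s p XYZ in \<open>auto simp: field_simps\<close>)
      ultimately have "Y \<le> (1 - s / p) + s / p * Z" by simp
      then have "2 / s * Y \<le> 2 / s * ((1 - s / p) + s / p * Z)" using s by (intro mult_left_mono) auto
      with \<open>X powr ((s - 2) / s) * Y powr (2 / s) \<le> (s - 2) / s * X + 2 / s * Y\<close>
      have "X powr ((s - 2) / s) * Y powr (2 / s) \<le> (s - 2) / s * X + 2 / s * ((1 - s / p) + s / p * Z)" by linarith
      then have "A powr (s - 2) * W\<^sup>2 * (X powr ((s - 2) / s) * Y powr (2 / s)) \<le> v x"
        unfolding v_def X_def[symmetric] Z_def[symmetric] by (intro mult_left_mono) auto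
      moreover have "X powr ((s - 2) / s) = u x powr (s - 2) / A powr (s - 2)"
        using s u_pos[OF x] Is A(1) by (simp add: X_def A(2)[symmetric] powr_divide powr_powr)
      moreover have "Y powr (2 / s) = (w x)\<^sup>2 / W\<^sup>2"
        using s wx W by (simp add: Y_def powr_divide powr_powr)
      ultimately show ?thesis using A W by simp
    qed
    have C1: "C1_on n G (\<lambda>x. u x powr (s / 2)) (\<lambda>i x. (s / 2 * u x powr (s / 2 - 1)) * D i x)"
    proof (rule C1_on_compose[OF u])
      show "((\<lambda>t. t powr (s / 2)) has_real_derivative s / 2 * u x powr (s / 2 - 1)) (at (u x))" if "x \<in> G" for x
        using has_real_derivative_powr[OF u_pos[OF that], of "s / 2"] .
      show "continuous_on (u ` G) (\<lambda>t. s / 2 * t powr (s / 2 - 1))"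
        by (intro continuous_intros) (auto dest: u_pos)
    qed
    have sq: "(u x powr (s / 2))\<^sup>2 = u x powr s" for x by (simp add: power2_eq_square flip: powr_add)
    have "Ent M (\<lambda>x. (u x powr (s / 2))\<^sup>2) \<le> 2 * \<sigma>\<^sup>2 * (\<integral>x. s\<^sup>2 / 4 * v x \<partial>M)"
    proof (rule lsi_C1[OF C1, of "c powr (s / 2)" "B powr (s / 2)"])
      show "integrable M (\<lambda>x. s\<^sup>2 / 4 * v x)" using v_int by auto
      fix x assume x: "x \<in> G"
      show "c powr (s / 2) \<le> u x powr (s / 2)" "u x powr (s / 2) \<le> B powr (s / 2)"
        using bnd[OF x] u_pos[OF x] c s by (auto intro!: powr_mono2)
      have "(\<Sum>i<n. (s / 2 * u x powr (s / 2 - 1) * D i x)\<^sup>2) = s\<^sup>2 / 4 * ((u x powr (s / 2 - 1))\<^sup>2 * (\<Sum>i<n. (D i x)\<^sup>2))"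
        by (simp add: power_mult_distrib power_divide sum_distrib_left mult.assoc)
      also have "(u x powr (s / 2 - 1))\<^sup>2 = u x powr (s - 2)" by (simp add: power2_eq_square flip: powr_add)
      also have "s\<^sup>2 / 4 * (u x powr (s - 2) * (\<Sum>i<n. (D i x)\<^sup>2)) \<le> s\<^sup>2 / 4 * (u x powr (s - 2) * (w x)\<^sup>2)"
        using Dw[OF x] by (intro mult_left_mono) auto
      also have "\<dots> \<le> s\<^sup>2 / 4 * v x" using young[OF x] by (intro mult_left_mono) auto
      finally show "(\<Sum>i<n. (s / 2 * u x powr (s / 2 - 1) * D i x)\<^sup>2) \<le> s\<^sup>2 / 4 * v x" .
    qed (use c in auto)
    also have "\<dots> = 2 * \<sigma>\<^sup>2 * (s\<^sup>2 / 4 * (\<integral>x. v x \<partial>M))" by simp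
    also have "\<dots> \<le> 2 * \<sigma>\<^sup>2 * (s\<^sup>2 / 4 * (A powr (s - 2) * W\<^sup>2))" using v_le by (intro mult_left_mono) auto
    finally have Ent1: "Ent M (\<lambda>x. (u x powr (s / 2))\<^sup>2) \<le> \<sigma>\<^sup>2 * (s\<^sup>2 / 2) * (A powr (s - 2) * W\<^sup>2)" by (simp add: mult_ac)
    have "Ent M (\<lambda>x. (u x powr (s / 2))\<^sup>2) = s * I' s - I s * ln (I s)"
    proof -
      have "(\<integral>x. u x powr s * ln (u x powr s) \<partial>M) = (\<integral>x. s * (u x powr s * ln (u x)) \<partial>M)"
        by (rule Bochner_Integration.integral_cong) (auto simp: ln_powr)
      then show ?thesis unfolding Ent_def sq by (simp add: I_def I'_def)
    qed
    with Ent1 have Ent2: "s * I' s - I s * ln (I s) \<le> \<sigma>\<^sup>2 * (s\<^sup>2 / 2) * (A powr (s - 2) * W\<^sup>2)" by simp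
    have "\<psi>' s = (2 / s\<^sup>2 / I s) * (s * I' s - I s * ln (I s))"
      using s Is by (simp add: \<psi>'_def field_simps power2_eq_square)
    also have "\<dots> \<le> (2 / s\<^sup>2 / I s) * (\<sigma>\<^sup>2 * (s\<^sup>2 / 2) * (A powr (s - 2) * W\<^sup>2))"
      using Ent2 Is by (intro mult_left_mono) auto
    also have "\<dots> = \<sigma>\<^sup>2 * W\<^sup>2 * (A powr (s - 2) / I s)" using s by simp
    finally have "exp (\<psi> s) * \<psi>' s \<le> A powr 2 * (\<sigma>\<^sup>2 * W\<^sup>2 * (A powr (s - 2) / I s))"
      unfolding A(3) by (intro mult_left_mono) auto
    also have "\<dots> = \<sigma>\<^sup>2 * W\<^sup>2 * (A powr 2 * A powr (s - 2) / I s)" by simp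
    also have "A powr 2 * A powr (s - 2) = I s" using A(2) by (simp flip: powr_add)
    finally show ?thesis using Is by simp
  qed
  obtain \<xi> where \<xi>: "2 < \<xi>" "\<xi> < p" "exp (\<psi> p) - exp (\<psi> 2) = (p - 2) * (exp (\<psi> \<xi>) * \<psi>' \<xi>)"
    using MVT2[OF p, of "\<lambda>s. exp (\<psi> s)" "\<lambda>s. exp (\<psi> s) * \<psi>' s"] d\<psi> by auto
  have "(p - 2) * (exp (\<psi> \<xi>) * \<psi>' \<xi>) \<le> (p - 2) * (\<sigma>\<^sup>2 * W\<^sup>2)" using slope[OF \<xi>(1,2)] p by (intro mult_left_mono) auto
  moreover have "exp (\<psi> p) = I p powr (2 / p)" using I_pos[of p] p by (simp add: \<psi>_def powr_def)
  moreover have "exp (\<psi> 2) = (\<integral>x. (u x)\<^sup>2 \<partial>M)"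
  proof -
    have "exp (\<psi> 2) = I 2" using I_pos[of 2] by (simp add: \<psi>_def)
    also have "\<dots> = (\<integral>x. (u x)\<^sup>2 \<partial>M)" unfolding I_def
      by (rule Bochner_Integration.integral_cong) (auto simp: space_M dest: u_pos)
    finally show ?thesis .
  qed
  ultimately show ?thesis using \<xi>(3) by (simp add: I_def algebra_simps)
qed

end

section \<open>Soft maxima, and moment growth for maxima of finite families\<close>

lemma two_le_exp_plus_exp: "(2::real) \<le> exp t + exp (- t)"
  using exp_ge_add_one_self[of t] exp_ge_add_one_self[of "- t"] by linarith

lemma exp_abs_le: "exp \<bar>t\<bar> \<le> exp t + exp (- t :: real)"
  by (cases "t \<ge> 0") auto

text \<open>Log-sum-exp: a differentiable substitute for \<open>max |F a|\<close> whose gradient is a combination of the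
  gradients of the \<open>F a\<close> with coefficients of total mass at most 1, hence without dimensional loss.\<close>
lemma soft_max:
  fixes F :: "'a \<Rightarrow> (nat \<Rightarrow> real) \<Rightarrow> real" and \<beta> :: real
  assumes fin: "finite A" "A \<noteq> {}" and F: "\<And>a. a \<in> A \<Longrightarrow> C1_on n G (F a) (D a)"
    and Dw: "\<And>a x. a \<in> A \<Longrightarrow> x \<in> G \<Longrightarrow> L2_set (\<lambda>i. D a i x) {..<n} \<le> w x"
    and \<beta>: "\<beta> > 0"
  obtains v E where "C1_on n G v E" "\<And>x. x \<in> G \<Longrightarrow> L2_set (\<lambda>i. E i x) {..<n} \<le> w x"
    "\<And>x. Max ((\<lambda>a. \<bar>F a x\<bar>) ` A) \<le> v x"
    "\<And>x. v x \<le> Max ((\<lambda>a. \<bar>F a x\<bar>) ` A) + ln (2 * real (card A)) / \<beta>"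
    "\<And>x. ln 2 / \<beta> \<le> v x"
proof -
  define U where "U x = Max ((\<lambda>a. \<bar>F a x\<bar>) ` A)" for x
  \<comment> \<open>Both signs occur, so that the logarithm dominates the absolute values; moreover
    S \<ge> 2 keeps \<open>v\<close> away from 0. The price is the factor 2 in
    \<open>ln (2 * real (card A))\<close>.\<close>
  define S where "S x = (\<Sum>a\<in>A. exp (\<beta> * F a x) + exp (- (\<beta> * F a x)))" for x
  define v where "v x = 1 / \<beta> * ln (S x)" for x
  define E where "E i x = (1 / (\<beta> * S x)) * (\<Sum>a\<in>A. (exp (\<beta> * F a x) - exp (- (\<beta> * F a x))) * (\<beta> * D a i x))" for i x
  have FU: "\<bar>F a x\<bar> \<le> U x" if "a \<in> A" for a x unfolding U_def using fin that by (intro Max_ge) auto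
  have S2: "2 \<le> S x" for x
  proof -
    obtain a where a: "a \<in> A" using fin by auto
    have "2 \<le> exp (\<beta> * F a x) + exp (- (\<beta> * F a x))" by (rule two_le_exp_plus_exp)
    also have "\<dots> \<le> S x" unfolding S_def using fin a by (intro member_le_sum) (auto intro: add_nonneg_nonneg)
    finally show ?thesis .
  qed
  then have S0: "S x > 0" for x by (smt (verit))
  have C1: "C1_on n G v E"
    unfolding C1_on_def
  proof (intro conjI allI impI ballI)
    have contS: "continuous_on G S" unfolding S_def[abs_def] by (intro continuous_intros C1_onD(1)[OF F])
    show "continuous_on G v" unfolding v_def[abs_def] using S0 contS by (intro continuous_intros) (auto simp: less_imp_neq[symmetric])
    fix i assume i: "i < n"
    show "continuous_on G (E i)" unfolding E_def[abs_def] using S0 contS \<beta>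
      by (intro continuous_intros C1_onD(1)[OF F] C1_onD(2)[OF F i]) (auto simp: less_imp_neq[symmetric])
    fix x assume x: "x \<in> G"
    have dF: "has_partial i (\<lambda>x. exp (\<beta> * F a x) + exp (- (\<beta> * F a x))) x
        ((exp (\<beta> * F a x) - exp (- (\<beta> * F a x))) * (\<beta> * D a i x))" if a: "a \<in> A" for a
    proof -
      have 1: "has_partial i (\<lambda>x. \<beta> * F a x) x (\<beta> * D a i x)" by (intro DERIV_cmult C1_onD(3)[OF F[OF a] i x])
      from DERIV_add[OF DERIV_chain2[OF DERIV_exp 1] DERIV_chain2[OF DERIV_exp DERIV_minus[OF 1]]]
      show ?thesis by (simp add: algebra_simps)
    qed
    have "has_partial i S x (\<Sum>a\<in>A. (exp (\<beta> * F a x) - exp (- (\<beta> * F a x))) * (\<beta> * D a i x))"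
      unfolding S_def by (rule has_partial_sum[OF dF])
    from DERIV_cmult[OF DERIV_chain2[OF DERIV_ln_divide this], of "1 / \<beta>"] S0[of x]
    show "has_partial i v x (E i x)" unfolding v_def E_def by (simp add: mult.assoc)
  qed
  have grad: "L2_set (\<lambda>i. E i x) {..<n} \<le> w x" if x: "x \<in> G" for x
  proof -
    define q where "q a = (exp (\<beta> * F a x) - exp (- (\<beta> * F a x))) / S x" for a
    have "E i x = (\<Sum>a\<in>A. q a * D a i x)" for i
      using \<beta> by (simp add: E_def q_def sum_distrib_left)
    then have "L2_set (\<lambda>i. E i x) {..<n} \<le> (\<Sum>a\<in>A. L2_set (\<lambda>i. q a * D a i x) {..<n})" by (simp add: L2_set_sum_le)
    also have "\<dots> = (\<Sum>a\<in>A. \<bar>q a\<bar> * L2_set (\<lambda>i. D a i x) {..<n})" by (simp add: L2_set_scale)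
    also have "\<dots> \<le> (\<Sum>a\<in>A. \<bar>q a\<bar> * w x)" using Dw[OF _ x] by (intro sum_mono mult_left_mono) auto
    also have "\<dots> = (\<Sum>a\<in>A. \<bar>q a\<bar>) * w x" by (simp add: sum_distrib_right)
    also have "\<dots> \<le> 1 * w x"
    proof (rule mult_right_mono)
      have "\<bar>q a\<bar> \<le> (exp (\<beta> * F a x) + exp (- (\<beta> * F a x))) / S x" for a
        using S0[of x] exp_gt_zero[of "\<beta> * F a x"] exp_gt_zero[of "- (\<beta> * F a x)"]
        unfolding q_def abs_divide by (intro frac_le) (linarith | simp)+
      then have "(\<Sum>a\<in>A. \<bar>q a\<bar>) \<le> (\<Sum>a\<in>A. (exp (\<beta> * F a x) + exp (- (\<beta> * F a x))) / S x)" by (intro sum_mono)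
      also have "\<dots> = 1" using S0[of x] by (simp add: S_def flip: sum_divide_distrib)
      finally show "(\<Sum>a\<in>A. \<bar>q a\<bar>) \<le> 1" .
      obtain a where "a \<in> A" using fin by auto
      then show "0 \<le> w x" using Dw[OF _ x] L2_set_nonneg order_trans by blast
    qed
    finally show ?thesis by simp
  qed
  have low: "U x \<le> v x" for x
  proof -
    have "\<bar>F a x\<bar> \<le> v x" if a: "a \<in> A" for a
    proof -
      have "exp (\<beta> * \<bar>F a x\<bar>) \<le> exp (\<beta> * F a x) + exp (- (\<beta> * F a x))"
        using exp_abs_le[of "\<beta> * F a x"] \<beta> by (simp add: abs_mult)
      also have "\<dots> \<le> S x" unfolding S_def using fin a by (intro member_le_sum) (auto intro: add_nonneg_nonneg)
      finally have "\<beta> * \<bar>F a x\<bar> \<le> ln (S x)" using S0[of x] by (simp add: ln_ge_iff)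
      then show ?thesis using \<beta> by (simp add: v_def field_simps)
    qed
    then show ?thesis unfolding U_def using fin by (subst Max_le_iff) auto
  qed
  have up: "v x \<le> U x + ln (2 * real (card A)) / \<beta>" for x
  proof -
    have "S x \<le> (\<Sum>a\<in>A. 2 * exp (\<beta> * U x))"
      unfolding S_def
    proof (rule sum_mono)
      fix a assume a: "a \<in> A"
      have "\<beta> * \<bar>F a x\<bar> \<le> \<beta> * U x" using FU[OF a] \<beta> by (intro mult_left_mono) auto
      then have "\<bar>\<beta> * F a x\<bar> \<le> \<beta> * U x" using \<beta> by (simp add: abs_mult)
      then have "exp (\<beta> * F a x) \<le> exp (\<beta> * U x)" "exp (- (\<beta> * F a x)) \<le> exp (\<beta> * U x)"
        by (subst exp_le_cancel_iff, linarith)+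
      then show "exp (\<beta> * F a x) + exp (- (\<beta> * F a x)) \<le> 2 * exp (\<beta> * U x)" by linarith
    qed
    also have "\<dots> = (2 * real (card A)) * exp (\<beta> * U x)" by simp
    finally have "ln (S x) \<le> ln ((2 * real (card A)) * exp (\<beta> * U x))" using S0[of x] by (subst ln_le_cancel_iff) auto
    also have "\<dots> = ln (2 * real (card A)) + \<beta> * U x" using fin by (subst ln_mult_pos) (auto simp: card_gt_0_iff)
    finally show ?thesis using \<beta> by (simp add: v_def field_simps)
  qed
  have pos: "ln 2 / \<beta> \<le> v x" for x
  proof -
    have "ln 2 \<le> ln (S x)" using S2[of x] S0[of x] by (subst ln_le_cancel_iff) auto
    then show ?thesis using \<beta> by (simp add: v_def divide_right_mono)
  qed
  show ?thesis using that[OF C1 grad low[unfolded U_def] up[unfolded U_def] pos] .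
qed

context log_sobolev_space
begin

text \<open>Reduction to a bounded positive C1 function: the maximum is replaced by its soft maximum
  with parameter m + 1, which is then truncated at level m + 1. Neither operation pushes the
  gradient above \<open>w\<close>, the error \<kappa> m disappears in the limit, and Fatou's lemma
  transfers the bound.\<close>

lemma moment_growth_family:
  fixes F :: "'a \<Rightarrow> (nat \<Rightarrow> real) \<Rightarrow> real"
  assumes fin: "finite A" "A \<noteq> {}" and F: "\<And>a. a \<in> A \<Longrightarrow> C1_on n G (F a) (D a)"
    and Dw: "\<And>a x. a \<in> A \<Longrightarrow> x \<in> G \<Longrightarrow> L2_set (\<lambda>i. D a i x) {..<n} \<le> w x"
    and p: "p > 2" and W: "W > 0"
    and w_int: "integrable M (\<lambda>x. w x powr p)" and w_le: "(\<integral>x. w x powr p \<partial>M) \<le> W powr p"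
    and U_int: "integrable M (\<lambda>x. (Max ((\<lambda>a. \<bar>F a x\<bar>) ` A))\<^sup>2)"
    and U_le: "(\<integral>x. (Max ((\<lambda>a. \<bar>F a x\<bar>) ` A))\<^sup>2 \<partial>M) \<le> K\<^sup>2" and K: "K > 0"
  shows "(\<integral>\<^sup>+ x. ennreal (Max ((\<lambda>a. \<bar>F a x\<bar>) ` A) powr p) \<partial>M) \<le> ennreal ((K + \<sigma> * sqrt (p - 2) * W) powr p)"
proof -
  define U where "U x = Max ((\<lambda>a. \<bar>F a x\<bar>) ` A)" for x
  note U_int = U_int[folded U_def] and U_le = U_le[folded U_def]
  obtain a0 where a0: "a0 \<in> A" using fin by auto
  have U0: "U x \<ge> 0" for x
    unfolding U_def using fin a0 by (intro order_trans[OF abs_ge_zero Max_ge]) auto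
  have w0: "0 \<le> w x" if "x \<in> G" for x using Dw[OF a0 that] L2_set_nonneg order_trans by blast
  define b where "b = \<sigma> * sqrt (p - 2) * W"
  have b0: "b \<ge> 0" "b\<^sup>2 = \<sigma>\<^sup>2 * (p - 2) * W\<^sup>2"
    using p W \<sigma>_pos by (auto simp: b_def power_mult_distrib)
  define \<kappa> where "\<kappa> m = ln (2 * real (card A)) / real (Suc m)" for m
  have \<kappa>0: "\<kappa> m \<ge> 0" for m
  proof -
    have "card A \<ge> 1" using fin by (simp add: Suc_leI card_gt_0_iff)
    then have "2 * real (card A) \<ge> 1" by linarith
    then show ?thesis unfolding \<kappa>_def by (intro divide_nonneg_nonneg ln_ge_zero) auto
  qed
  have \<kappa>_lim: "\<kappa> \<longlonglongrightarrow> 0"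
    using tendsto_mult_right_zero[OF LIMSEQ_Suc[OF lim_1_over_n], of "ln (2 * real (card A))"] by (simp add: \<kappa>_def[abs_def])
  have U_meas [measurable]: "U \<in> borel_measurable M"
    unfolding U_def using fin
    by (intro borel_measurable_Max borel_measurable_abs continuous_on_measurable C1_onD(1)[OF F])
  have "\<exists>v E. C1_on n G v E \<and> (\<forall>x\<in>G. L2_set (\<lambda>i. E i x) {..<n} \<le> w x) \<and> (\<forall>x. U x \<le> v x) \<and>
      (\<forall>x. v x \<le> U x + \<kappa> m) \<and> (\<forall>x. ln 2 / real (Suc m) \<le> v x)" for m
  proof (rule soft_max[where A = A and F = F and n = n and G = G and D = D and w = w and \<beta> = "real (Suc m)"])
    fix v E
    assume "C1_on n G v E" "\<And>x. x \<in> G \<Longrightarrow> L2_set (\<lambda>i. E i x) {..<n} \<le> w x"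
      "\<And>x. Max ((\<lambda>a. \<bar>F a x\<bar>) ` A) \<le> v x"
      "\<And>x. v x \<le> Max ((\<lambda>a. \<bar>F a x\<bar>) ` A) + ln (2 * real (card A)) / real (Suc m)"
      "\<And>x. ln 2 / real (Suc m) \<le> v x"
    then show ?thesis unfolding U_def \<kappa>_def by blast
  qed (use fin F Dw in auto)
  then obtain v E where v: "\<And>m. C1_on n G (v m) (E m)" "\<And>m x. x \<in> G \<Longrightarrow> L2_set (\<lambda>i. E m i x) {..<n} \<le> w x"
    "\<And>m x. U x \<le> v m x" "\<And>m x. v m x \<le> U x + \<kappa> m" "\<And>m x. ln 2 / real (Suc m) \<le> v m x" by metis
  have v_pos: "v m x > 0" for m x
    by (rule less_le_trans[OF _ v(5)]) simp
  \<comment> \<open>With N = m + 1, the truncation t N / (N + t) is increasing in t > 0, stays below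
    both N and t, and has derivative (N / (N + t))^2 \<le> 1, so gradients do not grow and
    positivity is kept.\<close>
  define u where "u m x = real (Suc m) * v m x / (real (Suc m) + v m x)" for m x
  have u_le: "u m x \<le> v m x" "u m x \<le> real (Suc m)" "0 < u m x" for m x
  proof -
    define N where "N = real (Suc m)"
    have "N > 0" by (simp add: N_def)
    then show "u m x \<le> v m x" "u m x \<le> real (Suc m)" "0 < u m x"
      unfolding u_def N_def[symmetric] using v_pos[of m x]
      by (auto simp: divide_le_eq algebra_simps intro!: divide_pos_pos mult_pos_pos add_pos_pos)
  qed
  have u_meas [measurable]: "u m \<in> borel_measurable M" for m
    unfolding u_def[abs_def] using continuous_on_measurable[OF C1_onD(1)[OF v(1)[of m]]] by measurable
  have U1: "integrable M U"
    using square_integrable_imp_integrable[OF U_meas U_int] .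
  \<comment> \<open>The first moment is needed for the cross term of (U + \<kappa> m)^2; it is
    bounded by \<open>K\<close> through 2 U \<le> U^2 / K + K.\<close>
  have "2 * (\<integral>x. U x \<partial>M) \<le> 2 * K"
  proof -
    have "2 * (\<integral>x. U x \<partial>M) = (\<integral>x. 2 * U x \<partial>M)" by simp
    also have "\<dots> \<le> (\<integral>x. (U x)\<^sup>2 / K + K \<partial>M)"
    proof (rule integral_mono)
      fix x
      have "0 \<le> (U x - K)\<^sup>2" by simp
      then show "2 * U x \<le> (U x)\<^sup>2 / K + K" using K by (simp add: power2_eq_square field_simps)
    qed (use U1 U_int in auto)
    also have "\<dots> = (\<integral>x. (U x)\<^sup>2 \<partial>M) / K + K" using U_int by (simp add: prob_space)
    also have "\<dots> \<le> K\<^sup>2 / K + K" using U_le K by (intro add_right_mono divide_right_mono) auto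
    finally show ?thesis using K by (simp add: power2_eq_square)
  qed
  then have U1_le: "(\<integral>x. U x \<partial>M) \<le> K" by simp
  have main: "(\<integral>\<^sup>+ x. ennreal (u m x powr p) \<partial>M) \<le> ennreal ((K + \<kappa> m + b) powr p)" for m
  proof -
    define N where "N = real (Suc m)"
    have N: "N > 0" by (simp add: N_def)
    have u_C1: "C1_on n G (u m) (\<lambda>i x. (N\<^sup>2 / (N + v m x)\<^sup>2) * E m i x)"
      unfolding u_def N_def[symmetric]
    proof (rule C1_on_compose[OF v(1)])
      show "((\<lambda>t. N * t / (N + t)) has_real_derivative N\<^sup>2 / (N + v m x)\<^sup>2) (at (v m x))" if "x \<in> G" for x
        using v_pos[of m x] N by (auto intro!: derivative_eq_intros simp: power2_eq_square field_simps)
      have "N + v m x \<noteq> 0" for x using v_pos[of m x] N by linarith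
      then show "continuous_on (v m ` G) (\<lambda>t. N\<^sup>2 / (N + t)\<^sup>2)" by (intro continuous_intros) auto
    qed
    \<comment> \<open>The value of the truncation at ln 2 / N, the lower bound of the soft
      maximum.\<close>
    define c where "c = N * (ln 2 / N) / (N + ln 2 / N)"
    have c: "c > 0" unfolding c_def using N by (intro divide_pos_pos mult_pos_pos add_pos_pos) auto
    have cu: "c \<le> u m x" for x
    proof -
      define l where "l = ln 2 / N"
      have l: "0 < l" "l \<le> v m x" using v(5)[of m x] N by (auto simp: N_def l_def)
      have "N * l * (N + v m x) \<le> N * v m x * (N + l)"
      proof -
        have "N * (N * l + l * v m x) \<le> N * (N * v m x + l * v m x)"
          using l N by (intro mult_left_mono add_right_mono) auto
        then show ?thesis by (simp add: algebra_simps)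
      qed
      then have "N * l / (N + l) * (N + v m x) \<le> N * v m x" using l N by (simp add: pos_divide_le_eq)
      then show ?thesis unfolding c_def u_def N_def[symmetric] l_def[symmetric] using N v_pos[of m x]
        by (simp add: pos_le_divide_eq)
    qed
    have "(\<integral>x. u m x powr p \<partial>M) powr (2 / p) \<le> (\<integral>x. (u m x)\<^sup>2 \<partial>M) + \<sigma>\<^sup>2 * (p - 2) * W\<^sup>2"
    proof (rule moment_growth_bounded[OF u_C1 c, of N w])
      fix x assume x: "x \<in> G"
      have q: "0 \<le> N\<^sup>2 / (N + v m x)\<^sup>2" "N\<^sup>2 / (N + v m x)\<^sup>2 \<le> 1"
        using N v_pos[of m x] by (auto intro!: power_mono simp: divide_le_eq)
      have "L2_set (\<lambda>i. (N\<^sup>2 / (N + v m x)\<^sup>2) * E m i x) {..<n} \<le> 1 * w x"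
        unfolding L2_set_scale using q v(2)[OF x, of m] by (intro mult_mono) auto
      then have "(L2_set (\<lambda>i. (N\<^sup>2 / (N + v m x)\<^sup>2) * E m i x) {..<n})\<^sup>2 \<le> (w x)\<^sup>2" by (intro power_mono) auto
      then show "(\<Sum>i<n. (N\<^sup>2 / (N + v m x)\<^sup>2 * E m i x)\<^sup>2) \<le> (w x)\<^sup>2" by (simp add: L2_set_def sum_nonneg)
    qed (use cu u_le(2) w0 p W w_int w_le in \<open>auto simp: N_def\<close>)
    also have "(\<integral>x. (u m x)\<^sup>2 \<partial>M) \<le> (K + \<kappa> m)\<^sup>2"
    proof -
      have "(\<integral>x. (u m x)\<^sup>2 \<partial>M) \<le> (\<integral>x. (U x)\<^sup>2 + 2 * \<kappa> m * U x + (\<kappa> m)\<^sup>2 \<partial>M)"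
      proof (rule integral_mono)
        show "integrable M (\<lambda>x. (u m x)\<^sup>2)"
          by (rule integrable_bounded[of _ "(real (Suc m))\<^sup>2"])
             (use u_le(2)[of m] u_le(3)[of m, THEN less_imp_le] in \<open>auto intro!: power_mono simp del: of_nat_Suc\<close>)
        fix x
        have "(u m x)\<^sup>2 \<le> (U x + \<kappa> m)\<^sup>2" using u_le[of m x] v(4)[of m x] by (intro power_mono) auto
        then show "(u m x)\<^sup>2 \<le> (U x)\<^sup>2 + 2 * \<kappa> m * U x + (\<kappa> m)\<^sup>2" by (simp add: power2_eq_square algebra_simps)
      qed (use U_int U1 in auto)
      also have "\<dots> = (\<integral>x. (U x)\<^sup>2 \<partial>M) + 2 * \<kappa> m * (\<integral>x. U x \<partial>M) + (\<kappa> m)\<^sup>2"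
        using U_int U1 by (simp add: prob_space)
      also have "\<dots> \<le> K\<^sup>2 + 2 * \<kappa> m * K + (\<kappa> m)\<^sup>2"
        using U_le U1_le \<kappa>0[of m] by (intro add_mono mult_left_mono) auto
      also have "\<dots> = (K + \<kappa> m)\<^sup>2" by (simp add: power2_eq_square algebra_simps)
      finally show ?thesis .
    qed
    \<comment> \<open>Squared norms are turned into norms by a^2 + b^2 \<le> (a + b)^2, which makes
      the later recursion over the order of differentiation linear.\<close>
    also have "(K + \<kappa> m)\<^sup>2 + \<sigma>\<^sup>2 * (p - 2) * W\<^sup>2 \<le> (K + \<kappa> m + b)\<^sup>2"
      unfolding b0(2)[symmetric] power2_sum[of "K + \<kappa> m" b] using b0(1) K \<kappa>0[of m] by simp
    finally have *: "(\<integral>x. u m x powr p \<partial>M) powr (2 / p) \<le> (K + \<kappa> m + b)\<^sup>2" by simp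
    have int: "integrable M (\<lambda>x. u m x powr p)"
      by (rule integrable_bounded[of _ "real (Suc m) powr p"])
         (use u_le(2)[of m] u_le(3)[of m, THEN less_imp_le] p in \<open>auto intro!: powr_mono2 simp del: of_nat_Suc\<close>)
    have I0: "0 \<le> (\<integral>x. u m x powr p \<partial>M)" by (intro integral_nonneg_AE) auto
    have "(\<integral>x. u m x powr p \<partial>M) = ((\<integral>x. u m x powr p \<partial>M) powr (2 / p)) powr (p / 2)"
      using p I0 by (simp add: powr_powr)
    also have "\<dots> \<le> ((K + \<kappa> m + b)\<^sup>2) powr (p / 2)" using * p by (intro powr_mono2) auto
    also have "\<dots> = (K + \<kappa> m + b) powr p"
    proof -
      have "K + \<kappa> m + b > 0" using K \<kappa>0[of m] b0 by linarith
      then have "(K + \<kappa> m + b)\<^sup>2 = (K + \<kappa> m + b) powr 2" by simp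
      then show ?thesis by (simp add: powr_powr)
    qed
    finally show ?thesis using int by (subst nn_integral_eq_integral) (auto intro: ennreal_leI)
  qed
  have u_lim: "(\<lambda>m. u m x) \<longlonglongrightarrow> U x" for x
  proof -
    have v_lim: "(\<lambda>m. v m x) \<longlonglongrightarrow> U x"
    proof (rule tendsto_sandwich[of "\<lambda>_. U x" _ _ "\<lambda>m. U x + \<kappa> m"])
      show "(\<lambda>m. U x + \<kappa> m) \<longlonglongrightarrow> U x" using tendsto_add[OF tendsto_const \<kappa>_lim, of "U x"] by simp
    qed (use v(3,4) in auto)
    have eq: "u m x = v m x / (1 + v m x * (1 / real (Suc m)))" for m
      unfolding u_def using v_pos[of m x] by (simp add: field_simps)
    have "(\<lambda>m. v m x / (1 + v m x * (1 / real (Suc m)))) \<longlonglongrightarrow> U x / (1 + U x * 0)"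
      by (intro tendsto_intros v_lim LIMSEQ_Suc[OF lim_1_over_n]) auto
    then show ?thesis by (simp add: eq)
  qed
  have "(\<integral>\<^sup>+ x. ennreal (U x powr p) \<partial>M) = (\<integral>\<^sup>+ x. liminf (\<lambda>m. ennreal (u m x powr p)) \<partial>M)"
  proof (rule nn_integral_cong)
    fix x
    have "(\<lambda>m. u m x powr p) \<longlonglongrightarrow> U x powr p"
      by (rule tendsto_powr2[OF u_lim tendsto_const]) (use p u_le(3)[of _ x, THEN less_imp_le] in auto)
    then have "(\<lambda>m. ennreal (u m x powr p)) \<longlonglongrightarrow> ennreal (U x powr p)" by (rule tendsto_ennrealI)
    then show "ennreal (U x powr p) = liminf (\<lambda>m. ennreal (u m x powr p))"
      by (rule lim_imp_Liminf[OF trivial_limit_sequentially, symmetric])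
  qed
  also have "\<dots> \<le> liminf (\<lambda>m. \<integral>\<^sup>+ x. ennreal (u m x powr p) \<partial>M)" by (rule nn_integral_liminf) auto
  also have "\<dots> \<le> liminf (\<lambda>m. ennreal ((K + \<kappa> m + b) powr p))" by (intro Liminf_mono always_eventually allI main)
  also have "\<dots> = ennreal ((K + b) powr p)"
  proof (rule lim_imp_Liminf)
    have "(\<lambda>m. (K + \<kappa> m + b) powr p) \<longlonglongrightarrow> (K + 0 + b) powr p"
      by (intro tendsto_intros \<kappa>_lim) (use K b0 in auto)
    then show "(\<lambda>m. ennreal ((K + \<kappa> m + b) powr p)) \<longlonglongrightarrow> ennreal ((K + b) powr p)" by (simp add: tendsto_ennrealI)
  qed simp
  finally show ?thesis by (simp add: U_def b_def)
qed

end

subsection \<open>Operator norms\<close>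

definition unit_tuples :: "nat \<Rightarrow> nat \<Rightarrow> (nat \<Rightarrow> nat \<Rightarrow> real) set" where
  "unit_tuples n k = {v. \<forall>j<k. v j \<in> topspace (Euclidean_space n) \<and> L2_set (v j) {..<n} = 1}"

lemma op_norm_eq: "op_norm n k A = Sup (multilinear_form n k A ` unit_tuples n k)"
  unfolding op_norm_def unit_tuples_def by (rule arg_cong[where f = Sup]) auto

lemma unit_tuples_nonempty:
  assumes "n > 0"
  shows "unit_tuples n k \<noteq> {}"
proof -
  have "L2_set (\<lambda>i. if i = 0 then 1 else 0) {..<n} = sqrt (\<Sum>i<n. if i = 0 then 1 else 0)"
    unfolding L2_set_def by (intro arg_cong[where f = sqrt] sum.cong) auto
  then have "(\<lambda>j i. if i = 0 then 1 else 0) \<in> unit_tuples n k"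
    using assms by (auto simp: unit_tuples_def topspace_Euclidean_space)
  then show ?thesis by auto
qed

text \<open>Entries of a unit vector are at most 1 in absolute value. Boundedness makes the real
  \<open>Sup\<close> in \<open>op_norm\<close> a genuine upper bound.\<close>

lemma multilinear_form_bdd: "bdd_above (multilinear_form n k A ` unit_tuples n k)"
proof (rule bdd_aboveI2)
  fix v assume v: "v \<in> unit_tuples n k"
  have "multilinear_form n k A v \<le> (\<Sum>is | length is = k \<and> set is \<subseteq> {..<n}. \<bar>A is\<bar>)"
    unfolding multilinear_form_def
  proof (rule sum_mono)
    fix "is" assume "is \<in> {is. length is = k \<and> set is \<subseteq> {..<n}}"
    then have isn: "\<And>j. j < k \<Longrightarrow> is ! j < n" by (auto dest: nth_mem)
    have "\<bar>v j (is ! j)\<bar> \<le> 1" if "j < k" for j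
      using member_le_L2_set[of "{..<n}" "is ! j" "\<lambda>i. \<bar>v j i\<bar>"] isn[OF that] v that
      by (auto simp: unit_tuples_def L2_set_def)
    then have "(\<Prod>j<k. \<bar>v j (is ! j)\<bar>) \<le> 1" by (intro prod_le_1) auto
    then have "\<bar>A is * (\<Prod>j<k. v j (is ! j))\<bar> \<le> \<bar>A is\<bar>"
      unfolding abs_mult abs_prod by (intro mult_left_le) auto
    then show "A is * (\<Prod>j<k. v j (is ! j)) \<le> \<bar>A is\<bar>" by linarith
  qed
  then show "multilinear_form n k A v \<le> (\<Sum>is | length is = k \<and> set is \<subseteq> {..<n}. \<bar>A is\<bar>)" .
qed

lemma multilinear_form_le_op_norm: "v \<in> unit_tuples n k \<Longrightarrow> multilinear_form n k A v \<le> op_norm n k A"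
  unfolding op_norm_eq by (intro cSup_upper multilinear_form_bdd) auto

text \<open>Reversing the first vector changes the sign of the form, and k \<ge> 1 provides such a
  vector.\<close>

lemma abs_multilinear_form_le_op_norm:
  assumes v: "v \<in> unit_tuples n k" and k: "k \<ge> 1"
  shows "\<bar>multilinear_form n k A v\<bar> \<le> op_norm n k A"
proof -
  define v' where "v' = v(0 := (\<lambda>i. - v 0 i))"
  have "v' \<in> unit_tuples n k"
    using v by (auto simp: unit_tuples_def v'_def topspace_Euclidean_space L2_set_def)
  moreover have "multilinear_form n k A v' = - multilinear_form n k A v"
    unfolding multilinear_form_def sum_negf[symmetric]
  proof (rule sum.cong)
    fix "is" :: "nat list"
    have "(\<Prod>j<k. v' j (is ! j)) = v' 0 (is ! 0) * (\<Prod>j\<in>{..<k} - {0}. v' j (is ! j))"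
      using k by (subst prod.remove[of _ 0]) auto
    also have "(\<Prod>j\<in>{..<k} - {0}. v' j (is ! j)) = (\<Prod>j\<in>{..<k} - {0}. v j (is ! j))"
      by (intro prod.cong) (auto simp: v'_def)
    also have "v' 0 (is ! 0) * \<dots> = - (v 0 (is ! 0) * (\<Prod>j\<in>{..<k} - {0}. v j (is ! j)))" by (simp add: v'_def)
    also have "v 0 (is ! 0) * (\<Prod>j\<in>{..<k} - {0}. v j (is ! j)) = (\<Prod>j<k. v j (is ! j))"
      using k by (subst prod.remove[of "{..<k}" 0]) auto
    finally show "A is * (\<Prod>j<k. v' j (is ! j)) = - (A is * (\<Prod>j<k. v j (is ! j)))" by simp
  qed simp
  ultimately show ?thesis
    using multilinear_form_le_op_norm[of v' n k A] multilinear_form_le_op_norm[OF v, of A] by linarith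
qed

lemma op_norm_nonneg: "n > 0 \<Longrightarrow> k \<ge> 1 \<Longrightarrow> op_norm n k A \<ge> 0"
  using unit_tuples_nonempty[of n k] abs_multilinear_form_le_op_norm[of _ n k A] abs_ge_zero order_trans by blast

text \<open>The set of unit tuples is separable and the form is continuous in the tuple. One
  sequence \<open>t\<close> serves all coefficient arrays \<open>A\<close> at once, as it must,
  since \<open>A\<close> will vary with the point at which derivatives are taken.\<close>

lemma op_norm_countable_sup:
  assumes n: "n > 0"
  obtains t :: "nat \<Rightarrow> nat \<Rightarrow> nat \<Rightarrow> real" where "\<And>m. t m \<in> unit_tuples n k"
    "\<And>A y. y < op_norm n k A \<Longrightarrow> \<exists>m. y < multilinear_form n k A (t m)"
proof -
  obtain T where T: "countable T" "T \<subseteq> unit_tuples n k" "unit_tuples n k \<subseteq> closure T"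
    using separable[of "unit_tuples n k"] by blast
  have "T \<noteq> {}" using T(3) unit_tuples_nonempty[OF n, of k] by auto
  define t where "t = from_nat_into T"
  show ?thesis
  proof (rule that[of t])
    show "t m \<in> unit_tuples n k" for m
      using from_nat_into[OF \<open>T \<noteq> {}\<close>] T(2) by (auto simp: t_def)
    fix A y assume "y < op_norm n k A"
    then obtain v where v: "v \<in> unit_tuples n k" "y < multilinear_form n k A v"
      unfolding op_norm_eq using unit_tuples_nonempty[OF n, of k] multilinear_form_bdd[of n k A]
      by (subst (asm) less_cSup_iff) auto
    have "continuous_on UNIV (multilinear_form n k A)"
    proof -
      have "continuous_on UNIV (\<lambda>v::nat \<Rightarrow> nat \<Rightarrow> real. v j i)" for i j
        using continuous_on_compose2[OF continuous_on_coord[of UNIV i] continuous_on_product_coordinates[of j]] by auto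
      then show ?thesis unfolding multilinear_form_def[abs_def] by (intro continuous_intros)
    qed
    then have "open {v. y < multilinear_form n k A v}" by (intro open_Collect_less continuous_on_const)
    moreover have "v \<in> closure T" using v T by auto
    ultimately obtain u where "u \<in> T" "y < multilinear_form n k A u"
      using v(2) by (auto simp: closure_iff_nhds_not_empty disjoint_iff)
    then show "\<exists>m. y < multilinear_form n k A (t m)"
      using from_nat_into_surj[OF T(1)] by (metis t_def)
  qed
qed

lemma multilinear_form_0: "multilinear_form n 0 A v = A []"
proof -
  have "{is. length is = 0 \<and> set is \<subseteq> {..<n}} = {[]}" by auto
  then show ?thesis by (simp add: multilinear_form_def)
qed

text \<open>Splits off the first argument. As \<open>partial_derivs (i # is)\<close> differentiates
  in direction \<open>i\<close> last, the inner forms are the partial derivatives of a form in the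
  derivatives of one order less.\<close>

lemma multilinear_form_Suc:
  "multilinear_form n (Suc k) A v =
    (\<Sum>i<n. v 0 i * multilinear_form n k (\<lambda>is. A (i # is)) (\<lambda>j. v (Suc j)))"
proof -
  let ?L = "\<lambda>k. {is. length is = k \<and> set is \<subseteq> {..<n}}"
  have img: "?L (Suc k) = (\<lambda>(i, is). i # is) ` ({..<n} \<times> ?L k)"
    by (auto simp: length_Suc_conv image_iff)
  have inj: "inj_on (\<lambda>(i, is). i # is) ({..<n} \<times> ?L k)" by (auto simp: inj_on_def)
  have "multilinear_form n (Suc k) A v = (\<Sum>(i, is)\<in>{..<n} \<times> ?L k. A (i # is) * (\<Prod>j<Suc k. v j ((i # is) ! j)))"
    unfolding multilinear_form_def img by (subst sum.reindex[OF inj]) (simp add: case_prod_unfold comp_def)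
  also have "\<dots> = (\<Sum>i<n. \<Sum>is\<in>?L k. A (i # is) * (\<Prod>j<Suc k. v j ((i # is) ! j)))"
    by (simp add: sum.cartesian_product)
  also have "\<dots> = (\<Sum>i<n. v 0 i * multilinear_form n k (\<lambda>is. A (i # is)) (\<lambda>j. v (Suc j)))"
    unfolding multilinear_form_def sum_distrib_left
    by (intro sum.cong refl) (simp del: prod.lessThan_Suc add: prod.lessThan_Suc_shift mult_ac)
  finally show ?thesis .
qed

text \<open>Duality: with the normalised vector of the inner forms as first argument, the form
  returns the Euclidean length of that vector. Applied to the derivatives of order k + 1, this
  bounds the gradient of every form of order k by the next operator norm, with no factor depending
  on \<open>n\<close>.\<close>

lemma L2_set_multilinear_forms_le:
  assumes n: "n > 0" and v: "v \<in> unit_tuples n k"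
  shows "L2_set (\<lambda>i. multilinear_form n k (\<lambda>is. A (i # is)) v) {..<n} \<le> op_norm n (Suc k) A"
proof (cases "L2_set (\<lambda>i. multilinear_form n k (\<lambda>is. A (i # is)) v) {..<n} = 0")
  case True
  then show ?thesis using op_norm_nonneg[OF n] by simp
next
  case False
  define D where "D i = multilinear_form n k (\<lambda>is. A (i # is)) v" for i
  define L where "L = L2_set D {..<n}"
  have L: "L > 0" using False L2_set_nonneg[of D "{..<n}"] unfolding L_def D_def by linarith
  have sq: "(\<Sum>i<n. (D i)\<^sup>2) = L\<^sup>2" by (simp add: L_def L2_set_def sum_nonneg)
  define v' where "v' j = (case j of 0 \<Rightarrow> (\<lambda>i. if i < n then D i / L else 0) | Suc j \<Rightarrow> v j)" for j
  have "L2_set (\<lambda>i. if i < n then D i / L else 0) {..<n} = L2_set (\<lambda>i. (1 / L) * D i) {..<n}"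
    by (intro L2_set_cong) auto
  also have "\<dots> = 1" using L unfolding L2_set_scale by (simp flip: L_def)
  finally have "v' \<in> unit_tuples n (Suc k)"
    using v by (auto simp: unit_tuples_def v'_def topspace_Euclidean_space less_Suc_eq_0_disj)
  from multilinear_form_le_op_norm[OF this, of A]
  have "(\<Sum>i<n. v' 0 i * D i) \<le> op_norm n (Suc k) A"
    unfolding multilinear_form_Suc by (simp add: v'_def D_def)
  moreover have "(\<Sum>i<n. v' 0 i * D i) = (\<Sum>i<n. (D i)\<^sup>2) / L"
    by (simp add: v'_def sum_divide_distrib power2_eq_square)
  ultimately show ?thesis using L unfolding sq D_def[symmetric] L_def[symmetric] by (simp add: power2_eq_square)
qed

lemma C1_on_multilinear_form:
  assumes f: "C_diff_on n d G f" and k: "k < d"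
  shows "C1_on n G (\<lambda>x. multilinear_form n k (\<lambda>is. partial_derivs is f x) v)
    (\<lambda>i x. multilinear_form n k (\<lambda>is. partial_derivs (i # is) f x) v)"
proof -
  have cont: "continuous_on G (partial_derivs is f)" if "set is \<subseteq> {..<n}" "length is \<le> d" for "is"
    using f that by (auto simp: C_diff_on_def)
  have part: "has_partial i (partial_derivs is f) x (partial_derivs (i # is) f x)"
    if "set is \<subseteq> {..<n}" "length is < d" "i < n" "x \<in> G" for "is" i x
  proof -
    have "(\<lambda>t. partial_derivs is f (x(i := t))) field_differentiable at (x i)"
      using f that by (auto simp: C_diff_on_def)
    then show ?thesis by (simp only: partial_derivs.simps partial_deriv_def DERIV_deriv_iff_field_differentiable)
  qed
  show ?thesis
    unfolding C1_on_def multilinear_form_def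
  proof (intro conjI allI impI ballI)
    show "continuous_on G (\<lambda>x. \<Sum>is | length is = k \<and> set is \<subseteq> {..<n}. partial_derivs is f x * (\<Prod>j<k. v j (is ! j)))"
      by (intro continuous_on_sum continuous_on_mult continuous_on_const cont) (use k in auto)
    fix i assume i: "i < n"
    show "continuous_on G (\<lambda>x. \<Sum>is | length is = k \<and> set is \<subseteq> {..<n}. partial_derivs (i # is) f x * (\<Prod>j<k. v j (is ! j)))"
      by (intro continuous_on_sum continuous_on_mult continuous_on_const cont) (use k i in auto)
    fix x assume x: "x \<in> G"
    show "has_partial i (\<lambda>x. \<Sum>is | length is = k \<and> set is \<subseteq> {..<n}. partial_derivs is f x * (\<Prod>j<k. v j (is ! j))) x
        (\<Sum>is | length is = k \<and> set is \<subseteq> {..<n}. partial_derivs (i # is) f x * (\<Prod>j<k. v j (is ! j)))"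
      by (intro has_partial_sum DERIV_cmult_right part) (use k i x in auto)
  qed
qed

section \<open>Operator norms of derivatives as functions on G\<close>

context log_sobolev_space
begin

text \<open>Finite maxima over a dense sequence of tuples increase to the operator norm. They serve
  twice: for measurability, and as the finite families to which soft maxima apply.\<close>

lemma deriv_op_norm_approx:
  assumes n: "n > 0" and f: "C_diff_on n d G f" and k: "1 \<le> k" "k \<le> d"
  obtains t :: "nat \<Rightarrow> nat \<Rightarrow> nat \<Rightarrow> real" where "\<And>m. t m \<in> unit_tuples n k"
    "\<And>x. (\<lambda>m. Max ((\<lambda>a. \<bar>multilinear_form n k (\<lambda>is. partial_derivs is f x) (t a)\<bar>) ` {..m})) \<longlonglongrightarrow> deriv_op_norm n k f x"
    "\<And>m x. Max ((\<lambda>a. \<bar>multilinear_form n k (\<lambda>is. partial_derivs is f x) (t a)\<bar>) ` {..m}) \<le> deriv_op_norm n k f x"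
    "\<And>m. (\<lambda>x. Max ((\<lambda>a. \<bar>multilinear_form n k (\<lambda>is. partial_derivs is f x) (t a)\<bar>) ` {..m})) \<in> borel_measurable M"
proof -
  obtain t :: "nat \<Rightarrow> nat \<Rightarrow> nat \<Rightarrow> real" where t: "\<And>m. t m \<in> unit_tuples n k"
    "\<And>A y. y < op_norm n k A \<Longrightarrow> \<exists>m. y < multilinear_form n k A (t m)"
    by (rule op_norm_countable_sup[OF n, of k]) blast
  define F where "F a x = \<bar>multilinear_form n k (\<lambda>is. partial_derivs is f x) (t a)\<bar>" for a x
  have F_le: "F a x \<le> deriv_op_norm n k f x" for a x
    unfolding F_def deriv_op_norm_def by (rule abs_multilinear_form_le_op_norm[OF t(1) k(1)])
  have Max_le: "Max ((\<lambda>a. F a x) ` {..m}) \<le> deriv_op_norm n k f x" for m x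
    using F_le by (subst Max_le_iff) auto
  show ?thesis
  proof (rule that[of t, folded F_def, OF t(1) _ Max_le])
    show "(\<lambda>m. Max ((\<lambda>a. F a x) ` {..m})) \<longlonglongrightarrow> deriv_op_norm n k f x" for x
    proof (rule increasing_tendsto)
      show "\<forall>\<^sub>F m in sequentially. Max ((\<lambda>a. F a x) ` {..m}) \<le> deriv_op_norm n k f x" using Max_le by simp
      fix y assume "y < deriv_op_norm n k f x"
      then obtain a where "y < multilinear_form n k (\<lambda>is. partial_derivs is f x) (t a)"
        using t(2) unfolding deriv_op_norm_def by blast
      then have y: "y < F a x" unfolding F_def by linarith
      show "\<forall>\<^sub>F m in sequentially. y < Max ((\<lambda>a. F a x) ` {..m})"
      proof (rule eventually_sequentiallyI[of a])
        fix m assume "a \<le> m"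
        then have "F a x \<le> Max ((\<lambda>a. F a x) ` {..m})" by (intro Max_ge) auto
        then show "y < Max ((\<lambda>a. F a x) ` {..m})" using y by linarith
      qed
    qed
    have "(\<lambda>x. F a x) \<in> borel_measurable M" for a
      unfolding F_def multilinear_form_def
      by (intro borel_measurable_abs continuous_on_measurable continuous_on_sum continuous_on_mult continuous_on_const)
         (use f k in \<open>auto simp: C_diff_on_def\<close>)
    then show "(\<lambda>x. Max ((\<lambda>a. F a x) ` {..m})) \<in> borel_measurable M" for m
      by (intro borel_measurable_Max) auto
  qed
qed

lemma deriv_op_norm_measurable:
  assumes "n > 0" "C_diff_on n d G f" "1 \<le> k" "k \<le> d"
  shows "deriv_op_norm n k f \<in> borel_measurable M"
proof (rule deriv_op_norm_approx[OF assms])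
  fix t :: "nat \<Rightarrow> nat \<Rightarrow> nat \<Rightarrow> real"
  assume "\<And>x. (\<lambda>m. Max ((\<lambda>a. \<bar>multilinear_form n k (\<lambda>is. partial_derivs is f x) (t a)\<bar>) ` {..m})) \<longlonglongrightarrow> deriv_op_norm n k f x"
    "\<And>m. (\<lambda>x. Max ((\<lambda>a. \<bar>multilinear_form n k (\<lambda>is. partial_derivs is f x) (t a)\<bar>) ` {..m})) \<in> borel_measurable M"
  then show ?thesis by (rule borel_measurable_LIMSEQ_real)
qed

lemma integrable_of_nn_integral_le:
  assumes [measurable]: "h \<in> borel_measurable M" and "\<And>x. 0 \<le> h x" and le: "(\<integral>\<^sup>+ x. ennreal (h x) \<partial>M) \<le> ennreal C" and "C \<ge> 0"
  shows "integrable M h" "(\<integral>x. h x \<partial>M) \<le> C"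
proof -
  show int: "integrable M h"
    by (rule integrableI_nonneg) (use assms le_less_trans[OF le] in auto)
  have "ennreal (\<integral>x. h x \<partial>M) \<le> ennreal C" using le assms nn_integral_eq_integral[OF int] by simp
  then show "(\<integral>x. h x \<partial>M) \<le> C" using \<open>C \<ge> 0\<close> by simp
qed

text \<open>Each finite maximum satisfies the family estimate with the operator norm of order k + 1
  as common gradient bound. The result does not depend on the number of tuples, so Fatou's lemma
  passes to the supremum.\<close>

lemma moment_growth_deriv_op_norm:
  assumes n: "n > 0" and f: "C_diff_on n d G f" and k: "1 \<le> k" "k < d"
    and p: "p > 2" and W: "W > 0" and K: "K > 0"
    and w_le: "(\<integral>\<^sup>+ x. ennreal (deriv_op_norm n (Suc k) f x powr p) \<partial>M) \<le> ennreal (W powr p)"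
    and U_le: "(\<integral>\<^sup>+ x. ennreal ((deriv_op_norm n k f x)\<^sup>2) \<partial>M) \<le> ennreal (K\<^sup>2)"
  shows "(\<integral>\<^sup>+ x. ennreal (deriv_op_norm n k f x powr p) \<partial>M) \<le> ennreal ((K + \<sigma> * sqrt (p - 2) * W) powr p)"
proof -
  note [measurable] = deriv_op_norm_measurable[OF n f]
  have k': "k \<le> d" using k by simp
  obtain t where t: "\<And>m. t m \<in> unit_tuples n k"
    "\<And>x. (\<lambda>m. Max ((\<lambda>a. \<bar>multilinear_form n k (\<lambda>is. partial_derivs is f x) (t a)\<bar>) ` {..m})) \<longlonglongrightarrow> deriv_op_norm n k f x"
    "\<And>m x. Max ((\<lambda>a. \<bar>multilinear_form n k (\<lambda>is. partial_derivs is f x) (t a)\<bar>) ` {..m}) \<le> deriv_op_norm n k f x"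
    "\<And>m. (\<lambda>x. Max ((\<lambda>a. \<bar>multilinear_form n k (\<lambda>is. partial_derivs is f x) (t a)\<bar>) ` {..m})) \<in> borel_measurable M"
    by (rule deriv_op_norm_approx[OF n f k(1) k']) blast
  define U where "U m x = Max ((\<lambda>a. \<bar>multilinear_form n k (\<lambda>is. partial_derivs is f x) (t a)\<bar>) ` {..m})" for m x
  have U_lim: "(\<lambda>m. U m x) \<longlonglongrightarrow> deriv_op_norm n k f x" and U_dom: "U m x \<le> deriv_op_norm n k f x"
    and [measurable]: "U m \<in> borel_measurable M" for m x
    using t(2-4) unfolding U_def by auto
  have U0: "U m x \<ge> 0" for m x
    unfolding U_def by (rule order_trans[OF abs_ge_zero Max_ge[of _ "\<bar>multilinear_form n k (\<lambda>is. partial_derivs is f x) (t 0)\<bar>"]]) auto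
  have bound: "(\<integral>\<^sup>+ x. ennreal (U m x powr p) \<partial>M) \<le> ennreal ((K + \<sigma> * sqrt (p - 2) * W) powr p)" for m
    unfolding U_def
  proof (rule moment_growth_family[where w = "deriv_op_norm n (Suc k) f"
        and D = "\<lambda>a i x. multilinear_form n k (\<lambda>is. partial_derivs (i # is) f x) (t a)"])
    show "C1_on n G (\<lambda>x. multilinear_form n k (\<lambda>is. partial_derivs is f x) (t a))
        (\<lambda>i x. multilinear_form n k (\<lambda>is. partial_derivs (i # is) f x) (t a))" for a
      by (rule C1_on_multilinear_form[OF f k(2)])
    show "L2_set (\<lambda>i. multilinear_form n k (\<lambda>is. partial_derivs (i # is) f x) (t a)) {..<n} \<le> deriv_op_norm n (Suc k) f x" for a x
      using L2_set_multilinear_forms_le[OF n t(1), of "\<lambda>is. partial_derivs is f x"] unfolding deriv_op_norm_def .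
    have [measurable]: "deriv_op_norm n (Suc k) f \<in> borel_measurable M"
      by (rule deriv_op_norm_measurable[OF n f]) (use k in auto)
    show "integrable M (\<lambda>x. deriv_op_norm n (Suc k) f x powr p)"
      "(\<integral>x. deriv_op_norm n (Suc k) f x powr p \<partial>M) \<le> W powr p"
      by (rule integrable_of_nn_integral_le[OF _ _ w_le]; simp)+
    have sq: "(\<integral>\<^sup>+ x. ennreal ((U m x)\<^sup>2) \<partial>M) \<le> ennreal (K\<^sup>2)"
      by (rule order_trans[OF nn_integral_mono U_le]) (auto intro!: ennreal_leI power_mono U_dom U0)
    show "integrable M (\<lambda>x. (Max ((\<lambda>a. \<bar>multilinear_form n k (\<lambda>is. partial_derivs is f x) (t a)\<bar>) ` {..m}))\<^sup>2)"
      "(\<integral>x. (Max ((\<lambda>a. \<bar>multilinear_form n k (\<lambda>is. partial_derivs is f x) (t a)\<bar>) ` {..m}))\<^sup>2 \<partial>M) \<le> K\<^sup>2"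
      unfolding U_def[symmetric] by (rule integrable_of_nn_integral_le[OF _ _ sq]; simp)+
  qed (use p W K in auto)
  have "(\<integral>\<^sup>+ x. ennreal (deriv_op_norm n k f x powr p) \<partial>M) = (\<integral>\<^sup>+ x. liminf (\<lambda>m. ennreal (U m x powr p)) \<partial>M)"
  proof (rule nn_integral_cong)
    fix x
    have "(\<lambda>m. U m x powr p) \<longlonglongrightarrow> deriv_op_norm n k f x powr p"
      by (rule tendsto_powr2[OF U_lim tendsto_const]) (use p U0 in auto)
    then have "(\<lambda>m. ennreal (U m x powr p)) \<longlonglongrightarrow> ennreal (deriv_op_norm n k f x powr p)" by (rule tendsto_ennrealI)
    then show "ennreal (deriv_op_norm n k f x powr p) = liminf (\<lambda>m. ennreal (U m x powr p))"
      by (rule lim_imp_Liminf[OF trivial_limit_sequentially, symmetric])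
  qed
  also have "\<dots> \<le> liminf (\<lambda>m. \<integral>\<^sup>+ x. ennreal (U m x powr p) \<partial>M)" by (rule nn_integral_liminf) auto
  also have "\<dots> \<le> liminf (\<lambda>m. ennreal ((K + \<sigma> * sqrt (p - 2) * W) powr p))" by (intro Liminf_mono always_eventually allI bound)
  also have "\<dots> = ennreal ((K + \<sigma> * sqrt (p - 2) * W) powr p)" by (simp add: Liminf_const)
  finally show ?thesis .
qed

end

subsection \<open>Exponential integrability\<close>

text \<open>Prepares a truncation for functions of either sign: N sin (t / N) is bounded by N,
  dominated by |t| and has derivative in [-1, 1], so it does not enlarge gradients.\<close>

lemma scaled_sin_tendsto: "(\<lambda>m. real (Suc m) * sin (t / real (Suc m))) \<longlonglongrightarrow> t"
proof (cases "t = 0")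
  case False
  have "((\<lambda>h. sin h / h) \<longlongrightarrow> 1) (at (0::real))" using DERIV_sin[of 0] by (simp add: DERIV_def)
  moreover have "filterlim (\<lambda>m. t / real (Suc m)) (at 0) sequentially"
    unfolding filterlim_at using tendsto_mult_right_zero[OF LIMSEQ_Suc[OF lim_1_over_n], of t] False by simp
  ultimately have "(\<lambda>m. sin (t / real (Suc m)) / (t / real (Suc m))) \<longlonglongrightarrow> 1" by (rule filterlim_compose)
  from tendsto_mult[OF tendsto_const[of t] this]
  have "(\<lambda>m. t * (sin (t / real (Suc m)) / (t / real (Suc m)))) \<longlonglongrightarrow> t" by simp
  moreover have "t * (sin (t / real (Suc m)) / (t / real (Suc m))) = real (Suc m) * sin (t / real (Suc m))" for m
    using False by (simp del: of_nat_Suc)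
  ultimately show ?thesis by (simp only:)
qed auto

lemma Lp_norm_2_le:
  assumes "Lp_norm M 2 h \<le> ennreal c" "c \<ge> 0"
  shows "(\<integral>\<^sup>+ x. ennreal ((h x)\<^sup>2) \<partial>M) \<le> ennreal (c\<^sup>2)"
proof -
  have two: "enn2real 2 = 2" using enn2real_numeral[of "num.Bit0 num.One"] by simp
  define I where "I = (\<integral>\<^sup>+ x. ennreal (\<bar>h x\<bar> powr 2) \<partial>M)"
  have I: "I = (\<integral>\<^sup>+ x. ennreal ((h x)\<^sup>2) \<partial>M)" unfolding I_def by simp
  have L: "Lp_norm M 2 h = (if I = \<infinity> then \<infinity> else ennreal (enn2real I powr (1 / 2)))"
    unfolding Lp_norm_def two I_def Let_def by simp
  \<comment> \<open>Finiteness must come first: \<open>enn2real\<close> sends infinity to 0, so a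
    bound on \<open>enn2real I\<close> alone would not control I.\<close>
  have fin: "I \<noteq> \<infinity>" using assms L by (auto simp: top_unique)
  then have "enn2real I powr (1 / 2) \<le> c" using assms L by simp
  then have "(enn2real I powr (1 / 2))\<^sup>2 \<le> c\<^sup>2" by (intro power_mono) auto
  then have "enn2real I \<le> c\<^sup>2" by (simp add: power2_eq_square flip: powr_add)
  then have "I \<le> ennreal (c\<^sup>2)" using fin
    by (metis ennreal_enn2real ennreal_leI infinity_ennreal_def less_top)
  then show ?thesis by (simp add: I)
qed

text \<open>The quotient m^m / m! is a single term of the series of exp m, and e \<le> 3.\<close>

lemma power_self_le_fact: "real m ^ m \<le> 3 ^ m * fact m"
proof -
  have "real m ^ m / fact m \<le> exp (real m)"
  proof -
    have "(\<Sum>k\<in>{m}. inverse (fact k) * real m ^ k) \<le> (\<Sum>k. inverse (fact k) * real m ^ k)"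
      by (rule sum_le_suminf) (use summable_exp[of "real m"] in auto)
    then show ?thesis by (simp add: exp_def divide_inverse mult.commute)
  qed
  also have "exp (real m) = exp 1 ^ m" by (simp flip: exp_of_nat_mult)
  also have "\<dots> \<le> 3 ^ m" by (intro power_mono exp_le) auto
  finally show ?thesis by (simp add: divide_le_eq)
qed

text \<open>The condition on \<open>s\<close> says 4 \<le> 3 s: one more term is absorbed by the
  growth of 4 s^m, so no factor depending on the number of terms appears.\<close>

lemma geometric_sum_le:
  fixes s :: real
  assumes "s \<ge> 4 / 3"
  shows "(\<Sum>j\<le>m. s ^ j) \<le> 4 * s ^ m"
proof (induction m)
  case (Suc m)
  have "4 * s ^ m \<le> 3 * s * s ^ m" using assms by (intro mult_right_mono) auto
  then show ?case using Suc by simp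
qed simp

section \<open>Poincare inequality for unbounded functions, the moment recursion, and exponential
  integrability\<close>

context log_sobolev_space
begin

text \<open>Truncate \<open>f\<close> by the sine, subtract the mean of the truncation and use the
  bounded case. The means tend to 0 by domination with |f|, and Fatou's lemma bounds the second
  moment of \<open>f\<close>, including its finiteness.\<close>

lemma poincare:
  assumes f: "C1_on n G f D" and int: "integrable M f" and mean: "(\<integral>x. f x \<partial>M) = 0"
    and w: "integrable M w" and Dw: "\<And>x. x \<in> G \<Longrightarrow> (\<Sum>i<n. (D i x)\<^sup>2) \<le> w x"
  shows "(\<integral>\<^sup>+ x. ennreal ((f x)\<^sup>2) \<partial>M) \<le> ennreal (\<sigma>\<^sup>2 * (\<integral>x. w x \<partial>M))"
proof -
  have [measurable]: "f \<in> borel_measurable M" using int by simp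
  define T where "T m x = real (Suc m) * sin (f x / real (Suc m))" for m x
  have T_meas [measurable]: "T m \<in> borel_measurable M" for m unfolding T_def[abs_def] by measurable
  have T_lim: "(\<lambda>m. T m x) \<longlonglongrightarrow> f x" for x unfolding T_def by (rule scaled_sin_tendsto)
  have T_le: "\<bar>T m x\<bar> \<le> \<bar>f x\<bar>" for m x
  proof -
    have "\<bar>T m x\<bar> \<le> real (Suc m) * \<bar>f x / real (Suc m)\<bar>"
      unfolding T_def abs_mult using abs_sin_x_le_abs_x[of "f x / real (Suc m)"] by (intro mult_mono) auto
    then show ?thesis by (simp add: abs_divide)
  qed
  have T_bnd: "\<bar>T m x\<bar> \<le> real (Suc m)" for m x
    unfolding T_def abs_mult using mult_left_le[of "\<bar>sin (f x / real (Suc m))\<bar>" "real (Suc m)"] by simp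
  define E where "E m = (\<integral>x. T m x \<partial>M)" for m
  have E_lim: "E \<longlonglongrightarrow> 0"
    unfolding E_def[abs_def] mean[symmetric]
    by (rule integral_dominated_convergence[where w = "\<lambda>x. \<bar>f x\<bar>"]) (use int T_lim T_le in auto)
  have T_int: "integrable M (T m)" "integrable M (\<lambda>x. (T m x)\<^sup>2)" for m
  proof -
    show "integrable M (T m)" by (rule integrable_bounded[OF _ T_bnd]) simp
    have "(T m x)\<^sup>2 \<le> (real (Suc m))\<^sup>2" for x using power_mono[OF T_bnd[of m x], of 2] by (simp del: of_nat_Suc)
    then show "integrable M (\<lambda>x. (T m x)\<^sup>2)" by (intro integrable_bounded[of _ "(real (Suc m))\<^sup>2"]) auto
  qed
  have bound: "(\<integral>\<^sup>+ x. ennreal ((T m x)\<^sup>2) \<partial>M) \<le> ennreal (\<sigma>\<^sup>2 * (\<integral>x. w x \<partial>M) + (E m)\<^sup>2)" for m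
  proof -
    define N where "N = real (Suc m)"
    have N: "N > 0" by (simp add: N_def)
    have C1: "C1_on n G (\<lambda>x. N * sin (f x / N) - E m) (\<lambda>i x. cos (f x / N) * D i x)"
    proof (rule C1_on_compose[OF f])
      show "((\<lambda>t. N * sin (t / N) - E m) has_real_derivative cos (f x / N)) (at (f x))" for x
        using N by (auto intro!: derivative_eq_intros)
      show "continuous_on (f ` G) (\<lambda>t. cos (t / N))" using N by (intro continuous_intros) auto
    qed
    have T: "T m x - E m = N * sin (f x / N) - E m" for x by (simp add: T_def N_def)
    have "(\<integral>x. (T m x - E m)\<^sup>2 \<partial>M) \<le> \<sigma>\<^sup>2 * (\<integral>x. w x \<partial>M)"
      unfolding T
    proof (rule poincare_bounded[OF C1, of "N + \<bar>E m\<bar>"])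
      show "\<bar>N * sin (f x / N) - E m\<bar> \<le> N + \<bar>E m\<bar>" for x
        using T_bnd[of m x] T[of x] unfolding N_def by linarith
      show "(\<integral>x. N * sin (f x / N) - E m \<partial>M) = 0"
        unfolding T[symmetric] using T_int by (simp add: prob_space E_def)
      fix x assume x: "x \<in> G"
      have "(\<Sum>i<n. (cos (f x / N) * D i x)\<^sup>2) = (cos (f x / N))\<^sup>2 * (\<Sum>i<n. (D i x)\<^sup>2)"
        by (simp add: power_mult_distrib sum_distrib_left)
      also have "\<dots> \<le> 1 * w x"
        using Dw[OF x] abs_cos_le_one[of "f x / N"] by (intro mult_mono) (auto intro: sum_nonneg simp: abs_square_le_1)
      finally show "(\<Sum>i<n. (cos (f x / N) * D i x)\<^sup>2) \<le> w x" by simp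
    qed (rule w)
    moreover have "(\<integral>x. (T m x - E m)\<^sup>2 \<partial>M) = (\<integral>x. (T m x)\<^sup>2 \<partial>M) - (E m)\<^sup>2"
    proof -
      have "(\<lambda>x. (T m x - E m)\<^sup>2) = (\<lambda>x. (T m x)\<^sup>2 - 2 * E m * T m x + (E m)\<^sup>2)"
        by (auto simp: power2_eq_square algebra_simps)
      then have "(\<integral>x. (T m x - E m)\<^sup>2 \<partial>M) = (\<integral>x. (T m x)\<^sup>2 \<partial>M) - 2 * E m * E m + (E m)\<^sup>2"
        using T_int[of m] by (simp add: prob_space E_def)
      then show ?thesis by (simp add: power2_eq_square)
    qed
    ultimately have "(\<integral>x. (T m x)\<^sup>2 \<partial>M) \<le> \<sigma>\<^sup>2 * (\<integral>x. w x \<partial>M) + (E m)\<^sup>2" by linarith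
    then show ?thesis using T_int(2)[of m] by (subst nn_integral_eq_integral) (auto intro: ennreal_leI)
  qed
  have "(\<integral>\<^sup>+ x. ennreal ((f x)\<^sup>2) \<partial>M) = (\<integral>\<^sup>+ x. liminf (\<lambda>m. ennreal ((T m x)\<^sup>2)) \<partial>M)"
  proof (rule nn_integral_cong)
    fix x
    have "(\<lambda>m. ennreal ((T m x)\<^sup>2)) \<longlonglongrightarrow> ennreal ((f x)\<^sup>2)"
      by (intro tendsto_ennrealI tendsto_intros T_lim)
    then show "ennreal ((f x)\<^sup>2) = liminf (\<lambda>m. ennreal ((T m x)\<^sup>2))"
      by (rule lim_imp_Liminf[OF trivial_limit_sequentially, symmetric])
  qed
  also have "\<dots> \<le> liminf (\<lambda>m. \<integral>\<^sup>+ x. ennreal ((T m x)\<^sup>2) \<partial>M)" by (rule nn_integral_liminf) auto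
  also have "\<dots> \<le> liminf (\<lambda>m. ennreal (\<sigma>\<^sup>2 * (\<integral>x. w x \<partial>M) + (E m)\<^sup>2))"
    by (intro Liminf_mono always_eventually allI bound)
  also have "\<dots> = ennreal (\<sigma>\<^sup>2 * (\<integral>x. w x \<partial>M))"
  proof (rule lim_imp_Liminf)
    have "(\<lambda>m. ennreal (\<sigma>\<^sup>2 * (\<integral>x. w x \<partial>M) + (E m)\<^sup>2)) \<longlonglongrightarrow> ennreal (\<sigma>\<^sup>2 * (\<integral>x. w x \<partial>M) + 0\<^sup>2)"
      by (intro tendsto_ennrealI tendsto_intros E_lim)
    then show "(\<lambda>m. ennreal (\<sigma>\<^sup>2 * (\<integral>x. w x \<partial>M) + (E m)\<^sup>2)) \<longlonglongrightarrow> ennreal (\<sigma>\<^sup>2 * (\<integral>x. w x \<partial>M))" by simp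
  qed simp
  finally show ?thesis .
qed

text \<open>Induction downwards from order \<open>d\<close>, with \<open>m\<close> counting the
  steps. The bound for order d - m solves R 0 = 1 and R (m + 1) = \<sigma>^(m + 1) + \<sigma> s R m
  with s = sqrt (p - 2); the first summand is the L2 hypothesis.\<close>

lemma moments_of_deriv_op_norm:
  assumes n: "n > 0" and f: "C_diff_on n d G f"
    and L2: "\<And>k. 1 \<le> k \<Longrightarrow> k < d \<Longrightarrow> (\<integral>\<^sup>+ x. ennreal ((deriv_op_norm n k f x)\<^sup>2) \<partial>M) \<le> ennreal ((\<sigma> ^ (d - k))\<^sup>2)"
    and top: "AE x in M. \<bar>deriv_op_norm n d f x\<bar> \<le> 1"
    and p: "p > 2" and m: "m < d"
  shows "(\<integral>\<^sup>+ x. ennreal (deriv_op_norm n (d - m) f x powr p) \<partial>M)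
    \<le> ennreal ((\<sigma> ^ m * (\<Sum>j\<le>m. sqrt (p - 2) ^ j)) powr p)"
  using m
proof (induction m)
  case 0
  have "(\<integral>\<^sup>+ x. ennreal (deriv_op_norm n d f x powr p) \<partial>M) \<le> (\<integral>\<^sup>+ x. 1 \<partial>M)"
  proof (rule nn_integral_mono_AE, use top in eventually_elim)
    fix x assume x: "\<bar>deriv_op_norm n d f x\<bar> \<le> 1"
    have "0 \<le> deriv_op_norm n d f x" unfolding deriv_op_norm_def using 0 by (intro op_norm_nonneg n) auto
    then have "deriv_op_norm n d f x powr p \<le> 1 powr p" using x p by (intro powr_mono2) auto
    then show "ennreal (deriv_op_norm n d f x powr p) \<le> 1" using ennreal_le_1 by simp
  qed
  then show ?case by (simp add: emeasure_space_1)
next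
  case (Suc m)
  define s where "s = sqrt (p - 2)"
  have s: "s > 0" using p by (simp add: s_def)
  have eq: "\<sigma> ^ Suc m + \<sigma> * s * (\<sigma> ^ m * (\<Sum>j\<le>m. s ^ j)) = \<sigma> ^ Suc m * (\<Sum>j\<le>Suc m. s ^ j)"
    unfolding sum.atMost_Suc_shift by (simp add: sum_distrib_left algebra_simps)
  have k: "Suc (d - Suc m) = d - m" "d - (d - Suc m) = Suc m" using Suc.prems by auto
  have "(\<integral>\<^sup>+ x. ennreal (deriv_op_norm n (d - Suc m) f x powr p) \<partial>M)
      \<le> ennreal ((\<sigma> ^ Suc m + \<sigma> * s * (\<sigma> ^ m * (\<Sum>j\<le>m. s ^ j))) powr p)"
    unfolding s_def
  proof (rule moment_growth_deriv_op_norm[OF n f _ _ p])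
    show "1 \<le> d - Suc m" "d - Suc m < d" using Suc.prems by auto
    show "0 < \<sigma> ^ m * (\<Sum>j\<le>m. sqrt (p - 2) ^ j)"
      using \<sigma>_pos s by (intro mult_pos_pos sum_pos) (auto simp: s_def)
    show "0 < \<sigma> ^ Suc m" using \<sigma>_pos by simp
    show "(\<integral>\<^sup>+ x. ennreal (deriv_op_norm n (Suc (d - Suc m)) f x powr p) \<partial>M)
        \<le> ennreal ((\<sigma> ^ m * (\<Sum>j\<le>m. sqrt (p - 2) ^ j)) powr p)"
      unfolding k using Suc by simp
    show "(\<integral>\<^sup>+ x. ennreal ((deriv_op_norm n (d - Suc m) f x)\<^sup>2) \<partial>M) \<le> ennreal ((\<sigma> ^ Suc m)\<^sup>2)"
      using L2[of "d - Suc m"] Suc.prems unfolding k by simp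
  qed
  then show ?case unfolding eq unfolding s_def .
qed

text \<open>The last step, from order 1 to \<open>f\<close> itself, follows the same recursion; its
  L2 input comes from the Poincare inequality. As p \<ge> 4 gives s \<ge> 4/3, the geometric sum is
  at most 4 s^d.\<close>

lemma moments:
  assumes n: "n > 0" and d: "d \<ge> 1" and f: "C_diff_on n d G f"
    and int: "integrable M f" and mean: "(\<integral>x. f x \<partial>M) = 0"
    and L2: "\<And>k. 1 \<le> k \<Longrightarrow> k < d \<Longrightarrow> (\<integral>\<^sup>+ x. ennreal ((deriv_op_norm n k f x)\<^sup>2) \<partial>M) \<le> ennreal ((\<sigma> ^ (d - k))\<^sup>2)"
    and top: "AE x in M. \<bar>deriv_op_norm n d f x\<bar> \<le> 1"
    and p: "p \<ge> 4"
  shows "(\<integral>\<^sup>+ x. ennreal (\<bar>f x\<bar> powr p) \<partial>M) \<le> ennreal ((4 * \<sigma> ^ d * p powr (real d / 2)) powr p)"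
proof -
  define s where "s = sqrt (p - 2)"
  define w where "w = deriv_op_norm n 1 f"
  define R where "R m = \<sigma> ^ m * (\<Sum>j\<le>m. s ^ j)" for m
  obtain d' where d': "d = Suc d'" using d by (cases d) auto
  have [measurable]: "w \<in> borel_measurable M"
    unfolding w_def by (rule deriv_op_norm_measurable[OF n f]) (use d in auto)
  have w0: "w x \<ge> 0" for x unfolding w_def deriv_op_norm_def by (intro op_norm_nonneg n) auto
  have s: "s \<ge> 4 / 3"
  proof -
    have "(4 / 3)\<^sup>2 \<le> p - 2" using p by (simp add: power2_eq_square)
    then show ?thesis unfolding s_def by (rule real_le_rsqrt)
  qed
  have C1: "C1_on n G f (\<lambda>i x. partial_deriv i f x)"
    using C1_on_multilinear_form[OF f, of 0 "\<lambda>_ _. 0"] d by (simp add: multilinear_form_0)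
  have grad: "L2_set (\<lambda>i. partial_deriv i f x) {..<n} \<le> w x" for x
    using L2_set_multilinear_forms_le[OF n, of "\<lambda>_ _. 0" 0 "\<lambda>is. partial_derivs is f x"]
    by (simp add: multilinear_form_0 unit_tuples_def w_def deriv_op_norm_def)
  have w2: "(\<integral>\<^sup>+ x. ennreal ((w x)\<^sup>2) \<partial>M) \<le> ennreal ((\<sigma> ^ (d - 1))\<^sup>2)"
  \<comment> \<open>For d = 1 the gradient is the top derivative and is bounded by 1 almost
    everywhere; otherwise its L2 norm is covered by the hypotheses.\<close>
  proof (cases "d = 1")
    case True
    have "(\<integral>\<^sup>+ x. ennreal ((w x)\<^sup>2) \<partial>M) \<le> (\<integral>\<^sup>+ x. 1 \<partial>M)"
    proof (rule nn_integral_mono_AE, use top in eventually_elim)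
      fix x assume "\<bar>deriv_op_norm n d f x\<bar> \<le> 1"
      then have "(w x)\<^sup>2 \<le> 1" using True by (simp add: w_def abs_square_le_1)
      then show "ennreal ((w x)\<^sup>2) \<le> 1" using ennreal_le_1 by blast
    qed
    then show ?thesis using True by (simp add: emeasure_space_1)
  next
    case False
    then show ?thesis using L2[of 1] d unfolding w_def by auto
  qed
  have w2_int: "integrable M (\<lambda>x. (w x)\<^sup>2)" "(\<integral>x. (w x)\<^sup>2 \<partial>M) \<le> (\<sigma> ^ (d - 1))\<^sup>2"
    by (rule integrable_of_nn_integral_le[OF _ _ w2]; simp)+
  have "(\<integral>\<^sup>+ x. ennreal ((f x)\<^sup>2) \<partial>M) \<le> ennreal (\<sigma>\<^sup>2 * (\<integral>x. (w x)\<^sup>2 \<partial>M))"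
  proof (rule poincare[OF C1 int mean w2_int(1)])
    fix x
    have "(L2_set (\<lambda>i. partial_deriv i f x) {..<n})\<^sup>2 \<le> (w x)\<^sup>2" using grad by (intro power_mono) auto
    then show "(\<Sum>i<n. (partial_deriv i f x)\<^sup>2) \<le> (w x)\<^sup>2" by (simp add: L2_set_def sum_nonneg)
  qed
  also have "\<dots> \<le> ennreal ((\<sigma> ^ d)\<^sup>2)"
  proof (rule ennreal_leI)
    have "\<sigma>\<^sup>2 * (\<integral>x. (w x)\<^sup>2 \<partial>M) \<le> \<sigma>\<^sup>2 * (\<sigma> ^ (d - 1))\<^sup>2" using w2_int(2) by (intro mult_left_mono) auto
    then show "\<sigma>\<^sup>2 * (\<integral>x. (w x)\<^sup>2 \<partial>M) \<le> (\<sigma> ^ d)\<^sup>2" by (simp add: d' power_mult_distrib)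
  qed
  finally have f2: "(\<integral>\<^sup>+ x. ennreal ((f x)\<^sup>2) \<partial>M) \<le> ennreal ((\<sigma> ^ d)\<^sup>2)" .
  have f2_int: "integrable M (\<lambda>x. (f x)\<^sup>2)" "(\<integral>x. (f x)\<^sup>2 \<partial>M) \<le> (\<sigma> ^ d)\<^sup>2"
    by (rule integrable_of_nn_integral_le[OF _ _ f2]; use int in simp)+
  have wp: "(\<integral>\<^sup>+ x. ennreal (w x powr p) \<partial>M) \<le> ennreal (R d' powr p)"
    using moments_of_deriv_op_norm[OF n f L2 top, of p d'] p unfolding d' w_def R_def s_def by simp
  have wp_int: "integrable M (\<lambda>x. w x powr p)" "(\<integral>x. w x powr p \<partial>M) \<le> R d' powr p"
    by (rule integrable_of_nn_integral_le[OF _ _ wp]; simp)+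
  \<comment> \<open>A single function seen as a family over the unit type, so that the maximum is
    |f|.\<close>
  have "(\<integral>\<^sup>+ x. ennreal (Max ((\<lambda>a::unit. \<bar>f x\<bar>) ` {()}) powr p) \<partial>M) \<le> ennreal ((\<sigma> ^ d + \<sigma> * sqrt (p - 2) * R d') powr p)"
  proof (rule moment_growth_family[where D = "\<lambda>a i x. partial_deriv i f x" and w = w])
    show "0 < R d'" unfolding R_def using \<sigma>_pos s by (intro mult_pos_pos sum_pos) auto
  qed (use C1 grad p wp_int f2_int \<sigma>_pos in auto)
  then have "(\<integral>\<^sup>+ x. ennreal (\<bar>f x\<bar> powr p) \<partial>M) \<le> ennreal ((\<sigma> ^ d + \<sigma> * s * R d') powr p)" by (simp add: s_def)
  also have "\<sigma> ^ d + \<sigma> * s * R d' = \<sigma> ^ d * (\<Sum>j\<le>d. s ^ j)"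
    unfolding d' sum.atMost_Suc_shift R_def by (simp add: sum_distrib_left algebra_simps)
  also have "ennreal ((\<sigma> ^ d * (\<Sum>j\<le>d. s ^ j)) powr p) \<le> ennreal ((4 * \<sigma> ^ d * p powr (real d / 2)) powr p)"
  proof (intro ennreal_leI powr_mono2)
    have "s ^ d \<le> sqrt p ^ d" unfolding s_def using p by (intro power_mono) auto
    also have "\<dots> = p powr (real d / 2)"
      using p by (simp add: powr_half_sqrt[symmetric] powr_powr flip: powr_realpow)
    finally have "(\<Sum>j\<le>d. s ^ j) \<le> 4 * p powr (real d / 2)" using geometric_sum_le[OF s, of d] by linarith
    then have "\<sigma> ^ d * (\<Sum>j\<le>d. s ^ j) \<le> \<sigma> ^ d * (4 * p powr (real d / 2))" using \<sigma>_pos by (intro mult_left_mono) auto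
    then show "\<sigma> ^ d * (\<Sum>j\<le>d. s ^ j) \<le> 4 * \<sigma> ^ d * p powr (real d / 2)" by simp
    show "0 \<le> \<sigma> ^ d * (\<Sum>j\<le>d. s ^ j)" using \<sigma>_pos s by (intro mult_nonneg_nonneg sum_nonneg) auto
  qed (use p in auto)
  finally show ?thesis .
qed

text \<open>Expand the exponential: the m-th term is a moment of order q = 2 m / d. Bounding that
  moment by 2 (96 \<sigma>^2)^m m! cancels the factorial and leaves a geometric series.\<close>

lemma exponential_integrability_of_moments:
  assumes d: "d \<ge> 1" and [measurable]: "f \<in> borel_measurable M"
    and mom: "\<And>p. p \<ge> 4 \<Longrightarrow> (\<integral>\<^sup>+ x. ennreal (\<bar>f x\<bar> powr p) \<partial>M) \<le> ennreal ((4 * \<sigma> ^ d * p powr (real d / 2)) powr p)"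
  shows "(\<integral>\<^sup>+ x. ennreal (exp (1 / 288 / \<sigma>\<^sup>2 * \<bar>f x\<bar> powr (2 / real d))) \<partial>M) \<le> 2"
proof -
  define y where "y x = 1 / 288 / \<sigma>\<^sup>2 * \<bar>f x\<bar> powr (2 / real d)" for x
  have y0: "y x \<ge> 0" for x by (simp add: y_def)
  have [measurable]: "y \<in> borel_measurable M" unfolding y_def by measurable
  define q where "q m = 2 * real m / real d" for m
  have d0: "real d > 0" using d by simp
  have q: "q m * (real d / 2) = real m" "0 \<le> q m" "q m \<le> 2 * real m" for m
    using d mult_left_mono[of 1 "real d" "real m"] by (auto simp: q_def divide_le_eq)
  \<comment> \<open>The condition m \<ge> 1 avoids the convention 0 powr 0 = 0 at zeros of
    \<open>f\<close>.\<close>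
  have ym: "y x ^ m = (1 / 288 / \<sigma>\<^sup>2) ^ m * \<bar>f x\<bar> powr q m" if "m \<ge> 1" for x m
  proof -
    have "(\<bar>f x\<bar> powr (2 / real d)) ^ m = \<bar>f x\<bar> powr q m"
      using that by (cases "f x = 0") (simp_all add: q_def powr_powr mult.commute flip: powr_realpow)
    then show ?thesis unfolding y_def power_mult_distrib by (simp only:)
  qed
  have \<sigma>q: "(\<sigma> ^ d) powr q m = \<sigma> ^ (2 * m)" for m
    using \<sigma>_pos d by (simp add: powr_powr q_def flip: powr_realpow)
  have q_moment: "(\<integral>\<^sup>+ x. ennreal (\<bar>f x\<bar> powr q m) \<partial>M) \<le> ennreal (2 * (96 * \<sigma>\<^sup>2) ^ m * fact m)" if m: "m \<ge> 1" for m
  proof (cases "q m \<ge> 4")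
    case True
    have "(4 * \<sigma> ^ d * q m powr (real d / 2)) powr q m = 4 powr q m * \<sigma> ^ (2 * m) * q m ^ m"
    proof -
      have "(q m powr (real d / 2)) powr q m = q m ^ m"
        using q(1)[of m] True by (simp add: powr_powr mult.commute powr_realpow)
      then show ?thesis using \<sigma>_pos by (simp add: powr_mult \<sigma>q)
    qed
    \<comment> \<open>Here q \<le> 2 m gives 4^q \<le> 16^m and q^m \<le> 2^m m^m, and m^m \<le> 3^m
      m!; together this is the constant 96 = 16 * 2 * 3.\<close>
    also have "\<dots> \<le> 16 ^ m * \<sigma> ^ (2 * m) * (2 ^ m * (3 ^ m * fact m))"
    proof (intro mult_mono)
      have "(4::real) powr q m \<le> 4 powr (2 * real m)" using q(3) by (intro powr_mono) auto
      also have "\<dots> = (4 powr 2) powr real m" by (simp only: powr_powr)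
      also have "\<dots> = 16 ^ m" by (simp add: powr_realpow)
      finally show "4 powr q m \<le> 16 ^ m" .
      have "q m ^ m \<le> (2 * real m) ^ m" using q by (intro power_mono) auto
      also have "\<dots> \<le> 2 ^ m * (3 ^ m * fact m)"
        unfolding power_mult_distrib by (intro mult_left_mono power_self_le_fact) auto
      finally show "q m ^ m \<le> 2 ^ m * (3 ^ m * fact m)" .
    qed (use \<sigma>_pos q in auto)
    also have "\<dots> = (16 * \<sigma>\<^sup>2 * (2 * 3)) ^ m * fact m"
      unfolding power_mult_distrib power_mult by (simp only: mult.assoc)
    also have "\<dots> = (96 * \<sigma>\<^sup>2) ^ m * fact m" by (simp add: mult.commute)
    also have "\<dots> \<le> 2 * (96 * \<sigma>\<^sup>2) ^ m * fact m" by simp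
    finally show ?thesis using mom[OF True] by (meson ennreal_leI order_trans)
  next
    case False
    \<comment> \<open>Orders below 4 are reached by interpolation: \<open>L\<close> is the bound on
      the norm of order 4, and for r = |f| / L one has r^q \<le> 1 + r^4, which costs the factor
      2.\<close>
    define L where "L = 4 * \<sigma> ^ d * 4 powr (real d / 2)"
    have L: "L > 0" using \<sigma>_pos by (simp add: L_def)
    have pw: "\<bar>f x\<bar> powr q m \<le> L powr q m * (1 + \<bar>f x\<bar> powr 4 / L powr 4)" for x
    proof -
      define r where "r = \<bar>f x\<bar> / L"
      have r: "r \<ge> 0" using L by (simp add: r_def)
      have "r powr q m \<le> 1 + r powr 4"
      proof (cases "r \<le> 1")
        case True
        then have "r powr q m \<le> 1 powr q m" using q r by (intro powr_mono2) auto
        then show ?thesis by (simp add: add_increasing2)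
      next
        case False
        then have "r powr q m \<le> r powr 4" using \<open>\<not> 4 \<le> q m\<close> by (intro powr_mono) auto
        then show ?thesis by simp
      qed
      then have "L powr q m * r powr q m \<le> L powr q m * (1 + r powr 4)" by (intro mult_left_mono) auto
      moreover have "L powr q m * r powr q m = \<bar>f x\<bar> powr q m" using L by (simp add: r_def powr_divide)
      ultimately show ?thesis using L by (simp add: r_def powr_divide)
    qed
    have "(\<integral>\<^sup>+ x. ennreal (\<bar>f x\<bar> powr q m) \<partial>M) \<le> (\<integral>\<^sup>+ x. ennreal (L powr q m) + ennreal (L powr q m / L powr 4) * ennreal (\<bar>f x\<bar> powr 4) \<partial>M)"
      by (intro nn_integral_mono) (use pw in \<open>simp add: ennreal_plus[symmetric] ennreal_mult[symmetric] ennreal_leI algebra_simps del: ennreal_plus\<close>)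
    also have "\<dots> = ennreal (L powr q m) + ennreal (L powr q m / L powr 4) * (\<integral>\<^sup>+ x. ennreal (\<bar>f x\<bar> powr 4) \<partial>M)"
      by (simp add: nn_integral_add nn_integral_cmult emeasure_space_1)
    also have "\<dots> \<le> ennreal (L powr q m) + ennreal (L powr q m / L powr 4) * ennreal (L powr 4)"
      using mom[of 4] unfolding L_def[symmetric] by (intro add_left_mono mult_left_mono) auto
    also have "\<dots> = ennreal (2 * L powr q m)"
      using L by (simp add: ennreal_plus[symmetric] ennreal_mult[symmetric] del: ennreal_plus)
    also have "L powr q m = 4 powr q m * \<sigma> ^ (2 * m) * 4 ^ m"
    proof -
      have "(4 powr (real d / 2)) powr q m = (4::real) ^ m"
        unfolding powr_powr mult.commute[of "real d / 2"] q(1) by (rule powr_realpow) simp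
      then show ?thesis using \<sigma>_pos unfolding L_def by (simp add: powr_mult \<sigma>q)
    qed
    also have "ennreal (2 * (4 powr q m * \<sigma> ^ (2 * m) * 4 ^ m)) \<le> ennreal (2 * (96 * \<sigma>\<^sup>2) ^ m * fact m)"
    proof (rule ennreal_leI)
      have "(4::real) powr q m \<le> 4 powr (2 * real m)" using q(3) by (intro powr_mono) auto
      also have "\<dots> = (4 powr 2) powr real m" by (simp only: powr_powr)
      also have "\<dots> = 16 ^ m" by (simp add: powr_realpow)
      finally have "4 powr q m * (\<sigma> ^ (2 * m) * 4 ^ m) \<le> 16 ^ m * (\<sigma> ^ (2 * m) * 4 ^ m)"
        using \<sigma>_pos by (intro mult_right_mono) auto
      also have "\<dots> = (16 * (\<sigma>\<^sup>2 * 4)) ^ m" unfolding power_mult_distrib power_mult ..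
      also have "\<dots> = (64 * \<sigma>\<^sup>2) ^ m" by (simp add: mult.commute)
      also have "\<dots> \<le> (96 * \<sigma>\<^sup>2) ^ m" by (intro power_mono) auto
      also have "\<dots> * 1 \<le> (96 * \<sigma>\<^sup>2) ^ m * fact m" by (intro mult_left_mono fact_ge_1) auto
      finally show "2 * (4 powr q m * \<sigma> ^ (2 * m) * 4 ^ m) \<le> 2 * (96 * \<sigma>\<^sup>2) ^ m * fact m" by simp
    qed
    finally show ?thesis .
  qed
  \<comment> \<open>As 96 / 288 = 1/3, the bounds sum to 1 + 2 * (1/2) = 2; the term m = 0 is
    exactly 1, without the factor 2.\<close>
  define b where "b m = (if m = 0 then 1 else 2 * (1 / 3) ^ m :: real)" for m :: nat
  have term_le: "(\<integral>\<^sup>+ x. ennreal (y x ^ m / fact m) \<partial>M) \<le> ennreal (b m)" for m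
  proof (cases "m = 0")
    case True
    then show ?thesis by (simp add: b_def emeasure_space_1)
  next
    case False
    then have m: "m \<ge> 1" by simp
    define C where "C = (1 / 288 / \<sigma>\<^sup>2) ^ m / fact m"
    have C0: "C \<ge> 0" by (simp add: C_def)
    have "(\<integral>\<^sup>+ x. ennreal (y x ^ m / fact m) \<partial>M) = (\<integral>\<^sup>+ x. ennreal C * ennreal (\<bar>f x\<bar> powr q m) \<partial>M)"
      using C0 by (intro nn_integral_cong) (simp add: ym[OF m] C_def flip: ennreal_mult)
    also have "\<dots> = ennreal C * (\<integral>\<^sup>+ x. ennreal (\<bar>f x\<bar> powr q m) \<partial>M)" by (simp add: nn_integral_cmult)
    also have "\<dots> \<le> ennreal C * ennreal (2 * (96 * \<sigma>\<^sup>2) ^ m * fact m)" by (intro mult_left_mono q_moment m) auto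
    also have "\<dots> = ennreal (C * (2 * (96 * \<sigma>\<^sup>2) ^ m * fact m))" using C0 by (simp flip: ennreal_mult)
    also have "C * (2 * (96 * \<sigma>\<^sup>2) ^ m * fact m) = 2 * ((1 / 288 / \<sigma>\<^sup>2) * (96 * \<sigma>\<^sup>2)) ^ m"
      unfolding C_def power_mult_distrib[of "1 / 288 / \<sigma>\<^sup>2"] by simp
    also have "(1 / 288 / \<sigma>\<^sup>2) * (96 * \<sigma>\<^sup>2) = 1 / 3" using \<sigma>_pos by simp
    finally show ?thesis using False by (simp add: b_def)
  qed
  have b_sums: "b sums 2"
  proof -
    have "(\<lambda>m. 2 * (1 / 3) ^ m :: real) sums (2 * (1 / (1 - 1 / 3)))" by (intro sums_mult geometric_sums) simp
    moreover have "(\<lambda>m. if m = 0 then 1 else 0 :: real) sums 1" using sums_single[of 0 "\<lambda>_. 1 :: real"] by simp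
    ultimately have "(\<lambda>m. 2 * (1 / 3) ^ m - (if m = 0 then 1 else 0) :: real) sums (2 * (1 / (1 - 1 / 3)) - 1)" by (rule sums_diff)
    then show ?thesis by (simp add: b_def[abs_def] if_distrib cong: if_cong)
  qed
  have "(\<integral>\<^sup>+ x. ennreal (exp (y x)) \<partial>M) = (\<integral>\<^sup>+ x. (\<Sum>m. ennreal (y x ^ m / fact m)) \<partial>M)"
  proof (rule nn_integral_cong)
    fix x
    have "(\<lambda>m. y x ^ m / fact m) sums exp (y x)"
      using exp_converges[of "y x"] by (simp add: scaleR_conv_of_real divide_inverse mult.commute)
    then show "ennreal (exp (y x)) = (\<Sum>m. ennreal (y x ^ m / fact m))"
      using y0[of x] by (simp add: suminf_ennreal2 sums_iff)
  qed
  also have "\<dots> = (\<Sum>m. \<integral>\<^sup>+ x. ennreal (y x ^ m / fact m) \<partial>M)" by (rule nn_integral_suminf) measurable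
  also have "\<dots> \<le> (\<Sum>m. ennreal (b m))" by (intro suminf_le term_le) auto
  also have "\<dots> = ennreal 2" using b_sums by (subst suminf_ennreal2) (auto simp: sums_iff b_def)
  finally show ?thesis by (simp add: y_def)
qed

end

theorem theorem1p9:
  shows "\<exists>c>0::real. \<forall>(n::nat) (G::(nat \<Rightarrow> real) set) (M::(nat \<Rightarrow> real) measure) (\<sigma>::real) (d::nat)
            (f::(nat \<Rightarrow> real) \<Rightarrow> real).
     openin (Euclidean_space n) G \<longrightarrow>
     prob_space M \<longrightarrow> sets M = sets (restrict_space borel G) \<longrightarrow>
     \<sigma> > 0 \<longrightarrow> log_sobolev n G M (\<sigma>\<^sup>2) \<longrightarrow>
     d \<ge> 1 \<longrightarrow> C_diff_on n d G f \<longrightarrow>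
     integrable M f \<longrightarrow> (\<integral>x. f x \<partial>M) = 0 \<longrightarrow>
     (\<forall>k\<in>{1..<d}. Lp_norm M 2 (deriv_op_norm n k f) \<le> ennreal (min 1 (\<sigma> ^ (d - k)))) \<longrightarrow>
     Lp_norm M \<infinity> (deriv_op_norm n d f) \<le> 1 \<longrightarrow>
     (\<integral>\<^sup>+ x. ennreal (exp (c / \<sigma>\<^sup>2 * \<bar>f x\<bar> powr (2 / real d))) \<partial>M) \<le> 2"
proof (intro exI[of _ "1 / 288 :: real"] conjI allI impI)
  fix n d :: nat and G :: "(nat \<Rightarrow> real) set" and M :: "(nat \<Rightarrow> real) measure" and \<sigma> :: real
    and f :: "(nat \<Rightarrow> real) \<Rightarrow> real"
  assume G: "openin (Euclidean_space n) G" and M: "prob_space M" "sets M = sets (restrict_space borel G)"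
    and \<sigma>: "\<sigma> > 0" and lsi: "log_sobolev n G M (\<sigma>\<^sup>2)" and d: "d \<ge> 1" and f: "C_diff_on n d G f"
    and int: "integrable M f" and mean: "(\<integral>x. f x \<partial>M) = 0"
    and L2: "\<forall>k\<in>{1..<d}. Lp_norm M 2 (deriv_op_norm n k f) \<le> ennreal (min 1 (\<sigma> ^ (d - k)))"
    and top: "Lp_norm M \<infinity> (deriv_op_norm n d f) \<le> 1"
  interpret log_sobolev_space M n G \<sigma>
    using G M \<sigma> lsi by (simp add: log_sobolev_space_def log_sobolev_space_axioms_def)
  show "(\<integral>\<^sup>+ x. ennreal (exp (1 / 288 / \<sigma>\<^sup>2 * \<bar>f x\<bar> powr (2 / real d))) \<partial>M) \<le> 2"
  \<comment> \<open>In dimension 0 there are no unit vectors and an operator norm of positive order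
    is the supremum of an empty set, so this case is settled directly: the space is a single point,
    and mean zero forces \<open>f\<close> to vanish there.\<close>
  proof (cases "n = 0")
    case True
    have sub: "x = (\<lambda>_. 0)" if "x \<in> space M" for x
      using openin_Euclidean_space_imp_zero[OF G, of x] that True by (auto simp: space_M)
    then have "(\<integral>x. f x \<partial>M) = (\<integral>x. f (\<lambda>_. 0) \<partial>M)" by (intro Bochner_Integration.integral_cong) auto
    then have "f (\<lambda>_. 0) = 0" using mean by (simp add: prob_space)
    then have "(\<integral>\<^sup>+ x. ennreal (exp (1 / 288 / \<sigma>\<^sup>2 * \<bar>f x\<bar> powr (2 / real d))) \<partial>M) = (\<integral>\<^sup>+ x. 1 \<partial>M)"
      by (intro nn_integral_cong) (auto dest: sub)
    then show ?thesis by (simp add: emeasure_space_1)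
  next
    case False
    then have n: "n > 0" by simp
    have [measurable]: "deriv_op_norm n d f \<in> borel_measurable M"
      by (rule deriv_op_norm_measurable[OF n f d order_refl])
    have "AE x in M. \<bar>deriv_op_norm n d f x\<bar> \<le> 1"
      using esssup_AE[of "\<lambda>x. ennreal \<bar>deriv_op_norm n d f x\<bar>" M]
    proof eventually_elim
      case (elim x)
      also have "esssup M (\<lambda>x. ennreal \<bar>deriv_op_norm n d f x\<bar>) \<le> 1" using top by (simp add: Lp_norm_def)
      finally show ?case by simp
    qed
    moreover have "(\<integral>\<^sup>+ x. ennreal ((deriv_op_norm n k f x)\<^sup>2) \<partial>M) \<le> ennreal ((\<sigma> ^ (d - k))\<^sup>2)"
      if "1 \<le> k" "k < d" for k
    proof (rule Lp_norm_2_le)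
      have "Lp_norm M 2 (deriv_op_norm n k f) \<le> ennreal (min 1 (\<sigma> ^ (d - k)))" using L2 that by simp
      also have "\<dots> \<le> ennreal (\<sigma> ^ (d - k))" by (intro ennreal_leI) simp
      finally show "Lp_norm M 2 (deriv_op_norm n k f) \<le> ennreal (\<sigma> ^ (d - k))" .
    qed (use \<sigma> in auto)
    ultimately show ?thesis
      using exponential_integrability_of_moments[OF d] moments[OF n d f int mean] int by blast
  qed
qed simp

end
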